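(* Let $\mu$ be a generalized semi-character of $X_+$ with $|\mu(\chi)|=1$ for all $\chi\in X_+$. An operator $A$ between the spaces $H^2(G)$ and $H^2_-(G)$ is bounded and $\mu$-Hankel if and only if $A=H_\varphi U$ for some unitary operator $Uf(x):=f(gx)$ in $H^2(G)$ ($g\in G$) and a Hankel operator $H_\varphi$ on $G$ with $\varphi\in L^\infty(G)$. In this case, $$\|A\|=\mathrm{dist}_{L^\infty}(\varphi,H^\infty(G)).$$
   Context: $G$ is a compact connected Abelian group with normalized Haar measure, $X$ is its (discrete, multiplicatively written) dual group of continuous characters, viewed as functions on $G$, and a total order compatible with the group structure is fixed on $X$. $\chi_0\equiv 1$ is the unit character, $X_+=\{\chi\in X:\chi\ge\chi_0\}$ and $X_-=X\setminus X_+=\{\overline{\xi}:\xi\in X_+\setminus\{\chi_0\}\}$, where the bar is complex conjugation (so $\overline{\xi}=\xi^{-1}$). $H^2(G)=\{f\in L^2(G):\widehat f(\chi)=0\ \forall\chi\in X_-\}$, where $\widehat f$ is the Fourier transform, and $H^2_-(G)=L^2(G)\ominus H^2(G)$; $X_+$ and $X_-$ are orthonormal bases of $H^2(G)$ and $H^2_-(G)$ respectively. $\langle\cdot,\cdot\rangle$ is the inner product of $L^2(G)$; $P_-$ is the orthogonal projection of $L^2(G)$ onto $H^2_-(G)$; $H^\infty(G)=\{f\in L^\infty(G):\widehat f(\chi)=0\ \forall\chi\in X_-\}$. For $\varphi\in L^\infty(G)$ the Hankel operator $H_\varphi:H^2(G)\to H^2_-(G)$ on $G$ with symbol $\varphi$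 is the bounded operator $H_\varphi f=P_-(\varphi f)$. A generalized semi-character of $X_+$ is a non-null (not identically zero) homomorphism $\mu$ of the semigroup $X_+$ into the multiplicative semigroup $\mathbb{C}$. A linear operator $A$ between $H^2(G)$ and $H^2_-(G)$, defined at least on the linear subspace $\mathrm{span}(X_+)$ of $H^2(G)$, is called $\mu$-Hankel if there is a function $a:X_+\setminus\{\chi_0\}\to\mathbb{C}$ such that $\langle A\chi,\overline{\xi}\rangle=\mu(\chi)a(\chi\xi)$ for all $\chi\in X_+$, $\xi\in X_+\setminus\{\chi_0\}$.
   Formalization: The translation U (the element g) is chosen depending only on μ, before A; with g chosen freely after A the "if" direction fails (circle group, μ=1, g=-1, φ the conjugate of z²). The norm formula is proved for every representation A=H_φU. *)

theory Defs
  imports "HOL-Probability.Probability"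
begin

text \<open>
  The compact group is a type written additively, so that \<open>g x\<close> becomes \<open>g + x\<close>. Its dual consists
  of functions on the group with pointwise multiplication. Elements of the Lebesgue spaces are
  represented by measurable functions, and identities between them are identities almost everywhere.
\<close>

definition normalized_haar :: "'g::topological_ab_group_add measure \<Rightarrow> bool" where
  "normalized_haar M \<longleftrightarrow>
     sets M = sets borel \<and> prob_space M \<and>
     (\<forall>g. distr M borel ((+) g) = M) \<and>
     (\<forall>B\<in>sets borel. emeasure M B = (INF V\<in>{V. open V \<and> B \<subseteq> V}. emeasure M V)) \<and>
     (\<forall>V. open V \<longrightarrow> emeasure M V = (SUP K\<in>{K. compact K \<and> K \<subseteq> V}. emeasure M K))"

definition dual :: "('g::topological_ab_group_add \<Rightarrow> complex) set" where
  "dual = {\<gamma>. continuous_on UNIV \<gamma> \<and> (\<forall>x. cmod (\<gamma> x) = 1) \<and> (\<forall>x y. \<gamma> (x + y) = \<gamma> x * \<gamma> y)}"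

definition fmult :: "('g \<Rightarrow> complex) \<Rightarrow> ('g \<Rightarrow> complex) \<Rightarrow> 'g \<Rightarrow> complex"  (infixl \<open>\<cdot>\<^sub>f\<close> 70) where
  "f \<cdot>\<^sub>f h = (\<lambda>x. f x * h x)"

definition fcnj :: "('g \<Rightarrow> complex) \<Rightarrow> 'g \<Rightarrow> complex" where
  "fcnj f = (\<lambda>x. cnj (f x))"

definition unit_char :: "'g \<Rightarrow> complex" where
  "unit_char = (\<lambda>x. 1)"

text \<open>In the relation \<open>r\<close>, a pair \<open>(\<gamma>, \<psi>)\<close> means \<open>\<gamma> \<le> \<psi>\<close>.\<close>

definition dual_order :: "('g::topological_ab_group_add \<Rightarrow> complex) rel \<Rightarrow> bool" where
  "dual_order r \<longleftrightarrow> linear_order_on dual r \<and>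
     (\<forall>\<gamma>\<in>dual. \<forall>\<psi>\<in>dual. \<forall>\<eta>\<in>dual. (\<gamma>, \<psi>) \<in> r \<longrightarrow> (\<gamma> \<cdot>\<^sub>f \<eta>, \<psi> \<cdot>\<^sub>f \<eta>) \<in> r)"

definition X_plus :: "('g::topological_ab_group_add \<Rightarrow> complex) rel \<Rightarrow> ('g \<Rightarrow> complex) set" where
  "X_plus r = {\<gamma>\<in>dual. (unit_char, \<gamma>) \<in> r}"

definition X_minus :: "('g::topological_ab_group_add \<Rightarrow> complex) rel \<Rightarrow> ('g \<Rightarrow> complex) set" where
  "X_minus r = dual - X_plus r"

definition generalized_semicharacter ::
    "('g::topological_ab_group_add \<Rightarrow> complex) rel \<Rightarrow> (('g \<Rightarrow> complex) \<Rightarrow> complex) \<Rightarrow> bool" where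
  "generalized_semicharacter r \<mu> \<longleftrightarrow>
     (\<forall>\<gamma>\<in>X_plus r. \<forall>\<psi>\<in>X_plus r. \<mu> (\<gamma> \<cdot>\<^sub>f \<psi>) = \<mu> \<gamma> * \<mu> \<psi>) \<and> (\<exists>\<gamma>\<in>X_plus r. \<mu> \<gamma> \<noteq> 0)"

definition L2 :: "'g measure \<Rightarrow> ('g \<Rightarrow> complex) set" where
  "L2 M = {f. f \<in> borel_measurable M \<and> integrable M (\<lambda>x. (cmod (f x))\<^sup>2)}"

definition L2_inner :: "'g measure \<Rightarrow> ('g \<Rightarrow> complex) \<Rightarrow> ('g \<Rightarrow> complex) \<Rightarrow> complex" where
  "L2_inner M f h = (\<integral>x. f x * cnj (h x) \<partial>M)"

definition L2_norm :: "'g measure \<Rightarrow> ('g \<Rightarrow> complex) \<Rightarrow> real" where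
  "L2_norm M f = sqrt (\<integral>x. (cmod (f x))\<^sup>2 \<partial>M)"

definition L_infty :: "'g measure \<Rightarrow> ('g \<Rightarrow> complex) set" where
  "L_infty M = {f. f \<in> borel_measurable M \<and> esssup M (\<lambda>x. ereal (cmod (f x))) < \<infinity>}"

definition L_infty_norm :: "'g measure \<Rightarrow> ('g \<Rightarrow> complex) \<Rightarrow> real" where
  "L_infty_norm M f = real_of_ereal (esssup M (\<lambda>x. ereal (cmod (f x))))"

definition L_infty_dist :: "'g measure \<Rightarrow> ('g \<Rightarrow> complex) \<Rightarrow> ('g \<Rightarrow> complex) set \<Rightarrow> real" where
  "L_infty_dist M \<phi> S = (INF h\<in>S. L_infty_norm M (\<lambda>x. \<phi> x - h x))"

definition fourier :: "'g measure \<Rightarrow> ('g \<Rightarrow> complex) \<Rightarrow> ('g \<Rightarrow> complex) \<Rightarrow> complex" where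
  "fourier M f \<gamma> = (\<integral>x. f x * cnj (\<gamma> x) \<partial>M)"

definition H2 :: "'g::topological_ab_group_add measure \<Rightarrow> ('g \<Rightarrow> complex) rel \<Rightarrow> ('g \<Rightarrow> complex) set" where
  "H2 M r = {f\<in>L2 M. \<forall>\<gamma>\<in>X_minus r. fourier M f \<gamma> = 0}"

definition H2_minus ::
    "'g::topological_ab_group_add measure \<Rightarrow> ('g \<Rightarrow> complex) rel \<Rightarrow> ('g \<Rightarrow> complex) set" where
  "H2_minus M r = {f\<in>L2 M. \<forall>h\<in>H2 M r. L2_inner M f h = 0}"

definition H_infty ::
    "'g::topological_ab_group_add measure \<Rightarrow> ('g \<Rightarrow> complex) rel \<Rightarrow> ('g \<Rightarrow> complex) set" where
  "H_infty M r = {f\<in>L_infty M. \<forall>\<gamma>\<in>X_minus r. fourier M f \<gamma> = 0}"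

text \<open>The representative chosen here is determined only up to equality almost everywhere.\<close>

definition orth_proj :: "'g measure \<Rightarrow> ('g \<Rightarrow> complex) set \<Rightarrow> ('g \<Rightarrow> complex) \<Rightarrow> 'g \<Rightarrow> complex" where
  "orth_proj M S f = (SOME p. p \<in> S \<and> (\<forall>h\<in>S. L2_inner M (\<lambda>x. f x - p x) h = 0))"

definition P_minus ::
    "'g::topological_ab_group_add measure \<Rightarrow> ('g \<Rightarrow> complex) rel \<Rightarrow> ('g \<Rightarrow> complex) \<Rightarrow> 'g \<Rightarrow> complex" where
  "P_minus M r = orth_proj M (H2_minus M r)"

definition Hankel ::
    "'g::topological_ab_group_add measure \<Rightarrow> ('g \<Rightarrow> complex) rel \<Rightarrow> ('g \<Rightarrow> complex) \<Rightarrow>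
     ('g \<Rightarrow> complex) \<Rightarrow> 'g \<Rightarrow> complex" where
  "Hankel M r \<phi> f = P_minus M r (\<phi> \<cdot>\<^sub>f f)"

definition translation :: "'g::topological_ab_group_add \<Rightarrow> ('g \<Rightarrow> complex) \<Rightarrow> 'g \<Rightarrow> complex" where
  "translation g f = (\<lambda>x. f (g + x))"

definition char_span :: "('g \<Rightarrow> complex) set \<Rightarrow> ('g \<Rightarrow> complex) set" where
  "char_span S = {\<lambda>x. \<Sum>\<gamma>\<in>F. c \<gamma> * \<gamma> x | F c. finite F \<and> F \<subseteq> S}"

text \<open>
  An operator is given by its domain \<open>D\<close>, a linear subspace with
  \<open>span(X\<^sub>+) \<subseteq> D \<subseteq> H\<^sup>2\<close> that is saturated under equality almost everywhere, and by a map \<open>A\<close>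
  on representatives. The values of \<open>A\<close> outside \<open>D\<close> are irrelevant.
\<close>

definition domain_between ::
    "'g::topological_ab_group_add measure \<Rightarrow> ('g \<Rightarrow> complex) rel \<Rightarrow> ('g \<Rightarrow> complex) set \<Rightarrow> bool" where
  "domain_between M r D \<longleftrightarrow>
     char_span (X_plus r) \<subseteq> D \<and> D \<subseteq> H2 M r \<and>
     (\<forall>f\<in>D. \<forall>h\<in>D. (\<lambda>x. f x + h x) \<in> D) \<and>
     (\<forall>f\<in>D. \<forall>c. (\<lambda>x. c * f x) \<in> D) \<and>
     (\<forall>f\<in>D. \<forall>h\<in>L2 M. (AE x in M. f x = h x) \<longrightarrow> h \<in> D)"

definition linear_operator_between ::
    "'g::topological_ab_group_add measure \<Rightarrow> ('g \<Rightarrow> complex) rel \<Rightarrow> ('g \<Rightarrow> complex) set \<Rightarrow>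
     (('g \<Rightarrow> complex) \<Rightarrow> 'g \<Rightarrow> complex) \<Rightarrow> bool" where
  "linear_operator_between M r D A \<longleftrightarrow>
     domain_between M r D \<and>
     (\<forall>f\<in>D. A f \<in> H2_minus M r) \<and>
     (\<forall>f\<in>D. \<forall>h\<in>D. (AE x in M. f x = h x) \<longrightarrow> (AE x in M. A f x = A h x)) \<and>
     (\<forall>f\<in>D. \<forall>h\<in>D. AE x in M. A (\<lambda>y. f y + h y) x = A f x + A h x) \<and>
     (\<forall>f\<in>D. \<forall>c. AE x in M. A (\<lambda>y. c * f y) x = c * A f x)"

definition op_eq ::
    "'g measure \<Rightarrow> ('g \<Rightarrow> complex) set \<Rightarrow> (('g \<Rightarrow> complex) \<Rightarrow> 'g \<Rightarrow> complex) \<Rightarrow>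
     (('g \<Rightarrow> complex) \<Rightarrow> 'g \<Rightarrow> complex) \<Rightarrow> bool" where
  "op_eq M D A B \<longleftrightarrow> (\<forall>f\<in>D. AE x in M. A f x = B f x)"

definition bounded_operator ::
    "'g measure \<Rightarrow> ('g \<Rightarrow> complex) set \<Rightarrow> (('g \<Rightarrow> complex) \<Rightarrow> 'g \<Rightarrow> complex) \<Rightarrow> bool" where
  "bounded_operator M D A \<longleftrightarrow> (\<exists>C. \<forall>f\<in>D. L2_norm M (A f) \<le> C * L2_norm M f)"

definition op_norm ::
    "'g measure \<Rightarrow> ('g \<Rightarrow> complex) set \<Rightarrow> (('g \<Rightarrow> complex) \<Rightarrow> 'g \<Rightarrow> complex) \<Rightarrow> real" where
  "op_norm M D A = (SUP f\<in>{f\<in>D. L2_norm M f \<le> 1}. L2_norm M (A f))"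

definition mu_Hankel ::
    "'g::topological_ab_group_add measure \<Rightarrow> ('g \<Rightarrow> complex) rel \<Rightarrow> (('g \<Rightarrow> complex) \<Rightarrow> complex) \<Rightarrow>
     (('g \<Rightarrow> complex) \<Rightarrow> 'g \<Rightarrow> complex) \<Rightarrow> bool" where
  "mu_Hankel M r \<mu> A \<longleftrightarrow>
     (\<exists>a :: ('g \<Rightarrow> complex) \<Rightarrow> complex. \<forall>\<gamma>\<in>X_plus r. \<forall>\<xi>\<in>X_plus r - {unit_char}.
        L2_inner M (A \<gamma>) (fcnj \<xi>) = \<mu> \<gamma> * a (\<gamma> \<cdot>\<^sub>f \<xi>))"

end

theory Submission
  imports Defs
begin

text \<open>
  Write \<open>X\<^sub>+\<close> and \<open>X\<^sub>-\<close> for the two halves of the dual, \<open>U\<close> for translation by \<open>g\<close>, and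
  \<open>P\<^sub>-\<close> for the projection onto \<open>H\<^sup>2\<^sub>-\<close>.

  The semi-character \<open>\<mu>\<close> extends to a homomorphism from the whole dual to the unit circle, and such a
  homomorphism is evaluation at a point \<open>g\<close> of the compact group (\<open>dual_hom_point\<close>). Therefore
  \<open>U \<gamma> = \<mu>(\<gamma>) \<gamma>\<close> for \<open>\<gamma>\<close> in \<open>X\<^sub>+\<close>, and an operator \<open>A\<close> is \<open>\<mu>\<close>-Hankel exactly if the entries of
  \<open>B = A U\<^sup>-\<^sup>1\<close>, the numbers \<open>\<langle>B \<gamma>, \<xi>\<^sup>*\<rangle>\<close>, depend on \<open>\<gamma> \<xi>\<close> only. This reduces the theorem to
  ordinary Hankel operators: a bounded \<open>B\<close> of this kind has the form \<open>f \<mapsto> P\<^sub>- (\<phi> f)\<close> for a bounded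
  \<open>\<phi>\<close>, and \<open>\<phi>\<close> can be chosen with supremum norm at most the norm of \<open>B\<close> (\<open>Nehari\<close>). Two symbols give
  the same operator exactly if they differ by an element of \<open>H\<^sup>\<infinity>\<close>, so the second statement is the
  formula for the norm.

  Put \<open>b = B 1\<close>. By hypothesis \<open>\<bar>\<integral> b u v\<bar> \<le> C \<parallel>u\<parallel> \<parallel>v\<parallel>\<close> for \<open>u\<close> in \<open>H\<^sup>2\<close> and for \<open>v\<close> in \<open>H\<^sup>2\<close> with
  mean zero, at first for polynomials. A polynomial \<open>f\<close> in the positive characters
  is a product \<open>u v\<close> with both \<open>\<parallel>u\<parallel>\<^sup>2\<close> and \<open>\<parallel>v\<parallel>\<^sup>2\<close> arbitrarily close to \<open>\<integral> \<bar>f\<bar>\<close>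
  (\<open>analytic_polynomial_factorization\<close>), so that \<open>\<bar>\<integral> b f\<bar> \<le> C \<integral> \<bar>f\<bar>\<close>. A functional with this
  bound is represented by a function of modulus at most \<open>C\<close>
  (\<open>L1_bounded_functional_representation\<close>), and this function is \<open>\<phi>\<close>.

  Two facts about \<open>L\<^sup>2\<close> carry the analysis. One is completeness, used through projections and through
  intersections of nested convex sets. The other is that an integrable function is determined by its
  Fourier coefficients (\<open>fourier_unique_AE\<close>), the theorem of Peter and Weyl for this group. For it one has to
  produce a character \<open>\<gamma>\<close> with \<open>\<integral> f \<gamma>\<^sup>* \<noteq> 0\<close> from a continuous function \<open>f \<noteq> 0\<close>. The even convolution
  powers of a hermitian kernel, suitably normalised, converge to an idempotent kernel
  (\<open>hermitian_kernel_top_idempotent\<close>), and a minimal idempotent is a multiple of a character.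
\<close>

section \<open>Square-integrable functions\<close>

lemma L2_measurable [measurable_dest]: "f \<in> L2 M \<Longrightarrow> f \<in> borel_measurable M"
  by (simp add: L2_def)

lemma L2_integrable_square: "f \<in> L2 M \<Longrightarrow> integrable M (\<lambda>x. (cmod (f x))\<^sup>2)"
  by (simp add: L2_def)

lemma L2_integrable_mult:
  assumes "f \<in> L2 M" "h \<in> L2 M"
  shows "integrable M (\<lambda>x. f x * h x)"
proof (rule Bochner_Integration.integrable_bound)
  show "integrable M (\<lambda>x. (cmod (f x))\<^sup>2 + (cmod (h x))\<^sup>2)"
    using assms by (auto simp: L2_def)
  show "(\<lambda>x. f x * h x) \<in> borel_measurable M"
    using assms by (auto simp: L2_def)
  have "cmod (f x) * cmod (h x) \<le> (cmod (f x))\<^sup>2 + (cmod (h x))\<^sup>2" for x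
  proof -
    have "2 * (cmod (f x) * cmod (h x)) \<le> (cmod (f x))\<^sup>2 + (cmod (h x))\<^sup>2"
      using sum_squares_bound[of "cmod (f x)" "cmod (h x)"] by simp
    moreover have "0 \<le> cmod (f x) * cmod (h x)" by simp
    ultimately show ?thesis by linarith
  qed
  then show "AE x in M. norm (f x * h x) \<le> norm ((cmod (f x))\<^sup>2 + (cmod (h x))\<^sup>2)"
    by (simp add: norm_mult)
qed

lemma L2_dominated:
  assumes "f \<in> L2 M" "h \<in> borel_measurable M" "AE x in M. cmod (h x) \<le> c * cmod (f x)"
  shows "h \<in> L2 M"
proof -
  have "integrable M (\<lambda>x. (cmod (h x))\<^sup>2)"
  proof (rule Bochner_Integration.integrable_bound)
    show "integrable M (\<lambda>x. c\<^sup>2 * (cmod (f x))\<^sup>2)"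
      using assms by (auto simp: L2_def)
    show "(\<lambda>x. (cmod (h x))\<^sup>2) \<in> borel_measurable M"
      using assms by auto
    show "AE x in M. norm ((cmod (h x))\<^sup>2) \<le> norm (c\<^sup>2 * (cmod (f x))\<^sup>2)"
      using assms(3)
    proof eventually_elim
      case (elim x)
      have "(cmod (h x))\<^sup>2 \<le> (c * cmod (f x))\<^sup>2"
        using elim by (intro power_mono) auto
      then show ?case by (simp add: power_mult_distrib)
    qed
  qed
  then show ?thesis using assms by (simp add: L2_def)
qed

lemma borel_measurable_cnj [measurable]:
  assumes "f \<in> borel_measurable M"
  shows "(\<lambda>x. cnj (f x)) \<in> borel_measurable M"
  by (rule measurable_compose[OF assms])
     (intro borel_measurable_continuous_onI continuous_intros)

lemma L2_fcnj: "f \<in> L2 M \<Longrightarrow> fcnj f \<in> L2 M"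
  by (auto simp: L2_def fcnj_def)

lemma L2_cnj: "f \<in> L2 M \<Longrightarrow> (\<lambda>x. cnj (f x)) \<in> L2 M"
  using L2_fcnj[of f M] by (simp add: fcnj_def)

lemma L2_integrable_inner:
  assumes "f \<in> L2 M" "h \<in> L2 M"
  shows "integrable M (\<lambda>x. f x * cnj (h x))"
  using L2_integrable_mult[OF assms(1) L2_cnj[OF assms(2)]] .

lemma L2_zero [simp]: "(\<lambda>x. 0) \<in> L2 M"
  by (simp add: L2_def)

lemma L2_cmult:
  assumes "f \<in> L2 M"
  shows "(\<lambda>x. c * f x) \<in> L2 M"
  by (rule L2_dominated[OF assms, where c = "cmod c"]) (use assms in \<open>auto simp: norm_mult L2_def\<close>)

lemma L2_add:
  assumes "f \<in> L2 M" "h \<in> L2 M"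
  shows "(\<lambda>x. f x + h x) \<in> L2 M"
proof -
  have "(cmod (f x + h x))\<^sup>2 = (cmod (f x))\<^sup>2 + (cmod (h x))\<^sup>2 + 2 * Re (f x * cnj (h x))" for x
    unfolding cmod_power2 by (simp add: power2_eq_square algebra_simps)
  moreover have "integrable M (\<lambda>x. (cmod (f x))\<^sup>2 + (cmod (h x))\<^sup>2 + 2 * Re (f x * cnj (h x)))"
    by (intro Bochner_Integration.integrable_add integrable_mult_right integrable_Re
        L2_integrable_inner L2_integrable_square assms)
  ultimately show ?thesis
    using assms by (auto simp: L2_def)
qed

lemma L2_uminus: "f \<in> L2 M \<Longrightarrow> (\<lambda>x. - f x) \<in> L2 M"
  using L2_cmult[of f M "-1"] by simp

lemma L2_diff: "f \<in> L2 M \<Longrightarrow> h \<in> L2 M \<Longrightarrow> (\<lambda>x. f x - h x) \<in> L2 M"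
  using L2_add[OF _ L2_uminus, of f M h] by simp

lemma L2_bounded_mult:
  assumes "f \<in> L2 M" "h \<in> borel_measurable M" "AE x in M. cmod (h x) \<le> C"
  shows "(\<lambda>x. h x * f x) \<in> L2 M"
proof (rule L2_dominated[OF assms(1), where c = C])
  show "(\<lambda>x. h x * f x) \<in> borel_measurable M"
    using assms by (auto simp: L2_def)
  show "AE x in M. cmod (h x * f x) \<le> C * cmod (f x)"
    using assms(3) by eventually_elim (auto simp: norm_mult intro!: mult_right_mono)
qed

lemma L2_norm_nonneg [simp]: "0 \<le> L2_norm M f"
  by (simp add: L2_norm_def)

lemma L2_norm_power2: "(L2_norm M f)\<^sup>2 = (\<integral>x. (cmod (f x))\<^sup>2 \<partial>M)"
  by (simp add: L2_norm_def)

lemma L2_norm_zero [simp]: "L2_norm M (\<lambda>x. 0) = 0"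
  by (simp add: L2_norm_def)

lemma L2_inner_self: "L2_inner M f f = of_real ((L2_norm M f)\<^sup>2)"
proof -
  have "f x * cnj (f x) = of_real ((cmod (f x))\<^sup>2)" for x
    by (rule complex_norm_square[symmetric])
  then have "L2_inner M f f = (\<integral>x. of_real ((cmod (f x))\<^sup>2) \<partial>M)"
    unfolding L2_inner_def by presburger
  then show ?thesis
    unfolding L2_norm_power2 by (subst (asm) integral_complex_of_real)
qed

lemma L2_norm_cong_AE:
  assumes "AE x in M. f x = h x" "f \<in> borel_measurable M" "h \<in> borel_measurable M"
  shows "L2_norm M f = L2_norm M h"
proof -
  have "(\<integral>x. (cmod (f x))\<^sup>2 \<partial>M) = (\<integral>x. (cmod (h x))\<^sup>2 \<partial>M)"
    by (rule integral_cong_AE) (use assms in auto)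
  then show ?thesis by (simp add: L2_norm_def)
qed

lemma L2_inner_cong_AE:
  assumes "AE x in M. f x = h x" "f \<in> borel_measurable M" "h \<in> borel_measurable M"
    and "k \<in> borel_measurable M"
  shows "L2_inner M f k = L2_inner M h k"
  unfolding L2_inner_def by (rule integral_cong_AE) (use assms in auto)

lemma L2_norm_eq_0_AE:
  assumes "f \<in> L2 M" "L2_norm M f = 0"
  shows "AE x in M. f x = 0"
proof -
  have "(\<integral>x. (cmod (f x))\<^sup>2 \<partial>M) = 0" using assms by (simp add: L2_norm_def)
  then have "AE x in M. (cmod (f x))\<^sup>2 = 0"
    using assms by (subst (asm) integral_nonneg_eq_0_iff_AE) (auto simp: L2_def)
  then show ?thesis by simp
qed

lemma L2_inner_diff:
  assumes "f \<in> L2 M" "h \<in> L2 M" "k \<in> L2 M"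
  shows "L2_inner M (\<lambda>x. f x - h x) k = L2_inner M f k - L2_inner M h k"
  unfolding L2_inner_def
  by (simp add: left_diff_distrib L2_integrable_inner assms)

lemma L2_inner_add:
  assumes "f \<in> L2 M" "h \<in> L2 M" "k \<in> L2 M"
  shows "L2_inner M (\<lambda>x. f x + h x) k = L2_inner M f k + L2_inner M h k"
  unfolding L2_inner_def
  by (simp add: distrib_right L2_integrable_inner assms)

lemma L2_inner_cmult: "L2_inner M (\<lambda>x. c * f x) k = c * L2_inner M f k"
  unfolding L2_inner_def by (simp add: mult.assoc)

lemma L2_inner_cnj: "cnj (L2_inner M f h) = L2_inner M h f"
  unfolding L2_inner_def by (subst Bochner_Integration.integral_cnj[symmetric]) (simp add: mult.commute)

lemma L2_norm_cmult: "L2_norm M (\<lambda>x. c * f x) = cmod c * L2_norm M f"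
  by (simp add: L2_norm_def norm_mult power_mult_distrib real_sqrt_mult)

lemma L2_norm_uminus [simp]: "L2_norm M (\<lambda>x. - f x) = L2_norm M f"
  by (simp add: L2_norm_def)

lemma L2_norm_minus_commute: "L2_norm M (\<lambda>x. f x - h x) = L2_norm M (\<lambda>x. h x - f x)"
  by (simp add: L2_norm_def norm_minus_commute)

lemma L2_norm_add_power2:
  assumes "f \<in> L2 M" "h \<in> L2 M"
  shows "(L2_norm M (\<lambda>x. f x + h x))\<^sup>2 =
    (L2_norm M f)\<^sup>2 + (L2_norm M h)\<^sup>2 + 2 * Re (L2_inner M f h)"
proof -
  define g where "g x = Re (f x * cnj (h x))" for x
  have *: "(cmod (f x + h x))\<^sup>2 = (cmod (f x))\<^sup>2 + (cmod (h x))\<^sup>2 + 2 * g x" for x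
    unfolding cmod_power2 g_def by (simp add: power2_eq_square algebra_simps)
  have "(\<integral>x. g x \<partial>M) = Re (L2_inner M f h)"
    unfolding L2_inner_def g_def by (rule integral_Re) (rule L2_integrable_inner[OF assms])
  moreover have "integrable M g"
    unfolding g_def by (intro integrable_Re L2_integrable_inner assms)
  ultimately show ?thesis
    unfolding L2_norm_power2 * using assms by (simp add: L2_integrable_square)
qed

lemma L2_norm_diff_power2:
  assumes "f \<in> L2 M" "h \<in> L2 M"
  shows "(L2_norm M (\<lambda>x. f x - h x))\<^sup>2 =
    (L2_norm M f)\<^sup>2 + (L2_norm M h)\<^sup>2 - 2 * Re (L2_inner M f h)"
proof -
  have "L2_inner M f (\<lambda>x. - h x) = - L2_inner M f h"
    by (simp add: L2_inner_def)
  then show ?thesis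
    using L2_norm_add_power2[OF assms(1) L2_uminus[OF assms(2)]] by simp
qed

lemma L2_parallelogram:
  assumes "f \<in> L2 M" "h \<in> L2 M"
  shows "(L2_norm M (\<lambda>x. f x - h x))\<^sup>2 + (L2_norm M (\<lambda>x. f x + h x))\<^sup>2 =
    2 * (L2_norm M f)\<^sup>2 + 2 * (L2_norm M h)\<^sup>2"
  using L2_norm_add_power2[OF assms] L2_norm_diff_power2[OF assms] by simp

lemma L2_integral_norm_mult_le:
  assumes "f \<in> L2 M" "h \<in> L2 M"
  shows "(\<integral>x. cmod (f x) * cmod (h x) \<partial>M) \<le> L2_norm M f * L2_norm M h"
proof -
  define a where "a = (\<integral>x. (cmod (f x))\<^sup>2 \<partial>M)"
  define b where "b = (\<integral>x. (cmod (h x))\<^sup>2 \<partial>M)"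
  define c where "c = (\<integral>x. cmod (f x) * cmod (h x) \<partial>M)"
  have int: "integrable M (\<lambda>x. cmod (f x) * cmod (h x))"
    using integrable_norm[OF L2_integrable_mult[OF assms]] by (simp add: norm_mult)
  have pos: "0 \<le> a * t\<^sup>2 - 2 * c * t + b" for t
  proof -
    have "0 \<le> (\<integral>x. (t * cmod (f x) - cmod (h x))\<^sup>2 \<partial>M)" by simp
    also have "\<dots> = (\<integral>x. t\<^sup>2 * (cmod (f x))\<^sup>2 - 2 * t * (cmod (f x) * cmod (h x)) + (cmod (h x))\<^sup>2 \<partial>M)"
      by (simp add: power2_eq_square algebra_simps)
    also have "\<dots> = t\<^sup>2 * a - 2 * t * c + b"
      unfolding a_def b_def c_def using int assms by (simp add: L2_integrable_square)
    finally show ?thesis by (simp add: algebra_simps)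
  qed
  have nn: "0 \<le> a" "0 \<le> b" "0 \<le> c" by (simp_all add: a_def b_def c_def)
  have "c\<^sup>2 \<le> a * b"
  proof (cases "a = 0")
    case True
    have "c = 0"
    proof (rule ccontr)
      assume "c \<noteq> 0"
      then show False using pos[of "(b + 1) / (2 * c)"] True nn by (simp add: field_simps)
    qed
    then show ?thesis using True by simp
  next
    case False
    then have "a > 0" using nn by simp
    have "a * (c / a)\<^sup>2 - 2 * c * (c / a) + b = b - c\<^sup>2 / a"
      using \<open>a > 0\<close> by (simp add: power2_eq_square field_simps)
    with pos[of "c / a"] have "c\<^sup>2 / a \<le> b" by simp
    with \<open>a > 0\<close> show ?thesis by (simp add: divide_le_eq mult.commute)
  qed
  then have "c \<le> sqrt (a * b)" using nn by (simp add: real_le_rsqrt)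
  then show ?thesis by (simp add: real_sqrt_mult L2_norm_def a_def b_def c_def)
qed

lemma L2_Cauchy_Schwarz_mult:
  assumes "f \<in> L2 M" "h \<in> L2 M"
  shows "cmod (\<integral>x. f x * h x \<partial>M) \<le> L2_norm M f * L2_norm M h"
proof -
  have "cmod (\<integral>x. f x * h x \<partial>M) \<le> (\<integral>x. cmod (f x) * cmod (h x) \<partial>M)"
    using integral_norm_bound[of M "\<lambda>x. f x * h x"] by (simp add: norm_mult)
  then show ?thesis using L2_integral_norm_mult_le[OF assms] by linarith
qed

lemma L2_Cauchy_Schwarz:
  assumes "f \<in> L2 M" "h \<in> L2 M"
  shows "cmod (L2_inner M f h) \<le> L2_norm M f * L2_norm M h"
  using L2_Cauchy_Schwarz_mult[OF assms(1) L2_cnj[OF assms(2)]]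
  by (simp add: L2_inner_def L2_norm_def)

lemma L2_norm_triangle:
  assumes "f \<in> L2 M" "h \<in> L2 M"
  shows "L2_norm M (\<lambda>x. f x + h x) \<le> L2_norm M f + L2_norm M h"
proof (rule power2_le_imp_le)
  have "Re (L2_inner M f h) \<le> L2_norm M f * L2_norm M h"
    using L2_Cauchy_Schwarz[OF assms] complex_Re_le_cmod order_trans by blast
  then show "(L2_norm M (\<lambda>x. f x + h x))\<^sup>2 \<le> (L2_norm M f + L2_norm M h)\<^sup>2"
    unfolding L2_norm_add_power2[OF assms] by (simp add: power2_sum)
qed simp

lemma L2_norm_triangle_diff:
  assumes "f \<in> L2 M" "h \<in> L2 M" "k \<in> L2 M"
  shows "L2_norm M (\<lambda>x. f x - k x) \<le> L2_norm M (\<lambda>x. f x - h x) + L2_norm M (\<lambda>x. h x - k x)"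
  using L2_norm_triangle[OF L2_diff[OF assms(1,2)] L2_diff[OF assms(2,3)]] by simp

lemma L2_norm_le_add_diff:
  assumes "f \<in> L2 M" "h \<in> L2 M"
  shows "L2_norm M f \<le> L2_norm M h + L2_norm M (\<lambda>x. f x - h x)"
  using L2_norm_triangle[OF assms(2) L2_diff[OF assms]] by simp

lemma L2_norm_tendsto:
  assumes "\<And>n. F n \<in> L2 M" "f \<in> L2 M" "(\<lambda>n. L2_norm M (\<lambda>x. F n x - f x)) \<longlonglongrightarrow> 0"
  shows "(\<lambda>n. L2_norm M (F n)) \<longlonglongrightarrow> L2_norm M f"
proof (rule LIM_zero_cancel, rule tendsto_rabs_zero_cancel, rule tendsto_sandwich[OF _ _ tendsto_const assms(3)])
  show "\<forall>\<^sub>F n in sequentially. \<bar>L2_norm M (F n) - L2_norm M f\<bar> \<le> L2_norm M (\<lambda>x. F n x - f x)"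
  proof (rule always_eventually, rule allI)
    fix n
    show "\<bar>L2_norm M (F n) - L2_norm M f\<bar> \<le> L2_norm M (\<lambda>x. F n x - f x)"
      using L2_norm_le_add_diff[OF assms(1)[of n] assms(2)] L2_norm_le_add_diff[OF assms(2) assms(1)[of n]]
      by (simp add: L2_norm_minus_commute[of M f] abs_le_iff)
  qed
qed simp

lemma L2_integral_mult_tendsto:
  assumes "\<And>n. F n \<in> L2 M" "f \<in> L2 M" "(\<lambda>n. L2_norm M (\<lambda>x. F n x - f x)) \<longlonglongrightarrow> 0" "h \<in> L2 M"
  shows "(\<lambda>n. \<integral>x. F n x * h x \<partial>M) \<longlonglongrightarrow> (\<integral>x. f x * h x \<partial>M)"
proof (rule LIM_zero_cancel, rule Lim_null_comparison)
  show "(\<lambda>n. L2_norm M (\<lambda>x. F n x - f x) * L2_norm M h) \<longlonglongrightarrow> 0"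
    using tendsto_mult_right[OF assms(3)] by simp
  have "cmod ((\<integral>x. F n x * h x \<partial>M) - (\<integral>x. f x * h x \<partial>M)) \<le>
      L2_norm M (\<lambda>x. F n x - f x) * L2_norm M h" for n
  proof -
    have "(\<integral>x. F n x * h x \<partial>M) - (\<integral>x. f x * h x \<partial>M) = (\<integral>x. (F n x - f x) * h x \<partial>M)"
      by (simp add: left_diff_distrib L2_integrable_mult assms)
    then show ?thesis
      using L2_Cauchy_Schwarz_mult[OF L2_diff[OF assms(1,2)] assms(4), of n] by simp
  qed
  then show "\<forall>\<^sub>F n in sequentially. norm ((\<integral>x. F n x * h x \<partial>M) - (\<integral>x. f x * h x \<partial>M)) \<le>
      L2_norm M (\<lambda>x. F n x - f x) * L2_norm M h" by simp
qed

lemma L2_inner_tendsto: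
  assumes "\<And>n. F n \<in> L2 M" "f \<in> L2 M" "(\<lambda>n. L2_norm M (\<lambda>x. F n x - f x)) \<longlonglongrightarrow> 0" "h \<in> L2 M"
  shows "(\<lambda>n. L2_inner M (F n) h) \<longlonglongrightarrow> L2_inner M f h"
  unfolding L2_inner_def by (rule L2_integral_mult_tendsto[OF assms(1-3) L2_cnj[OF assms(4)]])

lemma L2_inner_cmult_right: "L2_inner M f (\<lambda>x. c * h x) = cnj c * L2_inner M f h"
  using arg_cong[OF L2_inner_cmult[of M c h f], of cnj] by (simp add: L2_inner_cnj)

lemma L2_norm_mono:
  assumes "f \<in> L2 M" "h \<in> borel_measurable M" "AE x in M. cmod (h x) \<le> c * cmod (f x)" "c \<ge> 0"
  shows "L2_norm M h \<le> c * L2_norm M f"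
proof (rule power2_le_imp_le)
  have h: "h \<in> L2 M" by (rule L2_dominated[OF assms(1-3)])
  have "(\<integral>x. (cmod (h x))\<^sup>2 \<partial>M) \<le> (\<integral>x. c\<^sup>2 * (cmod (f x))\<^sup>2 \<partial>M)"
  proof (rule integral_mono_AE)
    show "AE x in M. (cmod (h x))\<^sup>2 \<le> c\<^sup>2 * (cmod (f x))\<^sup>2"
      using assms(3) by eventually_elim (simp flip: power_mult_distrib add: power_mono)
  qed (use assms(1) h in \<open>auto simp: L2_def\<close>)
  then show "(L2_norm M h)\<^sup>2 \<le> (c * L2_norm M f)\<^sup>2"
    by (simp add: L2_norm_power2 power_mult_distrib)
qed (use assms(4) in simp)

section \<open>Completeness, nested convex sets and projections\<close>

text \<open>
  Increments of a fast subsequence are summable in the mean, hence almost everywhere. This gives a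
  pointwise limit, and Fatou's lemma turns it into a limit in the norm.
\<close>

lemma L2_complete:
  assumes "prob_space M" and F: "\<And>n. F n \<in> L2 M"
    and Cauchy: "\<And>e. e > 0 \<Longrightarrow> \<exists>N. \<forall>m\<ge>N. \<forall>n\<ge>N. L2_norm M (\<lambda>x. F m x - F n x) < e"
  shows "\<exists>f\<in>L2 M. (\<lambda>n. L2_norm M (\<lambda>x. F n x - f x)) \<longlonglongrightarrow> 0"
proof -
  interpret prob_space M by fact
  have "\<exists>N. \<forall>k. (\<forall>m\<ge>N k. \<forall>n\<ge>N k. L2_norm M (\<lambda>x. F m x - F n x) < (1/2)^k)"
    using Cauchy[of "(1/2)^_"] by (intro choice allI) auto
  then obtain N where N: "\<And>k m n. m \<ge> N k \<Longrightarrow> n \<ge> N k \<Longrightarrow> L2_norm M (\<lambda>x. F m x - F n x) < (1/2)^k"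
    by blast
  define s where "s k = (\<Sum>i\<le>k. N i)" for k
  have sN: "s j \<ge> N k" if "j \<ge> k" for j k
    unfolding s_def using that by (intro member_le_sum) auto
  define G where "G k = F (s k)" for k
  have G: "G k \<in> L2 M" for k unfolding G_def by (rule F)
  have [measurable]: "G k \<in> borel_measurable M" for k using G by (rule L2_measurable)
  have [measurable]: "F k \<in> borel_measurable M" for k using F by (rule L2_measurable)
  have diff: "L2_norm M (\<lambda>x. G (Suc k) x - G k x) \<le> (1/2)^k" for k
    unfolding G_def by (rule less_imp_le, rule N) (use sN in auto)
  have nn1: "(\<integral>\<^sup>+x. ennreal (cmod (G (Suc k) x - G k x)) \<partial>M) \<le> ennreal ((1/2)^k)" for k
  proof -
    have one: "(\<lambda>x. 1) \<in> L2 M" by (simp add: L2_def)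
    have L: "(\<lambda>x. G (Suc k) x - G k x) \<in> L2 M" by (intro L2_diff G)
    have "(\<integral>x. cmod (G (Suc k) x - G k x) \<partial>M) \<le> (1/2)^k"
      using L2_integral_norm_mult_le[OF L one] diff[of k] by (simp add: L2_norm_def prob_space)
    moreover have "integrable M (\<lambda>x. cmod (G (Suc k) x - G k x))"
      using L2_integrable_mult[OF L one] by (auto intro!: integrable_norm)
    ultimately show ?thesis
      by (subst nn_integral_eq_integral) (auto intro!: ennreal_leI)
  qed
  have "(\<integral>\<^sup>+x. (\<Sum>k. ennreal (cmod (G (Suc k) x - G k x))) \<partial>M) =
      (\<Sum>k. \<integral>\<^sup>+x. ennreal (cmod (G (Suc k) x - G k x)) \<partial>M)"
    by (rule nn_integral_suminf) measurable
  also have "\<dots> \<le> (\<Sum>k. ennreal ((1/2)^k))"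
    by (intro suminf_le nn1) auto
  also have "\<dots> < \<infinity>"
    by (subst suminf_ennreal2) (auto intro: summable_geometric)
  finally have "AE x in M. (\<Sum>k. ennreal (cmod (G (Suc k) x - G k x))) \<noteq> \<infinity>"
    by (intro nn_integral_PInf_AE) auto
  then have conv: "AE x in M. convergent (\<lambda>k. G k x)"
  proof eventually_elim
    case (elim x)
    then have "summable (\<lambda>k. cmod (G (Suc k) x - G k x))"
      by (intro summable_suminf_not_top) auto
    then have "summable (\<lambda>k. G (Suc k) x - G k x)"
      by (rule summable_norm_cancel)
    then have "convergent (\<lambda>n. \<Sum>k<n. G (Suc k) x - G k x)"
      by (simp add: summable_iff_convergent)
    then have "convergent (\<lambda>n. (\<Sum>k<n. G (Suc k) x - G k x) + G 0 x)"
      by (intro convergent_add convergent_const)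
    moreover have "(\<lambda>n. (\<Sum>k<n. G (Suc k) x - G k x) + G 0 x) = (\<lambda>n. G n x)"
      by (subst sum_lessThan_telescope) simp
    ultimately show ?case by simp
  qed
  define f where "f x = lim (\<lambda>k. G k x)" for x
  have [measurable]: "f \<in> borel_measurable M"
    unfolding f_def by measurable
  have lim: "AE x in M. (\<lambda>k. G k x) \<longlonglongrightarrow> f x"
    using conv by eventually_elim (simp add: f_def convergent_LIMSEQ_iff)
  have main: "(\<integral>\<^sup>+x. ennreal ((cmod (F n x - f x))\<^sup>2) \<partial>M) \<le> ennreal (((1/2)^k)\<^sup>2)" if n: "n \<ge> N k" for n k
  proof -
    have "(\<integral>\<^sup>+x. ennreal ((cmod (F n x - f x))\<^sup>2) \<partial>M) =
        (\<integral>\<^sup>+x. liminf (\<lambda>j. ennreal ((cmod (F n x - G j x))\<^sup>2)) \<partial>M)"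
    proof (rule nn_integral_cong_AE)
      show "AE x in M. ennreal ((cmod (F n x - f x))\<^sup>2) = liminf (\<lambda>j. ennreal ((cmod (F n x - G j x))\<^sup>2))"
        using lim
      proof eventually_elim
        case (elim x)
        then have "(\<lambda>j. ennreal ((cmod (F n x - G j x))\<^sup>2)) \<longlonglongrightarrow> ennreal ((cmod (F n x - f x))\<^sup>2)"
          by (intro tendsto_ennrealI tendsto_intros)
        then show ?case by (metis lim_imp_Liminf sequentially_bot)
      qed
    qed
    also have "\<dots> \<le> liminf (\<lambda>j. \<integral>\<^sup>+x. ennreal ((cmod (F n x - G j x))\<^sup>2) \<partial>M)"
      by (rule nn_integral_liminf) measurable
    also have "\<dots> \<le> ennreal (((1/2)^k)\<^sup>2)"
    proof (rule Liminf_le[OF sequentially_bot], rule eventually_sequentiallyI[of k])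
      fix j assume "k \<le> j"
      have L: "(\<lambda>x. F n x - G j x) \<in> L2 M" by (intro L2_diff F G)
      have "(\<integral>\<^sup>+x. ennreal ((cmod (F n x - G j x))\<^sup>2) \<partial>M) =
          ennreal (\<integral>x. (cmod (F n x - G j x))\<^sup>2 \<partial>M)"
        by (rule nn_integral_eq_integral) (use L in \<open>auto simp: L2_def\<close>)
      also have "\<dots> = ennreal ((L2_norm M (\<lambda>x. F n x - G j x))\<^sup>2)"
        by (simp only: L2_norm_power2)
      also have "\<dots> \<le> ennreal (((1/2)^k)\<^sup>2)"
        unfolding G_def using n sN[OF \<open>k \<le> j\<close>]
        by (intro ennreal_leI power_mono less_imp_le[OF N]) auto
      finally show "(\<integral>\<^sup>+x. ennreal ((cmod (F n x - G j x))\<^sup>2) \<partial>M) \<le> ennreal (((1/2)^k)\<^sup>2)" .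
    qed
    finally show ?thesis .
  qed
  have L: "(\<lambda>x. F n x - f x) \<in> L2 M" if n: "n \<ge> N k" for n k
  proof -
    have "integrable M (\<lambda>x. (cmod (F n x - f x))\<^sup>2)"
      using main[OF n] by (intro integrableI_bounded) (auto simp: less_top[symmetric] top_unique)
    then show ?thesis by (simp add: L2_def)
  qed
  have "(\<lambda>x. F (N 0) x - (F (N 0) x - f x)) \<in> L2 M"
    by (rule L2_diff[OF F L[of 0]]) simp
  then have f: "f \<in> L2 M" by simp
  have small: "L2_norm M (\<lambda>x. F n x - f x) \<le> (1/2)^k" if n: "n \<ge> N k" for n k
  proof -
    have "ennreal ((L2_norm M (\<lambda>x. F n x - f x))\<^sup>2) \<le> ennreal (((1/2)^k)\<^sup>2)"
      using main[OF n] L[OF n] unfolding L2_norm_power2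
      by (subst (asm) nn_integral_eq_integral) (auto simp: L2_def)
    then have "(L2_norm M (\<lambda>x. F n x - f x))\<^sup>2 \<le> ((1/2)^k)\<^sup>2"
      by (simp add: ennreal_le_iff)
    then show ?thesis by (rule power2_le_imp_le) simp
  qed
  have "(\<lambda>n. L2_norm M (\<lambda>x. F n x - f x)) \<longlonglongrightarrow> 0"
  proof (rule LIMSEQ_I)
    fix e :: real assume "e > 0"
    then obtain k where "(1/2)^k < e" using real_arch_pow_inv[of e "1/2"] by auto
    then have "\<forall>n\<ge>N k. norm (L2_norm M (\<lambda>x. F n x - f x) - 0) < e"
      using small by (auto intro: le_less_trans)
    then show "\<exists>no. \<forall>n\<ge>no. norm (L2_norm M (\<lambda>x. F n x - f x) - 0) < e" by blast
  qed
  with f show ?thesis by blast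
qed

text \<open>
  A set of representatives which is closed in this sense is also saturated under equality almost
  everywhere, as constant sequences show.
\<close>

definition L2_closed :: "'g measure \<Rightarrow> ('g \<Rightarrow> complex) set \<Rightarrow> bool" where
  "L2_closed M S \<longleftrightarrow> S \<subseteq> L2 M \<and> (\<forall>F f. (\<forall>n. F n \<in> S) \<longrightarrow> f \<in> L2 M \<longrightarrow>
     (\<lambda>n. L2_norm M (\<lambda>x. F n x - f x)) \<longlonglongrightarrow> 0 \<longrightarrow> f \<in> S)"

definition convex_set :: "('g \<Rightarrow> complex) set \<Rightarrow> bool" where
  "convex_set S \<longleftrightarrow> (\<forall>f\<in>S. \<forall>h\<in>S. \<forall>t::real. 0 \<le> t \<longrightarrow> t \<le> 1 \<longrightarrow>
     (\<lambda>x. of_real (1 - t) * f x + of_real t * h x) \<in> S)"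

lemma convex_setD:
  "convex_set S \<Longrightarrow> f \<in> S \<Longrightarrow> h \<in> S \<Longrightarrow> 0 \<le> t \<Longrightarrow> t \<le> 1 \<Longrightarrow>
    (\<lambda>x. of_real (1 - t) * f x + of_real t * h x) \<in> S"
  unfolding convex_set_def by blast

lemma L2_closedD:
  "L2_closed M S \<Longrightarrow> (\<And>n. F n \<in> S) \<Longrightarrow> f \<in> L2 M \<Longrightarrow>
    (\<lambda>n. L2_norm M (\<lambda>x. F n x - f x)) \<longlonglongrightarrow> 0 \<Longrightarrow> f \<in> S"
  unfolding L2_closed_def by blast

text \<open>
  This replaces the weak compactness of balls. Choose in the \<open>n\<close>-th set an element of nearly minimal
  norm. The minimal norms increase to a finite limit, and by convexity the parallelogram law
  turns the convergence of the norms into the Cauchy property for the chosen elements.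
\<close>

lemma L2_nested_convex_Inter_nonempty:
  assumes "prob_space M"
    and closed: "\<And>n. L2_closed M (S n)" and convex: "\<And>n. convex_set (S n)"
    and ne: "\<And>n. S n \<noteq> {}" and dec: "\<And>n. S (Suc n) \<subseteq> S n"
    and bounded: "\<And>f. f \<in> S 0 \<Longrightarrow> L2_norm M f \<le> C"
  shows "\<exists>f. \<forall>n. f \<in> S n"
proof -
  have mono: "S n \<subseteq> S m" if "m \<le> n" for m n
    using lift_Suc_antimono_le[of S, OF dec that] .
  have S_L2: "f \<in> L2 M" if "f \<in> S n" for f n
    using closed[of n] that by (auto simp: L2_closed_def)
  \<comment> \<open>\<open>d n\<close> is the square of the distance from \<open>S n\<close> to the origin\<close>
  define d where "d n = (INF f\<in>S n. (L2_norm M f)\<^sup>2)" for n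
  have bdd: "bdd_below ((\<lambda>f. (L2_norm M f)\<^sup>2) ` S n)" for n
    by (rule bdd_belowI[of _ 0]) auto
  have d_le: "d n \<le> (L2_norm M f)\<^sup>2" if "f \<in> S n" for f n
    unfolding d_def by (rule cINF_lower[OF bdd that])
  have "\<exists>f. f \<in> S n \<and> (L2_norm M f)\<^sup>2 < d n + 1 / real (Suc n)" for n
  proof -
    have "d n < d n + 1 / real (Suc n)" by simp
    then show ?thesis
      unfolding d_def by (subst (asm) cINF_less_iff[OF ne bdd]) auto
  qed
  then obtain F where F: "\<And>n. F n \<in> S n" and Fd: "\<And>n. (L2_norm M (F n))\<^sup>2 < d n + 1 / real (Suc n)"
    by metis
  have d_mono: "d m \<le> d n" if "m \<le> n" for m n
    unfolding d_def by (rule cINF_superset_mono[OF ne bdd mono[OF that]]) simp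
  have d_bound: "d n \<le> C\<^sup>2" for n
  proof -
    have "F n \<in> S 0" using F mono[of 0 n] by auto
    then have "L2_norm M (F n) \<le> C" by (rule bounded)
    then have "(L2_norm M (F n))\<^sup>2 \<le> C\<^sup>2" by (rule power_mono) simp
    then show ?thesis using d_le[OF F[of n]] by linarith
  qed
  have "incseq d" using d_mono by (simp add: incseq_def)
  then have "convergent d"
    using d_bound by (metis incseq_convergent convergentI)
  then have Cd: "Cauchy d" by (simp add: convergent_eq_Cauchy convergent_def)
  have FL: "F n \<in> L2 M" for n using F S_L2 by blast
  have close: "(L2_norm M (\<lambda>x. F m x - F n x))\<^sup>2 \<le> 2 * (d n - d m) + 4 / real (Suc m)"
    if "m \<le> n" for m n
  proof -
    have "F n \<in> S m" using F[of n] mono[OF that] by auto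
    then have "(\<lambda>x. of_real (1 - 1/2) * F m x + of_real (1/2) * F n x) \<in> S m"
      by (intro convex_setD[OF convex F]) auto
    then have "d m \<le> (L2_norm M (\<lambda>x. of_real (1 - 1/2) * F m x + of_real (1/2) * F n x))\<^sup>2"
      by (rule d_le)
    also have "(\<lambda>x. of_real (1 - 1/2) * F m x + of_real (1/2) * F n x) = (\<lambda>x. (1/2) * (F m x + F n x))"
      by (simp add: algebra_simps)
    finally have "4 * d m \<le> (L2_norm M (\<lambda>x. F m x + F n x))\<^sup>2"
      by (simp only: L2_norm_cmult) (simp add: power_mult_distrib power2_eq_square)
    moreover have "1 / real (Suc n) \<le> 1 / real (Suc m)"
      using that by (simp add: field_simps)
    moreover have "p \<le> 2 * (y - x) + 4 * u"
      if "4 * x \<le> q" "v \<le> u" "p + q = 2 * a + 2 * b" "a < x + u" "b < y + v" for p q a b u v x y :: real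
      using that by (simp add: algebra_simps)
    ultimately have "(L2_norm M (\<lambda>x. F m x - F n x))\<^sup>2 \<le> 2 * (d n - d m) + 4 * (1 / real (Suc m))"
      using L2_parallelogram[OF FL[of m] FL[of n]] Fd[of m] Fd[of n] by blast
    then show ?thesis by simp
  qed
  have "\<exists>f\<in>L2 M. (\<lambda>n. L2_norm M (\<lambda>x. F n x - f x)) \<longlonglongrightarrow> 0"
  proof (rule L2_complete[OF assms(1) FL])
    fix e :: real assume "e > 0"
    then have "e\<^sup>2 / 4 > 0" by simp
    then obtain N1 where N1: "\<And>m n. m \<ge> N1 \<Longrightarrow> n \<ge> N1 \<Longrightarrow> \<bar>d m - d n\<bar> < e\<^sup>2 / 4"
      using Cd unfolding Cauchy_def dist_real_def by metis
    obtain N2 where N2: "8 / e\<^sup>2 < real N2" using reals_Archimedean2 by blast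
    define N where "N = max N1 N2"
    have *: "L2_norm M (\<lambda>x. F m x - F n x) < e" if "m \<ge> N" "m \<le> n" for m n
    proof (rule power2_less_imp_less)
      have "8 / e\<^sup>2 < real (Suc m)" using N2 that by (simp add: N_def)
      then have "4 / real (Suc m) < e\<^sup>2 / 2"
        using \<open>e > 0\<close> by (simp add: field_simps)
      moreover have "\<bar>d n - d m\<bar> < e\<^sup>2 / 4" using that by (intro N1) (auto simp: N_def)
      ultimately show "(L2_norm M (\<lambda>x. F m x - F n x))\<^sup>2 < e\<^sup>2"
        using close[OF that(2)] by argo
    qed (use \<open>e > 0\<close> in auto)
    have "L2_norm M (\<lambda>x. F m x - F n x) < e" if "m \<ge> N" "n \<ge> N" for m n
      using *[of m n] *[of n m] that by (cases "m \<le> n") (auto simp: L2_norm_minus_commute[of M "F m"])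
    then show "\<exists>N. \<forall>m\<ge>N. \<forall>n\<ge>N. L2_norm M (\<lambda>x. F m x - F n x) < e" by blast
  qed
  then obtain f where f: "f \<in> L2 M" and lim: "(\<lambda>n. L2_norm M (\<lambda>x. F n x - f x)) \<longlonglongrightarrow> 0" by blast
  have "f \<in> S k" for k
  proof (rule L2_closedD[OF closed _ f LIMSEQ_ignore_initial_segment[OF lim, of k]])
    show "F (n + k) \<in> S k" for n using F[of "n + k"] mono[of k "n + k"] by auto
  qed
  then show ?thesis by blast
qed

lemma L2_norm_convex:
  assumes "f \<in> L2 M" "h \<in> L2 M" "0 \<le> t" "t \<le> 1" "L2_norm M f \<le> c" "L2_norm M h \<le> c"
  shows "L2_norm M (\<lambda>x. of_real (1 - t) * f x + of_real t * h x) \<le> c"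
proof -
  have "L2_norm M (\<lambda>x. of_real (1 - t) * f x + of_real t * h x) \<le> (1 - t) * L2_norm M f + t * L2_norm M h"
    using L2_norm_triangle[OF L2_cmult[OF assms(1)] L2_cmult[OF assms(2)], of "of_real (1 - t)" "of_real t"]
      assms(3,4)
    by (simp only: L2_norm_cmult norm_of_real)
  also have "\<dots> \<le> (1 - t) * c + t * c"
    using assms by (intro add_mono mult_left_mono) auto
  finally show ?thesis by (simp add: algebra_simps)
qed

lemma L2_closed_convex_min_norm:
  assumes "prob_space M" "L2_closed M S" "convex_set S" "S \<noteq> {}"
  shows "\<exists>f\<in>S. \<forall>h\<in>S. L2_norm M f \<le> L2_norm M h"
proof -
  define d where "d = (INF f\<in>S. L2_norm M f)"
  have bdd: "bdd_below (L2_norm M ` S)" by (rule bdd_belowI[of _ 0]) auto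
  have d_le: "d \<le> L2_norm M f" if "f \<in> S" for f
    unfolding d_def by (rule cINF_lower[OF bdd that])
  define T where "T n = {f\<in>S. L2_norm M f \<le> d + 1 / real (Suc n)}" for n
  have SL: "S \<subseteq> L2 M" using assms(2) by (simp add: L2_closed_def)
  have "\<exists>f. \<forall>n. f \<in> T n"
  proof (rule L2_nested_convex_Inter_nonempty[OF assms(1)])
    show "L2_closed M (T n)" for n
      unfolding L2_closed_def
    proof (intro conjI allI impI)
      show "T n \<subseteq> L2 M" using SL by (auto simp: T_def)
      fix F f assume F: "\<forall>k. F k \<in> T n" and f: "f \<in> L2 M"
        and lim: "(\<lambda>k. L2_norm M (\<lambda>x. F k x - f x)) \<longlonglongrightarrow> 0"
      have "f \<in> S" by (rule L2_closedD[OF assms(2) _ f lim]) (use F in \<open>auto simp: T_def\<close>)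
      moreover have "L2_norm M f \<le> d + 1 / real (Suc n)"
        by (rule LIMSEQ_le_const2[OF L2_norm_tendsto[OF _ f lim]])
           (use F SL in \<open>auto simp: T_def\<close>)
      ultimately show "f \<in> T n" by (simp add: T_def)
    qed
    show "convex_set (T n)" for n
      unfolding convex_set_def
    proof (intro ballI allI impI)
      fix f h and t :: real assume fh: "f \<in> T n" "h \<in> T n" and t: "0 \<le> t" "t \<le> 1"
      then have "L2_norm M (\<lambda>x. of_real (1 - t) * f x + of_real t * h x) \<le> d + 1 / real (Suc n)"
        using SL by (intro L2_norm_convex) (auto simp: T_def)
      then show "(\<lambda>x. of_real (1 - t) * f x + of_real t * h x) \<in> T n"
        using assms(3) fh t unfolding convex_set_def T_def by blast
    qed
    show "T n \<noteq> {}" for n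
    proof -
      have "d < d + 1 / real (Suc n)" by simp
      then obtain f where "f \<in> S" "L2_norm M f < d + 1 / real (Suc n)"
        unfolding d_def by (subst (asm) cINF_less_iff[OF assms(4) bdd]) auto
      then show ?thesis by (auto simp: T_def intro: less_imp_le)
    qed
    show "T (Suc n) \<subseteq> T n" for n
    proof -
      have "1 / real (Suc (Suc n)) \<le> 1 / real (Suc n)" by (simp add: field_simps)
      then show ?thesis unfolding T_def by fastforce
    qed
    show "L2_norm M f \<le> d + 1" if "f \<in> T 0" for f using that by (simp add: T_def)
  qed
  then obtain f where f: "\<And>n. f \<in> T n" by blast
  have "f \<in> S" using f[of 0] by (simp add: T_def)
  have "L2_norm M f \<le> d"
  proof (rule LIMSEQ_le_const)
    show "(\<lambda>n. d + 1 / real (Suc n)) \<longlonglongrightarrow> d"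
      using tendsto_add[OF tendsto_const LIMSEQ_inverse_real_of_nat] by (simp add: inverse_eq_divide)
    show "\<exists>N. \<forall>n\<ge>N. L2_norm M f \<le> d + 1 / real (Suc n)" using f by (auto simp: T_def)
  qed
  with \<open>f \<in> S\<close> d_le show ?thesis by (meson order_trans)
qed

definition L2_subspace :: "'g measure \<Rightarrow> ('g \<Rightarrow> complex) set \<Rightarrow> bool" where
  "L2_subspace M S \<longleftrightarrow> L2_closed M S \<and> S \<noteq> {} \<and>
     (\<forall>f\<in>S. \<forall>h\<in>S. (\<lambda>x. f x + h x) \<in> S) \<and> (\<forall>f\<in>S. \<forall>c. (\<lambda>x. c * f x) \<in> S)"

text \<open>
  The translate \<open>f - S\<close> is closed and convex, and its element of minimal norm is orthogonal to \<open>S\<close>: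
  otherwise subtracting a small multiple of \<open>\<langle>f - p, h\<rangle> h\<close> would shorten it.
\<close>

lemma L2_projection:
  assumes "prob_space M" "L2_subspace M S" "f \<in> L2 M"
  shows "\<exists>p\<in>S. \<forall>h\<in>S. L2_inner M (\<lambda>x. f x - p x) h = 0"
proof -
  have closed: "L2_closed M S" and SL: "S \<subseteq> L2 M" and ne: "S \<noteq> {}"
    and add: "\<And>f h. f \<in> S \<Longrightarrow> h \<in> S \<Longrightarrow> (\<lambda>x. f x + h x) \<in> S"
    and cmult: "\<And>f c. f \<in> S \<Longrightarrow> (\<lambda>x. c * f x) \<in> S"
    using assms(2) by (auto simp: L2_subspace_def L2_closed_def)
  define T where "T = (\<lambda>p x. f x - p x) ` S"
  have T_iff: "h \<in> T \<longleftrightarrow> (\<lambda>x. f x - h x) \<in> S" for h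
  proof
    assume "(\<lambda>x. f x - h x) \<in> S"
    then have "(\<lambda>x. f x - (f x - h x)) \<in> T" unfolding T_def by (rule imageI)
    then show "h \<in> T" by simp
  qed (auto simp: T_def)
  have TL: "T \<subseteq> L2 M" using SL assms(3) by (auto simp: T_def intro: L2_diff)
  have "\<exists>f\<in>T. \<forall>h\<in>T. L2_norm M f \<le> L2_norm M h"
  proof (rule L2_closed_convex_min_norm[OF assms(1)])
    show "L2_closed M T"
      unfolding L2_closed_def
    proof (intro conjI allI impI)
      fix F h assume F: "\<forall>n. F n \<in> T" and h: "h \<in> L2 M"
        and lim: "(\<lambda>n. L2_norm M (\<lambda>x. F n x - h x)) \<longlonglongrightarrow> 0"
      have "L2_norm M (\<lambda>x. (f x - F n x) - (f x - h x)) = L2_norm M (\<lambda>x. F n x - h x)" for n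
        using L2_norm_minus_commute[of M h "F n"] by simp
      with lim have "(\<lambda>n. L2_norm M (\<lambda>x. (f x - F n x) - (f x - h x))) \<longlonglongrightarrow> 0" by presburger
      moreover have "(\<lambda>x. f x - F n x) \<in> S" for n using F T_iff by blast
      ultimately have "(\<lambda>x. f x - h x) \<in> S"
        by (intro L2_closedD[OF closed _ L2_diff[OF assms(3) h]])
      then show "h \<in> T" by (simp add: T_iff)
    qed fact
    show "convex_set T"
      unfolding convex_set_def
    proof (intro ballI allI impI)
      fix g h and t :: real assume "g \<in> T" "h \<in> T"
      then have "(\<lambda>x. of_real (1 - t) * (f x - g x) + of_real t * (f x - h x)) \<in> S"
        by (intro add cmult) (auto simp: T_iff)
      then show "(\<lambda>x. of_real (1 - t) * g x + of_real t * h x) \<in> T"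
        by (simp add: T_iff algebra_simps)
    qed
    show "T \<noteq> {}" using ne by (simp add: T_def)
  qed
  then obtain p where p: "p \<in> S" and min: "\<And>h. h \<in> S \<Longrightarrow> L2_norm M (\<lambda>x. f x - p x) \<le> L2_norm M (\<lambda>x. f x - h x)"
    unfolding T_def by auto
  define e where "e = (\<lambda>x. f x - p x)"
  have e: "e \<in> L2 M" unfolding e_def using p SL assms(3) by (auto intro: L2_diff)
  have "L2_inner M e h = 0" if h: "h \<in> S" for h
  proof -
    have hL: "h \<in> L2 M" using h SL by auto
    define a where "a = L2_inner M e h"
    have "(L2_norm M e)\<^sup>2 \<le> (L2_norm M (\<lambda>x. e x - (of_real t * a) * h x))\<^sup>2" for t
    proof (rule power_mono)
      have "(\<lambda>x. p x + (of_real t * a) * h x) \<in> S" using p h by (intro add cmult)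
      from min[OF this] show "L2_norm M e \<le> L2_norm M (\<lambda>x. e x - (of_real t * a) * h x)"
        by (simp add: e_def algebra_simps)
    qed simp
    moreover have "(L2_norm M (\<lambda>x. e x - (of_real t * a) * h x))\<^sup>2 =
        (L2_norm M e)\<^sup>2 + t\<^sup>2 * (cmod a)\<^sup>2 * (L2_norm M h)\<^sup>2 - 2 * t * (cmod a)\<^sup>2" for t
    proof -
      have "L2_inner M e (\<lambda>x. (of_real t * a) * h x) = of_real t * (cnj a * a)"
        unfolding L2_inner_cmult_right a_def by simp
      also have "\<dots> = of_real (t * (cmod a)\<^sup>2)"
        using complex_norm_square[of a] by (simp add: mult.commute)
      finally have "Re (L2_inner M e (\<lambda>x. (of_real t * a) * h x)) = t * (cmod a)\<^sup>2" by simp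
      then show ?thesis
        using L2_norm_diff_power2[OF e L2_cmult[OF hL, of "of_real t * a"]]
        by (simp only: L2_norm_cmult) (simp add: norm_mult power_mult_distrib)
    qed
    ultimately have *: "2 * t * (cmod a)\<^sup>2 \<le> t\<^sup>2 * (cmod a)\<^sup>2 * (L2_norm M h)\<^sup>2" for t
      by (metis (no_types, lifting) add_diff_eq add_le_same_cancel1 diff_ge_0_iff_ge le_add_same_cancel1)
    have "(cmod a)\<^sup>2 \<le> 0"
    proof -
      define b where "b = (L2_norm M h)\<^sup>2"
      have "b \<ge> 0" by (simp add: b_def)
      define s where "s = 1 / (b + 1)"
      have s: "s > 0" "s * b < 1" using \<open>b \<ge> 0\<close> by (auto simp: s_def field_simps)
      have "s * (2 * (cmod a)\<^sup>2) \<le> s * ((s * b) * (cmod a)\<^sup>2)"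
        using *[of s] by (simp add: b_def power2_eq_square mult_ac)
      then have "2 * (cmod a)\<^sup>2 \<le> (s * b) * (cmod a)\<^sup>2" using s(1) by simp
      also have "\<dots> \<le> 1 * (cmod a)\<^sup>2" using s by (intro mult_right_mono) auto
      finally show ?thesis by simp
    qed
    then show ?thesis by (simp add: a_def)
  qed
  with p show ?thesis unfolding e_def by blast
qed

section \<open>Convolution on a compact abelian group\<close>

definition convolve :: "'g::topological_ab_group_add measure \<Rightarrow> ('g \<Rightarrow> complex) \<Rightarrow> ('g \<Rightarrow> complex) \<Rightarrow> 'g \<Rightarrow> complex" where
  "convolve M k f = (\<lambda>x. \<integral>y. k (x - y) * f y \<partial>M)"

text \<open>
  This is the condition for convolution by \<open>k\<close> to be self-adjoint.
\<close>

definition hermitian :: "('g::topological_ab_group_add \<Rightarrow> complex) \<Rightarrow> bool" where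
  "hermitian k \<longleftrightarrow> (\<forall>x. k (- x) = cnj (k x))"

locale compact_haar =
  fixes M :: "'g::{topological_ab_group_add, t2_space} measure"
  assumes compact_UNIV: "compact (UNIV :: 'g set)"
    and haar: "normalized_haar M"
begin

lemma sets_M [simp, measurable_cong]: "sets M = sets borel"
  using haar by (simp add: normalized_haar_def)

lemma space_M [simp]: "space M = UNIV"
  using sets_eq_imp_space_eq[OF sets_M] by simp

lemma prob_M: "prob_space M"
  using haar by (simp add: normalized_haar_def)

sublocale prob_space M
  by (rule prob_M)

lemma continuous_measurable:
  fixes f :: "'g \<Rightarrow> 'b::topological_space"
  shows "continuous_on UNIV f \<Longrightarrow> f \<in> borel_measurable M"
  using borel_measurable_continuous_onI[of f] by (simp add: measurable_cong_sets[OF sets_M refl])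

lemma translation_measurable [measurable]: "(+) g \<in> borel_measurable M"
  by (intro continuous_measurable continuous_intros)

lemma measurable_translate:
  fixes f :: "'g \<Rightarrow> 'b::topological_space"
  assumes "f \<in> borel_measurable M"
  shows "(\<lambda>x. f (g + x)) \<in> borel_measurable M"
proof -
  have "f \<in> borel_measurable borel" using assms by (simp add: measurable_cong_sets[OF sets_M refl])
  then show ?thesis by (rule measurable_compose[OF translation_measurable])
qed

lemma distr_translate: "distr M borel ((+) g) = M"
  using haar by (simp add: normalized_haar_def)

lemma integral_translate:
  fixes f :: "'g \<Rightarrow> 'b::{banach, second_countable_topology}"
  assumes "f \<in> borel_measurable M"
  shows "(\<integral>x. f (g + x) \<partial>M) = (\<integral>x. f x \<partial>M)"
proof -
  have "f \<in> borel_measurable borel" using assms by (simp add: measurable_cong_sets[OF sets_M refl])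
  then have "(\<integral>x. f x \<partial>(distr M borel ((+) g))) = (\<integral>x. f (g + x) \<partial>M)"
    by (intro integral_distr) measurable
  then show ?thesis by (simp add: distr_translate)
qed

lemma integrable_translate:
  fixes f :: "'g \<Rightarrow> 'b::{banach, second_countable_topology}"
  assumes "integrable M f"
  shows "integrable M (\<lambda>x. f (g + x))"
proof -
  have "f \<in> borel_measurable borel"
    using borel_measurable_integrable[OF assms] by (simp add: measurable_cong_sets[OF sets_M refl])
  then have "integrable (distr M borel ((+) g)) f \<longleftrightarrow> integrable M (\<lambda>x. f (g + x))"
    by (intro integrable_distr_eq) measurable
  then show ?thesis using assms by (simp add: distr_translate)
qed

lemma continuous_bounded:
  fixes f :: "'a::topological_space \<Rightarrow> complex"
  assumes "compact (UNIV :: 'a set)" "continuous_on UNIV f"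
  obtains C where "C > 0" "\<And>x. cmod (f x) \<le> C"
proof -
  have "bounded (range f)"
    using compact_continuous_image[OF assms(2,1)] by (rule compact_imp_bounded)
  then obtain C where "\<And>x. cmod (f x) \<le> C" by (auto simp: bounded_iff)
  then show thesis using that[of "max C 1"] by (auto simp: le_max_iff_disj)
qed

lemma integrable_bounded_mult:
  assumes "integrable M f" "h \<in> borel_measurable M" "\<And>x. cmod (h x) \<le> C"
  shows "integrable M (\<lambda>x. h x * f x)"
proof (rule Bochner_Integration.integrable_bound)
  show "integrable M (\<lambda>x. of_real C * f x)" using assms by simp
  show "(\<lambda>x. h x * f x) \<in> borel_measurable M" using assms by auto
  have "C \<ge> 0" using assms(3)[of undefined] norm_ge_zero order_trans by blast
  then show "AE x in M. norm (h x * f x) \<le> norm (of_real C * f x)"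
    using assms(3) by (auto simp: norm_mult intro!: mult_right_mono)
qed

lemma continuous_integrable:
  assumes "continuous_on UNIV (f :: 'g \<Rightarrow> complex)"
  shows "integrable M f"
proof -
  obtain C where "\<And>x. cmod (f x) \<le> C" using continuous_bounded[OF compact_UNIV assms] by blast
  then show ?thesis
    by (intro integrable_const_bound[where B = C] AE_I2 continuous_measurable assms)
qed

lemma continuous_L2:
  assumes "continuous_on UNIV f"
  shows "f \<in> L2 M"
proof -
  have "continuous_on UNIV (\<lambda>x. f x * cnj (f x))" by (intro continuous_intros assms)
  then have "integrable M (\<lambda>x. f x * cnj (f x))" by (rule continuous_integrable)
  then have "integrable M (\<lambda>x. Re (f x * cnj (f x)))" by (rule integrable_Re)
  moreover have "Re (f x * cnj (f x)) = (cmod (f x))\<^sup>2" for x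
    by (simp flip: complex_norm_square)
  ultimately show ?thesis
    using continuous_measurable[OF assms] by (simp add: L2_def)
qed

lemma bounded_L2:
  assumes "f \<in> borel_measurable M" "AE x in M. cmod (f x) \<le> C"
  shows "f \<in> L2 M"
  by (rule L2_dominated[of "\<lambda>x. 1" _ _ C]) (use assms in \<open>auto simp: continuous_L2\<close>)

lemma L2_integrable: "f \<in> L2 M \<Longrightarrow> integrable M f"
  using L2_integrable_mult[of f M "\<lambda>x. 1"] continuous_L2[of "\<lambda>x. 1"] by simp

lemma L1_le_L2:
  assumes "f \<in> L2 M"
  shows "(\<integral>x. cmod (f x) \<partial>M) \<le> L2_norm M f"
  using L2_integral_norm_mult_le[OF assms continuous_L2[of "\<lambda>x. 1"]]
  by (simp add: L2_norm_def prob_space[unfolded space_M])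

lemma L2_norm_le_sup:
  assumes "\<And>x. cmod (f x) \<le> C" "f \<in> L2 M" "C \<ge> 0"
  shows "L2_norm M f \<le> C"
proof -
  have "(\<integral>x. (cmod (f x))\<^sup>2 \<partial>M) \<le> (\<integral>x. C\<^sup>2 \<partial>M)"
    by (rule integral_mono) (use assms in \<open>auto simp: L2_def intro!: power_mono\<close>)
  then have "(L2_norm M f)\<^sup>2 \<le> C\<^sup>2"
    by (simp add: L2_norm_power2 prob_space[unfolded space_M])
  then show ?thesis using assms(3) by (rule power2_le_imp_le)
qed

lemma normal_space_UNIV: "normal_space (euclidean :: 'g topology)"
proof (rule compact_Hausdorff_or_regular_imp_normal_space)
  show "compact_space (euclidean :: 'g topology)"
    using compact_UNIV by (simp add: compact_space_def)
  have "Hausdorff_space (euclidean :: 'g topology)"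
    unfolding Hausdorff_space_def disjnt_def by (metis hausdorff open_openin)
  then show "Hausdorff_space (euclidean :: 'g topology) \<or> regular_space (euclidean :: 'g topology)" ..
qed

lemma Urysohn_function:
  assumes "closed S" "closed T" "S \<inter> T = {}"
  obtains f :: "'g \<Rightarrow> real" where "continuous_on UNIV f" "\<And>x. 0 \<le> f x" "\<And>x. f x \<le> 1"
    "\<And>x. x \<in> S \<Longrightarrow> f x = 1" "\<And>x. x \<in> T \<Longrightarrow> f x = 0"
proof -
  obtain f where f: "continuous_map euclidean (top_of_set {0..1::real}) f" "f ` T \<subseteq> {0}" "f ` S \<subseteq> {1}"
    using Urysohn_lemma[OF normal_space_UNIV, of T S 0 1] assms
    by (auto simp: disjnt_def)
  have "continuous_on UNIV f" "f x \<in> {0..1}" for x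
    using f(1) by (auto simp: continuous_map_in_subtopology)
  with f that show thesis by (force simp: image_subset_iff)
qed

text \<open>
  Without a countable base the Borel sets of the square can exceed the product \<open>\<sigma>\<close>-algebra, so
  continuity does not give product measurability directly. But the continuous functions that are
  product measurable form a ring. It contains all functions of one coordinate, hence separates points,
  and by the theorem of Stone and Weierstrass it is uniformly dense. This makes Fubini's theorem
  available for continuous kernels.
\<close>

lemma continuous_real_measurable_pair:
  fixes F :: "'g \<times> 'g \<Rightarrow> real"
  assumes "continuous_on UNIV F"
  shows "F \<in> borel_measurable (M \<Otimes>\<^sub>M M)"
proof -
  define R where "R = {F :: 'g \<times> 'g \<Rightarrow> real. continuous_on UNIV F \<and> F \<in> borel_measurable (M \<Otimes>\<^sub>M M)}"
  interpret function_ring_on R UNIV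
  proof
    show "compact (UNIV :: ('g \<times> 'g) set)"
      using compact_Times[OF compact_UNIV compact_UNIV] by simp
    have sep: "\<exists>f::'g \<Rightarrow> real. continuous_on UNIV f \<and> f a \<noteq> f b" if "a \<noteq> b" for a b
      using Urysohn_function[of "{a}" "{b}"] that by (metis closed_singleton insertI1 disjoint_insert(1) inf_bot_right one_neq_zero singletonD)
    fix x y :: "'g \<times> 'g" assume "x \<noteq> y"
    then consider "fst x \<noteq> fst y" | "snd x \<noteq> snd y" by (auto simp: prod_eq_iff)
    then show "\<exists>f\<in>R. f x \<noteq> f y"
    proof cases
      case 1
      then obtain f :: "'g \<Rightarrow> real" where f: "continuous_on UNIV f" "f (fst x) \<noteq> f (fst y)" using sep by blast
      have [measurable]: "f \<in> borel_measurable M" using f by (intro continuous_measurable)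
      have "(\<lambda>z. f (fst z)) \<in> R"
        unfolding R_def using f(1) by (auto intro!: continuous_on_compose2[OF f(1)] continuous_intros)
      with f(2) show ?thesis by (intro bexI[of _ "\<lambda>z. f (fst z)"])
    next
      case 2
      then obtain f :: "'g \<Rightarrow> real" where f: "continuous_on UNIV f" "f (snd x) \<noteq> f (snd y)" using sep by blast
      have [measurable]: "f \<in> borel_measurable M" using f by (intro continuous_measurable)
      have "(\<lambda>z. f (snd z)) \<in> R"
        unfolding R_def using f(1) by (auto intro!: continuous_on_compose2[OF f(1)] continuous_intros)
      with f(2) show ?thesis by (intro bexI[of _ "\<lambda>z. f (snd z)"])
    qed
  qed (auto simp: R_def intro!: continuous_intros)
  obtain H where H: "\<And>n. H n \<in> R" "uniform_limit UNIV H F sequentially"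
    using Stone_Weierstrass[OF assms] unfolding Pi_iff by blast
  show ?thesis
  proof (rule borel_measurable_LIMSEQ_real)
    show "(\<lambda>i. H i x) \<longlonglongrightarrow> F x" for x by (rule tendsto_uniform_limitI[OF H(2)]) simp
    show "H i \<in> borel_measurable (M \<Otimes>\<^sub>M M)" for i using H(1) by (simp add: R_def)
  qed
qed

lemma continuous_measurable_pair:
  fixes F :: "'g \<times> 'g \<Rightarrow> complex"
  assumes "continuous_on UNIV F"
  shows "F \<in> borel_measurable (M \<Otimes>\<^sub>M M)"
proof -
  have "(\<lambda>z. Re (F z)) \<in> borel_measurable (M \<Otimes>\<^sub>M M)" "(\<lambda>z. Im (F z)) \<in> borel_measurable (M \<Otimes>\<^sub>M M)"
    by (intro continuous_real_measurable_pair continuous_intros assms)+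
  then show ?thesis by (simp add: borel_measurable_complex_iff)
qed

lemma continuous_kernel_Fubini:
  fixes F :: "'g \<times> 'g \<Rightarrow> complex"
  assumes F: "continuous_on UNIV F" and f: "integrable M f"
  shows "(\<integral>x. (\<integral>y. F (x, y) * f y \<partial>M) \<partial>M) = (\<integral>y. (\<integral>x. F (x, y) \<partial>M) * f y \<partial>M)"
proof -
  interpret pair_sigma_finite M M ..
  have [measurable]: "F \<in> borel_measurable (M \<Otimes>\<^sub>M M)" by (rule continuous_measurable_pair[OF F])
  have [measurable]: "f \<in> borel_measurable M" using f by simp
  have "compact (UNIV :: ('g \<times> 'g) set)"
    using compact_Times[OF compact_UNIV compact_UNIV] by simp
  then obtain C where C: "C > 0" "\<And>z. cmod (F z) \<le> C" using continuous_bounded[OF _ F] by blast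
  have F1: "(\<lambda>y. F (x, y)) \<in> borel_measurable M" for x by measurable
  have int: "integrable M (\<lambda>y. F (x, y) * f y)" for x
    by (rule integrable_bounded_mult[OF f F1 C(2)])
  have "integrable (M \<Otimes>\<^sub>M M) (\<lambda>(x, y). F (x, y) * f y)"
  proof (rule Fubini_integrable)
    show "(\<lambda>(x, y). F (x, y) * f y) \<in> borel_measurable (M \<Otimes>\<^sub>M M)" by measurable
    show "AE x in M. integrable M (\<lambda>y. case (x, y) of (x, y) \<Rightarrow> F (x, y) * f y)"
      using int by simp
    show "integrable M (\<lambda>x. \<integral>y. norm (case (x, y) of (x, y) \<Rightarrow> F (x, y) * f y) \<partial>M)"
    proof (rule integrable_const_bound)
      show "(\<lambda>x. \<integral>y. norm (case (x, y) of (x, y) \<Rightarrow> F (x, y) * f y) \<partial>M) \<in> borel_measurable M"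
        by measurable
      show "AE x in M. norm (\<integral>y. norm (case (x, y) of (x, y) \<Rightarrow> F (x, y) * f y) \<partial>M) \<le> (\<integral>y. C * norm (f y) \<partial>M)"
      proof (rule AE_I2)
        fix x
        have "(\<integral>y. norm (F (x, y) * f y) \<partial>M) \<le> (\<integral>y. C * norm (f y) \<partial>M)"
        proof (rule integral_mono)
          show "integrable M (\<lambda>y. norm (F (x, y) * f y))" by (rule integrable_norm[OF int])
          show "integrable M (\<lambda>y. C * norm (f y))" using f by simp
          show "norm (F (x, y) * f y) \<le> C * norm (f y)" for y
            unfolding norm_mult by (intro mult_right_mono C(2)) simp
        qed
        then show "norm (\<integral>y. norm (case (x, y) of (x, y) \<Rightarrow> F (x, y) * f y) \<partial>M) \<le> (\<integral>y. C * norm (f y) \<partial>M)"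
          by simp
      qed
    qed
  qed
  from Fubini_integral[OF this]
  show ?thesis by simp
qed

text \<open>
  By compactness, nearness of \<open>F (x, y)\<close> and \<open>F (x0, y)\<close> is uniform in \<open>y\<close>; this is the tube lemma.
\<close>

lemma continuous_kernel_integral:
  fixes F :: "'g \<times> 'g \<Rightarrow> complex"
  assumes F: "continuous_on UNIV F" and f: "integrable M f"
  shows "continuous_on UNIV (\<lambda>x. \<integral>y. F (x, y) * f y \<partial>M)"
proof -
  define I where "I = (\<integral>y. cmod (f y) \<partial>M)"
  have "I \<ge> 0" by (simp add: I_def)
  have Fx: "continuous_on UNIV (\<lambda>y. F (x, y))" for x
    by (rule continuous_on_compose2[OF F]) (auto intro!: continuous_intros)
  have int: "integrable M (\<lambda>y. F (x, y) * f y)" for x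
  proof -
    obtain C where "\<And>y. cmod (F (x, y)) \<le> C" using continuous_bounded[OF compact_UNIV Fx] by blast
    then show ?thesis by (intro integrable_bounded_mult[OF f] continuous_measurable Fx)
  qed
  have "((\<lambda>x. \<integral>y. F (x, y) * f y \<partial>M) \<longlongrightarrow> (\<integral>y. F (x0, y) * f y \<partial>M)) (at x0)" for x0
  proof (rule tendstoI)
    fix e :: real assume "e > 0"
    define d where "d = e / (I + 1)"
    have "d > 0" using \<open>e > 0\<close> \<open>I \<ge> 0\<close> by (simp add: d_def)
    have 1: "open {z. cmod (F z - F (x0, snd z)) < d}"
      by (intro open_Collect_less continuous_intros F continuous_on_compose2[OF Fx]) auto
    have 2: "{x0} \<times> UNIV \<subseteq> {z. cmod (F z - F (x0, snd z)) < d}" using \<open>d > 0\<close> by auto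
    obtain X where X: "x0 \<in> X" "open X" "X \<times> UNIV \<subseteq> {z. cmod (F z - F (x0, snd z)) < d}"
      using Elementary_Topology.tube_lemma[OF compact_UNIV 1 2] by auto
    have "dist (\<integral>y. F (x, y) * f y \<partial>M) (\<integral>y. F (x0, y) * f y \<partial>M) < e" if "x \<in> X" for x
    proof -
      have less: "cmod (F (x, y) - F (x0, y)) \<le> d" for y
        using subsetD[OF X(3), of "(x, y)"] that by simp
      have "(\<integral>y. F (x, y) * f y \<partial>M) - (\<integral>y. F (x0, y) * f y \<partial>M) = (\<integral>y. (F (x, y) - F (x0, y)) * f y \<partial>M)"
        by (simp add: left_diff_distrib int)
      also have "cmod \<dots> \<le> (\<integral>y. cmod ((F (x, y) - F (x0, y)) * f y) \<partial>M)"
        by (rule integral_norm_bound)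
      also have "\<dots> \<le> (\<integral>y. d * cmod (f y) \<partial>M)"
      proof (rule integral_mono)
        show "integrable M (\<lambda>y. cmod ((F (x, y) - F (x0, y)) * f y))"
          unfolding left_diff_distrib by (intro integrable_norm Bochner_Integration.integrable_diff int)
        show "integrable M (\<lambda>y. d * cmod (f y))" using f by simp
        show "cmod ((F (x, y) - F (x0, y)) * f y) \<le> d * cmod (f y)" for y
          unfolding norm_mult by (intro mult_right_mono less) simp
      qed
      also have "\<dots> = d * I" by (simp add: I_def)
      also have "d * I < e" using \<open>e > 0\<close> \<open>I \<ge> 0\<close> by (simp add: d_def field_simps)
      finally show ?thesis by (simp add: dist_norm)
    qed
    then show "\<forall>\<^sub>F x in at x0. dist (\<integral>y. F (x, y) * f y \<partial>M) (\<integral>y. F (x0, y) * f y \<partial>M) < e"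
      using X(1,2) by (auto simp: eventually_at_topological)
  qed
  then show ?thesis by (simp add: continuous_on_def)
qed

lemma continuous_on_diff_arg:
  fixes k :: "'g \<Rightarrow> complex"
  assumes "continuous_on UNIV k"
  shows "continuous_on UNIV (\<lambda>z. k (fst z - snd z))"
  by (rule continuous_on_compose2[OF assms]) (auto intro!: continuous_intros)

lemma continuous_on_compose_UNIV:
  assumes "continuous_on UNIV k" "continuous_on UNIV h"
  shows "continuous_on UNIV (\<lambda>x. k (h x))"
  by (rule continuous_on_compose2[OF assms]) simp

text \<open>
  Integrate \<open>k (x - y)\<close> over the square in both orders. One order leads to the integral of \<open>k\<close>, the
  other to that of its reflection.
\<close>

lemma integral_uminus:
  fixes k :: "'g \<Rightarrow> complex"
  assumes "continuous_on UNIV k"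
  shows "(\<integral>x. k (- x) \<partial>M) = (\<integral>x. k x \<partial>M)"
proof -
  have k': "continuous_on UNIV (\<lambda>y. k (- y))"
    by (intro continuous_on_compose_UNIV[OF assms] continuous_intros)
  have 1: "(\<integral>x. k (x - y) \<partial>M) = (\<integral>x. k x \<partial>M)" for y
    using integral_translate[OF continuous_measurable[OF assms], of "- y"] by simp
  have 2: "(\<integral>y. k (x - y) \<partial>M) = (\<integral>y. k (- y) \<partial>M)" for x
    using integral_translate[OF continuous_measurable[OF k'], of "- x"] by simp
  have "(\<integral>x. (\<integral>y. k (x - y) * 1 \<partial>M) \<partial>M) = (\<integral>y. (\<integral>x. k (x - y) \<partial>M) * 1 \<partial>M)"
    using continuous_kernel_Fubini[OF continuous_on_diff_arg[OF assms] continuous_integrable[of "\<lambda>x. 1"]]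
    by simp
  then show ?thesis
    by (simp add: 1 2 prob_space[unfolded space_M])
qed

lemma convolve_continuous:
  assumes "continuous_on UNIV k" "integrable M f"
  shows "continuous_on UNIV (convolve M k f)"
  using continuous_kernel_integral[OF continuous_on_diff_arg[OF assms(1)] assms(2)]
  by (simp add: convolve_def)

lemma convolve_integrable:
  fixes k :: "'g \<Rightarrow> complex"
  assumes "continuous_on UNIV k" "integrable M f"
  shows "integrable M (\<lambda>y. k (x - y) * f y)"
proof -
  have k: "continuous_on UNIV (\<lambda>y. k (x - y))"
    by (intro continuous_on_compose_UNIV[OF assms(1)] continuous_intros)
  obtain C where "\<And>y. cmod (k (x - y)) \<le> C" using continuous_bounded[OF compact_UNIV k] by blast
  then show ?thesis by (intro integrable_bounded_mult[OF assms(2)] continuous_measurable k)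
qed

lemma convolve_assoc:
  assumes k: "continuous_on UNIV k" and l: "continuous_on UNIV l" and m: "integrable M m"
  shows "convolve M (convolve M k l) m = convolve M k (convolve M l m)"
proof
  fix x
  have c: "continuous_on UNIV (\<lambda>z. k (x - fst z) * l (fst z - snd z))"
    by (intro continuous_intros continuous_on_compose_UNIV[OF k] continuous_on_compose_UNIV[OF l])
  have "convolve M k l (x - y) = (\<integral>z. k (x - z) * l (z - y) \<partial>M)" for y
  proof -
    have "continuous_on UNIV (\<lambda>z. k (x - z) * l (z - y))"
      by (intro continuous_intros continuous_on_compose_UNIV[OF k] continuous_on_compose_UNIV[OF l])
    from integral_translate[OF continuous_measurable[OF this], of y]
    show ?thesis by (simp add: convolve_def diff_diff_eq)
  qed
  then have "convolve M (convolve M k l) m x = (\<integral>y. (\<integral>z. k (x - z) * l (z - y) \<partial>M) * m y \<partial>M)"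
    by (simp add: convolve_def)
  also have "\<dots> = (\<integral>z. (\<integral>y. k (x - z) * l (z - y) * m y \<partial>M) \<partial>M)"
    using continuous_kernel_Fubini[OF c m] by simp
  also have "\<dots> = convolve M k (convolve M l m) x"
    by (simp add: convolve_def mult.assoc)
  finally show "convolve M (convolve M k l) m x = convolve M k (convolve M l m) x" .
qed

lemma convolve_commute:
  assumes k: "continuous_on UNIV k" and l: "continuous_on UNIV l"
  shows "convolve M k l = convolve M l k"
proof
  fix x
  have "continuous_on UNIV (\<lambda>y. k (x + y) * l (- y))"
    by (intro continuous_intros continuous_on_compose_UNIV[OF k] continuous_on_compose_UNIV[OF l])
  note integral_uminus[OF this]
  moreover have "continuous_on UNIV (\<lambda>y. l (x - y) * k y)"
    by (intro continuous_intros k continuous_on_compose_UNIV[OF l])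
  note integral_translate[OF continuous_measurable[OF this], of x]
  ultimately show "convolve M k l x = convolve M l k x"
    by (simp add: convolve_def mult.commute)
qed

lemma convolve_add_left:
  assumes "continuous_on UNIV k" "continuous_on UNIV l" "integrable M f"
  shows "convolve M (\<lambda>x. k x + l x) f = (\<lambda>x. convolve M k f x + convolve M l f x)"
  using assms by (simp add: convolve_def distrib_right convolve_integrable)

lemma convolve_add_right:
  assumes "continuous_on UNIV k" "integrable M f" "integrable M h"
  shows "convolve M k (\<lambda>x. f x + h x) = (\<lambda>x. convolve M k f x + convolve M k h x)"
  using assms by (simp add: convolve_def distrib_left convolve_integrable)

lemma convolve_cmult_left: "convolve M (\<lambda>x. c * k x) f = (\<lambda>x. c * convolve M k f x)"
  by (simp add: convolve_def mult.assoc)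

lemma convolve_cmult_right: "convolve M k (\<lambda>x. c * f x) = (\<lambda>x. c * convolve M k f x)"
  by (simp add: convolve_def mult.left_commute)

lemma convolve_translate: "convolve M (\<lambda>x. k (g + x)) f = (\<lambda>x. convolve M k f (g + x))"
  by (simp add: convolve_def add_diff_eq)

lemma hermitian_convolve:
  assumes "continuous_on UNIV k" "continuous_on UNIV l" "hermitian k" "hermitian l"
  shows "hermitian (convolve M k l)"
  unfolding hermitian_def
proof
  fix x
  have "continuous_on UNIV (\<lambda>y. k (- x - y) * l y)"
    by (intro continuous_intros assms continuous_on_compose_UNIV[OF assms(1)])
  from integral_uminus[OF this]
  have "convolve M k l (- x) = (\<integral>y. k (- (x - y)) * l (- y) \<partial>M)"
    by (simp add: convolve_def)
  also have "\<dots> = (\<integral>y. cnj (k (x - y) * l y) \<partial>M)"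
    using assms(3,4) unfolding hermitian_def by (simp only: complex_cnj_mult)
  also have "\<dots> = cnj (convolve M k l x)"
    unfolding convolve_def by (rule Bochner_Integration.integral_cnj)
  finally show "convolve M k l (- x) = cnj (convolve M k l x)" .
qed

lemma convolve_hermitian_0:
  assumes "hermitian k"
  shows "convolve M k f 0 = L2_inner M f k"
  using assms by (simp add: convolve_def L2_inner_def hermitian_def mult.commute)

lemma convolve_hermitian_bound:
  assumes k: "continuous_on UNIV k" "hermitian k" and f: "f \<in> L2 M"
  shows "cmod (convolve M k f x) \<le> L2_norm M k * L2_norm M f"
proof -
  have c: "continuous_on UNIV (\<lambda>y. k (x - y))"
    by (intro continuous_on_compose_UNIV[OF k(1)] continuous_intros)
  have "cmod (k (x - y)) = cmod (k (- x + y))" for y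
  proof -
    have "k (- (- x + y)) = cnj (k (- x + y))" using k(2) unfolding hermitian_def by blast
    then show ?thesis by (simp add: complex_mod_cnj)
  qed
  moreover have "(\<lambda>y. (cmod (k y))\<^sup>2) \<in> borel_measurable M"
    by (intro continuous_measurable continuous_intros k(1))
  note integral_translate[OF this, of "- x"]
  ultimately have "L2_norm M (\<lambda>y. k (x - y)) = L2_norm M k"
    by (simp add: L2_norm_def)
  then show ?thesis
    using L2_Cauchy_Schwarz_mult[OF continuous_L2[OF c] f] by (simp add: convolve_def)
qed

lemma uniform_limit_L2:
  assumes F: "\<And>n. continuous_on UNIV (F n)" and f: "continuous_on UNIV f"
    and lim: "uniform_limit UNIV F f sequentially"
  shows "(\<lambda>n. L2_norm M (\<lambda>x. F n x - f x)) \<longlonglongrightarrow> 0"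
proof (rule tendstoI)
  fix e :: real assume "e > 0"
  then have "\<forall>\<^sub>F n in sequentially. \<forall>x\<in>UNIV. dist (F n x) (f x) < e / 2"
    by (intro uniform_limitD[OF lim]) simp
  then show "\<forall>\<^sub>F n in sequentially. dist (L2_norm M (\<lambda>x. F n x - f x)) 0 < e"
  proof eventually_elim
    case (elim n)
    have "L2_norm M (\<lambda>x. F n x - f x) \<le> e / 2"
      using elim \<open>e > 0\<close> F[of n] f
      by (intro L2_norm_le_sup continuous_L2 continuous_intros) (auto simp: dist_norm less_imp_le)
    then show ?case using \<open>e > 0\<close> by simp
  qed
qed

lemma convolve_uniform_limit_right:
  assumes k: "continuous_on UNIV k" and F: "\<And>n. continuous_on UNIV (F n)"
    and f: "continuous_on UNIV f" and lim: "uniform_limit UNIV F f sequentially"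
  shows "(\<lambda>n. convolve M k (F n) x) \<longlonglongrightarrow> convolve M k f x"
proof -
  have kx: "continuous_on UNIV (\<lambda>y. k (x - y))"
    by (intro continuous_on_compose_UNIV[OF k] continuous_intros)
  have "(\<lambda>n. \<integral>y. F n y * k (x - y) \<partial>M) \<longlonglongrightarrow> (\<integral>y. f y * k (x - y) \<partial>M)"
    by (rule L2_integral_mult_tendsto[OF _ _ uniform_limit_L2[OF F f lim]])
       (intro continuous_L2 F f kx)+
  then show ?thesis by (simp add: convolve_def mult.commute)
qed

end

section \<open>The largest eigenvalue of a hermitian kernel\<close>

text \<open>
  If \<open>A n\<close> is the trace of \<open>K\<^sup>2\<^sup>n\<^sup>+\<^sup>2\<close> for a nonzero self-adjoint
  Hilbert-Schmidt operator \<open>K\<close>, these hypotheses are satisfied, \<open>\<kappa>\<close> is the largest eigenvalue of \<open>K\<^sup>2\<close>, and \<open>L\<close> is its multiplicity. By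
  log-convexity the quotients \<open>A (n + 1) / A n\<close> increase to some \<open>\<kappa>\<close>, so that
  \<open>A n / \<kappa>\<^sup>n\<^sup>+\<^sup>1\<close> decreases. If it fell below \<open>1\<close>, submultiplicativity would make
  \<open>A\<close> grow more slowly than its quotients allow.
\<close>

lemma log_convex_submultiplicative_limit:
  fixes A :: "nat \<Rightarrow> real"
  assumes pos: "\<And>n. A n > 0" and conv: "\<And>n. (A (Suc n))\<^sup>2 \<le> A n * A (Suc (Suc n))"
    and sub: "\<And>m n. A (m + n + 1) \<le> A m * A n"
  obtains \<kappa> L where "\<kappa> > 0" "L \<ge> 1" "(\<lambda>n. A n / \<kappa> ^ (n + 1)) \<longlonglongrightarrow> L"
proof -
  define r where "r n = A (Suc n) / A n" for n
  have r_pos: "r n > 0" for n using pos by (simp add: r_def)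
  have "r n \<le> r (Suc n)" for n
    using conv[of n] pos[of n] pos[of "Suc n"] by (simp add: r_def field_simps power2_eq_square)
  then have "incseq r" by (rule incseq_SucI)
  moreover have r_le: "r n \<le> A 0" for n
    using sub[of 0 n] pos[of n] by (simp add: r_def divide_le_eq)
  ultimately obtain l where l: "r \<longlonglongrightarrow> l" "\<And>n. r n \<le> l"
    using incseq_convergent[of r "A 0"] by blast
  have "l > 0" using r_pos[of 0] l(2)[of 0] by linarith
  define E where "E n = A n / l ^ (n + 1)" for n
  have E_Suc: "E (Suc n) \<le> E n" for n
  proof -
    have "A (Suc n) \<le> l * A n" using l(2)[of n] pos[of n] by (simp add: r_def divide_le_eq)
    then show ?thesis using \<open>l > 0\<close> by (simp add: E_def field_simps)
  qed
  have E_ge: "E N \<ge> 1" for N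
  proof (rule ccontr)
    assume "\<not> E N \<ge> 1"
    then have "A N < l ^ (N + 1)" using \<open>l > 0\<close> by (simp add: E_def field_simps)
    have "(\<lambda>n. r n ^ (N + 1)) \<longlonglongrightarrow> l ^ (N + 1)" by (intro tendsto_power l)
    then have "\<forall>\<^sub>F n in sequentially. A N < r n ^ (N + 1)"
      using \<open>A N < l ^ (N + 1)\<close> by (rule order_tendstoD(1))
    then obtain n0 where n0: "A N < r n0 ^ (N + 1)" by (auto simp: eventually_sequentially)
    \<comment> \<open>from \<open>n0\<close> on, \<open>A\<close> grows at least by the factor \<open>\<rho>\<close>, yet \<open>A N\<close> is less than \<open>\<rho> ^ (N + 1)\<close>\<close>
    define \<rho> where "\<rho> = r n0"
    have \<rho>: "\<rho> > 0" "A N < \<rho> ^ (N + 1)" using n0 r_pos by (auto simp: \<rho>_def)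
    have lower: "A n0 * \<rho> ^ j \<le> A (n0 + j)" for j
    proof (induction j)
      case (Suc j)
      have "\<rho> \<le> r (n0 + j)" using \<open>incseq r\<close> by (simp add: \<rho>_def incseq_def)
      then have "\<rho> * A (n0 + j) \<le> A (Suc (n0 + j))"
        using pos[of "n0 + j"] by (simp add: r_def le_divide_eq)
      moreover have "\<rho> * (A n0 * \<rho> ^ j) \<le> \<rho> * A (n0 + j)"
        using Suc \<rho>(1) by (intro mult_left_mono) auto
      ultimately show ?case by (simp add: algebra_simps)
    qed simp
    have upper: "A (j * (N + 1) + N) \<le> A N ^ (j + 1)" for j
    proof (induction j)
      case (Suc j)
      have "A (Suc j * (N + 1) + N) = A ((j * (N + 1) + N) + N + 1)" by (simp add: algebra_simps)
      also have "\<dots> \<le> A (j * (N + 1) + N) * A N" by (rule sub)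
      also have "\<dots> \<le> A N ^ (j + 1) * A N"
        using Suc pos[of N] by (intro mult_right_mono) auto
      finally show ?case by (simp add: mult.commute)
    qed simp
    define c where "c = A n0 / \<rho> ^ (n0 + 1)"
    have "c > 0" using pos \<rho> by (simp add: c_def)
    define q where "q = A N / \<rho> ^ (N + 1)"
    have q: "0 \<le> q" "q < 1" using \<rho> pos[of N] by (auto simp: q_def intro: less_imp_le)
    obtain n1 where n1: "q ^ n1 < c" using real_arch_pow_inv[OF \<open>c > 0\<close> q(2)] by blast
    define j where "j = max n0 n1"
    have "q ^ (j + 1) \<le> q ^ n1" using q by (intro power_decreasing) (auto simp: j_def)
    moreover have "c \<le> q ^ (j + 1)"
    proof -
      define i where "i = j * (N + 1) + N - n0"
      have i: "n0 + i = j * (N + 1) + N" by (simp add: i_def j_def)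
      have "A n0 * \<rho> ^ i \<le> A N ^ (j + 1)" using lower[of i] upper[of j] i by simp
      moreover have "\<rho> ^ (n0 + 1) * \<rho> ^ i = (\<rho> ^ (N + 1)) ^ (j + 1)"
      proof -
        have "n0 + 1 + i = (N + 1) * (j + 1)" using i by (simp add: algebra_simps)
        then show ?thesis by (simp only: power_mult[symmetric] power_add[symmetric])
      qed
      then have "c * (\<rho> ^ (N + 1)) ^ (j + 1) = A n0 * \<rho> ^ i"
        using \<rho>(1) unfolding c_def by (simp add: field_simps)
      ultimately have "c * (\<rho> ^ (N + 1)) ^ (j + 1) \<le> A N ^ (j + 1)" by simp
      then show ?thesis
        using \<rho>(1) unfolding q_def power_divide by (subst pos_le_divide_eq) (auto simp del: power_Suc)
    qed
    ultimately show False using n1 by linarith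
  qed
  have "decseq E" using E_Suc by (rule decseq_SucI)
  then obtain L where "E \<longlonglongrightarrow> L" "\<And>n. L \<le> E n"
    using decseq_convergent[of E 1] E_ge by blast
  moreover have "L \<ge> 1"
    by (rule LIMSEQ_le_const[OF \<open>E \<longlonglongrightarrow> L\<close>]) (use E_ge in auto)
  ultimately show thesis using that[of l L] \<open>l > 0\<close> unfolding E_def by blast
qed

lemma dual_0: "\<gamma> \<in> dual \<Longrightarrow> \<gamma> 0 = 1"
proof -
  assume g: "\<gamma> \<in> dual"
  then have "\<gamma> (0 + 0) = \<gamma> 0 * \<gamma> 0" "cmod (\<gamma> 0) = 1" unfolding dual_def by blast+
  then show ?thesis by auto
qed

lemma dual_add: "\<gamma> \<in> dual \<Longrightarrow> \<gamma> (x + y) = \<gamma> x * \<gamma> y"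
  by (simp add: dual_def)

lemma dual_norm: "\<gamma> \<in> dual \<Longrightarrow> cmod (\<gamma> x) = 1"
  by (simp add: dual_def)

lemma dual_cont: "\<gamma> \<in> dual \<Longrightarrow> continuous_on UNIV \<gamma>"
  by (simp add: dual_def)

lemma dual_cnj_mult: "\<gamma> \<in> dual \<Longrightarrow> cnj (\<gamma> x) * \<gamma> x = 1"
  using complex_norm_square[of "\<gamma> x"] by (simp add: dual_norm mult.commute)

lemma dual_uminus:
  assumes "\<gamma> \<in> dual"
  shows "\<gamma> (- x) = cnj (\<gamma> x)"
proof -
  have "\<gamma> (- x) * \<gamma> x = 1" using dual_add[OF assms, of "- x" x] dual_0[OF assms] by simp
  then have "\<gamma> (- x) * \<gamma> x = cnj (\<gamma> x) * \<gamma> x" by (simp add: dual_cnj_mult[OF assms])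
  moreover have "\<gamma> x \<noteq> 0" using dual_norm[OF assms, of x] by auto
  ultimately show ?thesis by simp
qed

lemma dual_fmult: "\<gamma> \<in> dual \<Longrightarrow> \<psi> \<in> dual \<Longrightarrow> \<gamma> \<cdot>\<^sub>f \<psi> \<in> dual"
  by (auto simp: dual_def fmult_def norm_mult mult_ac intro!: continuous_intros)

lemma dual_fcnj: "\<gamma> \<in> dual \<Longrightarrow> fcnj \<gamma> \<in> dual"
  by (auto simp: dual_def fcnj_def intro!: continuous_intros)

lemma dual_unit_char: "unit_char \<in> dual"
  by (auto simp: dual_def unit_char_def)

context compact_haar
begin

text \<open>
  Finitely many translates of a nonempty open set cover the group, and all of them have the same measure.
\<close>

lemma open_measure_pos:
  assumes "open U" "U \<noteq> {}"
  shows "measure M U > 0"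
proof -
  obtain u where u: "u \<in> U" using assms by blast
  define V where "V g = {x. - g + x \<in> U}" for g
  have V: "open (V g)" for g
  proof -
    have "continuous_on UNIV (\<lambda>x. - g + x)" by (intro continuous_intros)
    from open_vimage[OF assms(1) this] show ?thesis by (simp add: V_def vimage_def)
  qed
  have "x \<in> V (x - u)" for x using u by (simp add: V_def)
  then have "UNIV \<subseteq> (\<Union>g\<in>UNIV. V g)" by blast
  then obtain K where K: "finite K" "UNIV \<subseteq> (\<Union>g\<in>K. V g)"
    using compactE_image[OF compact_UNIV, of UNIV V] V by metis
  have "measure M (V g) = measure M U" for g
  proof -
    have "measure (distr M borel ((+) (- g))) U = measure M ((+) (- g) -` U \<inter> space M)"
      using assms(1) by (intro measure_distr) auto
    then show ?thesis by (simp add: distr_translate V_def vimage_def)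
  qed
  then have "(\<Sum>g\<in>K. measure M (V g)) = card K * measure M U" by simp
  moreover have "1 \<le> (\<Sum>g\<in>K. measure M (V g))"
  proof -
    have "1 = measure M UNIV" using prob_space by simp
    also have "\<dots> = measure M (\<Union>g\<in>K. V g)" using K(2) by (simp add: top.extremum_unique)
    also have "\<dots> \<le> (\<Sum>g\<in>K. measure M (V g))"
      using V by (intro finite_measure_subadditive_finite K(1)) auto
    finally show ?thesis .
  qed
  ultimately have "measure M U \<noteq> 0" by auto
  then show ?thesis by (simp add: zero_less_measure_iff)
qed

lemma continuous_AE_imp_all:
  fixes f :: "'g \<Rightarrow> 'b::t2_space"
  assumes "continuous_on UNIV f" "continuous_on UNIV h" "AE x in M. f x = h x"
  shows "f x = h x"
proof (rule ccontr)
  assume "f x \<noteq> h x"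
  have o: "open {x. f x \<noteq> h x}" by (rule open_Collect_neq[OF assms(1,2)])
  then have "measure M {x. f x \<noteq> h x} > 0" by (rule open_measure_pos) (use \<open>f x \<noteq> h x\<close> in blast)
  moreover have "measure M {x. f x \<noteq> h x} = 0"
    using assms(3) o by (subst (asm) AE_iff_measurable[OF _ refl]) (auto simp: measure_def)
  ultimately show False by simp
qed

lemma continuous_L2_norm_0:
  assumes "continuous_on UNIV f" "L2_norm M f = 0"
  shows "f = (\<lambda>x. 0)"
  using continuous_AE_imp_all[OF assms(1) continuous_on_const L2_norm_eq_0_AE[OF continuous_L2[OF assms(1)] assms(2)]]
  by auto

lemma fourier_convolve:
  assumes k: "continuous_on UNIV k" and f: "integrable M f" and \<gamma>: "\<gamma> \<in> dual"
  shows "fourier M (convolve M k f) \<gamma> = fourier M k \<gamma> * fourier M f \<gamma>"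
proof -
  have c: "continuous_on UNIV (\<lambda>z. k (fst z - snd z) * cnj (\<gamma> (fst z)))"
    by (intro continuous_intros continuous_on_diff_arg k continuous_on_compose_UNIV[OF dual_cont[OF \<gamma>]])
  have "(\<integral>x. k (x - y) * cnj (\<gamma> x) \<partial>M) = fourier M k \<gamma> * cnj (\<gamma> y)" for y
  proof -
    have "continuous_on UNIV (\<lambda>x. k (x - y) * cnj (\<gamma> x))"
      by (intro continuous_intros continuous_on_compose_UNIV[OF k] dual_cont[OF \<gamma>])
    from integral_translate[OF continuous_measurable[OF this], of y]
    have "(\<integral>x. k (x - y) * cnj (\<gamma> x) \<partial>M) = (\<integral>x. (k x * cnj (\<gamma> x)) * cnj (\<gamma> y) \<partial>M)"
      by (simp add: dual_add[OF \<gamma>] mult_ac)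
    then show ?thesis by (simp add: fourier_def)
  qed
  then have "(\<integral>y. (\<integral>x. k (x - y) * cnj (\<gamma> x) \<partial>M) * f y \<partial>M) = (\<integral>y. fourier M k \<gamma> * (f y * cnj (\<gamma> y)) \<partial>M)"
    by (simp add: mult_ac)
  also have "\<dots> = fourier M k \<gamma> * fourier M f \<gamma>"
    unfolding fourier_def by (rule integral_mult_right_zero)
  finally have *: "(\<integral>y. (\<integral>x. k (x - y) * cnj (\<gamma> x) \<partial>M) * f y \<partial>M) = fourier M k \<gamma> * fourier M f \<gamma>" .
  have "fourier M (convolve M k f) \<gamma> = (\<integral>x. (\<integral>y. k (x - y) * cnj (\<gamma> x) * f y \<partial>M) \<partial>M)"
  proof -
    have "convolve M k f x * cnj (\<gamma> x) = (\<integral>y. k (x - y) * cnj (\<gamma> x) * f y \<partial>M)" for x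
      unfolding convolve_def integral_mult_left_zero[symmetric] by (simp add: mult_ac)
    then show ?thesis by (simp add: fourier_def)
  qed
  also have "\<dots> = (\<integral>y. (\<integral>x. k (x - y) * cnj (\<gamma> x) \<partial>M) * f y \<partial>M)"
    using continuous_kernel_Fubini[OF c f] by simp
  finally show ?thesis using * by simp
qed

text \<open>
  Convolution by \<open>k\<close> is a compact self-adjoint operator, and \<open>e\<close> is the kernel of the projection onto
  the eigenspaces whose eigenvalues have the largest modulus. It is the limit of the even powers of \<open>k\<close>, normalised by
  the powers of \<open>\<kappa>\<close>. The inner product of two powers is the value of another power at \<open>0\<close>, so
  all distances between the normalised powers can be read off from the norms of the powers, and the limit of these norms
  shows that the sequence is Cauchy in \<open>L\<^sup>2\<close>. One more convolution makes it uniformly Cauchy.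
\<close>

lemma hermitian_kernel_top_idempotent:
  assumes k: "continuous_on UNIV k" "hermitian k" "k \<noteq> (\<lambda>x. 0)"
  obtains e \<kappa> where "continuous_on UNIV e" "hermitian e" "convolve M e e = e" "e \<noteq> (\<lambda>x. 0)"
    "\<kappa> \<noteq> 0" "convolve M (convolve M k k) e = (\<lambda>x. of_real \<kappa> * e x)"
    "\<And>e0. continuous_on UNIV e0 \<Longrightarrow> convolve M k e0 = k \<Longrightarrow> convolve M e e0 = e"
proof -
  \<comment> \<open>\<open>p n\<close> is the convolution power of \<open>k\<close> with exponent \<open>n + 1\<close>\<close>
  define p where "p n = (convolve M k ^^ n) k" for n
  have p_0: "p 0 = k" and p_Suc: "p (Suc n) = convolve M k (p n)" for n by (simp_all add: p_def)
  have p_cont: "continuous_on UNIV (p n)" for n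
    by (induction n) (auto simp: p_0 p_Suc k(1) intro!: convolve_continuous continuous_integrable)
  have p_herm: "hermitian (p n)" for n
    by (induction n) (auto simp: p_0 p_Suc k intro!: hermitian_convolve p_cont)
  have p_conv: "convolve M (p m) (p n) = p (m + n + 1)" for m n
    by (induction m)
       (simp_all add: p_0 p_Suc convolve_assoc[OF k(1) p_cont continuous_integrable[OF p_cont]])
  note p_L2 = continuous_L2[OF p_cont]
  define A where "A n = (L2_norm M (p n))\<^sup>2" for n
  have inner: "L2_inner M (p n) (p m) = p (m + n + 1) 0" for m n
    using convolve_hermitian_0[OF p_herm, of m "p n"] by (simp add: p_conv)
  have p_odd_0: "p (2 * n + 1) 0 = of_real (A n)" for n
    using inner[of n n] by (simp add: L2_inner_self A_def mult_2)
  have bound: "cmod (p (m + n + 1) x) \<le> L2_norm M (p m) * L2_norm M (p n)" for m n x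
    using convolve_hermitian_bound[OF p_cont p_herm p_L2, of m n x] by (simp add: p_conv)
  have conv: "(A (Suc n))\<^sup>2 \<le> A n * A (Suc (Suc n))" for n
  proof -
    have "A (Suc n) = cmod (p (2 * Suc n + 1) 0)" by (simp only: p_odd_0 norm_of_real) (simp add: A_def)
    also have "2 * Suc n + 1 = n + Suc (Suc n) + 1" by simp
    finally have "A (Suc n) \<le> L2_norm M (p n) * L2_norm M (p (Suc (Suc n)))" using bound by metis
    then have "(A (Suc n))\<^sup>2 \<le> (L2_norm M (p n) * L2_norm M (p (Suc (Suc n))))\<^sup>2"
      by (rule power_mono) (simp add: A_def)
    then show ?thesis by (simp add: A_def power_mult_distrib)
  qed
  have sub: "A (m + n + 1) \<le> A m * A n" for m n
  proof -
    have le: "L2_norm M (p (2 * n + 1)) \<le> A n" for n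
      by (rule L2_norm_le_sup[OF _ p_L2])
         (use bound[of n n] in \<open>auto simp: A_def power2_eq_square mult_2\<close>)
    have "A (m + n + 1) = cmod (p (2 * (m + n + 1) + 1) 0)" by (simp only: p_odd_0 norm_of_real) (simp add: A_def)
    also have "2 * (m + n + 1) + 1 = (2 * m + 1) + (2 * n + 1) + 1" by simp
    finally have "A (m + n + 1) \<le> L2_norm M (p (2 * m + 1)) * L2_norm M (p (2 * n + 1))" using bound by metis
    also have "\<dots> \<le> A m * A n" by (intro mult_mono le) (simp_all add: A_def)
    finally show ?thesis .
  qed
  have nz: "A n > 0" if "p n \<noteq> (\<lambda>x. 0)" for n
  proof -
    have "L2_norm M (p n) \<noteq> 0" using that continuous_L2_norm_0[OF p_cont] by blast
    then show ?thesis by (simp add: A_def)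
  qed
  have pos: "A n > 0 \<and> A (Suc n) > 0" for n
  proof (induction n)
    case 0
    have "A 0 > 0" by (rule nz) (simp add: p_0 k)
    then have "p 1 0 \<noteq> 0" using p_odd_0[of 0] by auto
    then have "A (Suc 0) > 0" by (intro nz) auto
    with \<open>A 0 > 0\<close> show ?case by simp
  next
    case (Suc n)
    then have "0 < A n * A (Suc (Suc n))" using conv[of n] by (metis less_le_trans zero_less_power)
    then show ?case using Suc by (simp add: zero_less_mult_iff)
  qed
  then obtain \<kappa> L where l: "\<kappa> > 0" "L \<ge> 1" and lim: "(\<lambda>n. A n / \<kappa> ^ (n + 1)) \<longlonglongrightarrow> L"
    using log_convex_submultiplicative_limit[of A] conv sub by metis
  define E where "E n = A n / \<kappa> ^ (n + 1)" for n
  define e where "e n x = of_real (1 / \<kappa> ^ (n + 1)) * p (2 * n + 1) x" for n x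
  have e_cont: "continuous_on UNIV (e n)" for n
    unfolding e_def by (intro continuous_intros p_cont)
  note e_L2 = continuous_L2[OF e_cont]
  have e_conv: "convolve M (e m) (e n) = e (m + n + 1)" for m n
  proof -
    have "convolve M (e m) (e n) = (\<lambda>x. of_real (1 / \<kappa> ^ (m + 1)) * (of_real (1 / \<kappa> ^ (n + 1)) *
        p (2 * m + 1 + (2 * n + 1) + 1) x))"
      unfolding e_def convolve_cmult_left convolve_cmult_right p_conv ..
    moreover have "2 * m + 1 + (2 * n + 1) + 1 = 2 * (m + n + 1) + 1" by simp
    moreover have "complex_of_real (1 / \<kappa> ^ (m + 1)) * of_real (1 / \<kappa> ^ (n + 1)) = of_real (1 / \<kappa> ^ (m + n + 1 + 1))"
      by (simp add: power_add)
    ultimately show ?thesis unfolding e_def by (simp only: mult.assoc[symmetric])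
  qed
  have e_herm: "hermitian (e n)" for n using p_herm[of "2 * n + 1"] by (simp add: e_def hermitian_def)
  have e_0: "e n 0 = of_real (E n)" for n
    unfolding e_def p_odd_0 by (simp add: E_def)
  have e_inner: "L2_inner M (e n) (e m) = of_real (E (m + n + 1))" for m n
    using convolve_hermitian_0[OF e_herm, of m "e n"] by (simp only: e_conv e_0)
  have e_dist: "(L2_norm M (\<lambda>x. e m x - e n x))\<^sup>2 = E (2 * m + 1) + E (2 * n + 1) - 2 * E (m + n + 1)" for m n
  proof -
    have "(L2_norm M (e n))\<^sup>2 = E (2 * n + 1)" for n
      using e_inner[of n n] L2_inner_self[of M "e n"] by (metis mult_2 of_real_eq_iff)
    then show ?thesis
      unfolding L2_norm_diff_power2[OF e_L2 e_L2] e_inner by (simp add: add.commute)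
  qed
  have K_e: "convolve M (p 1) (e n) = (\<lambda>x. of_real \<kappa> * e (Suc n) x)" for n
  proof -
    have "convolve M (p 1) (e n) = (\<lambda>x. of_real (1 / \<kappa> ^ (n + 1)) * p (1 + (2 * n + 1) + 1) x)"
      unfolding e_def convolve_cmult_right p_conv ..
    also have "1 + (2 * n + 1) + 1 = 2 * Suc n + 1" by simp
    also have "complex_of_real (1 / \<kappa> ^ (n + 1)) = of_real \<kappa> * of_real (1 / \<kappa> ^ (Suc n + 1))"
      using l by simp
    finally show ?thesis unfolding e_def by (simp only: mult.assoc)
  qed
  define C where "C = L2_norm M (p 1) / \<kappa>"
  have "C \<ge> 0" using l by (simp add: C_def)
  have e_bound: "cmod (e (Suc m) x - e (Suc n) x) \<le> C * L2_norm M (\<lambda>x. e m x - e n x)" for m n x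
  proof -
    have int: "integrable M (e n)" for n by (rule continuous_integrable[OF e_cont])
    have "convolve M (p 1) (\<lambda>x. e m x + (-1) * e n x) x =
        convolve M (p 1) (e m) x + (-1) * convolve M (p 1) (e n) x"
      by (simp only: convolve_add_right[OF p_cont int L2_integrable[OF L2_cmult[OF e_L2]]] convolve_cmult_right)
    then have "of_real \<kappa> * (e (Suc m) x - e (Suc n) x) = convolve M (p 1) (\<lambda>x. e m x - e n x) x"
      unfolding K_e by (simp add: algebra_simps)
    then have "\<kappa> * cmod (e (Suc m) x - e (Suc n) x) = cmod (convolve M (p 1) (\<lambda>x. e m x - e n x) x)"
      using l by (metis norm_mult norm_of_real abs_of_pos)
    also have "\<dots> \<le> L2_norm M (p 1) * L2_norm M (\<lambda>x. e m x - e n x)"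
      by (intro convolve_hermitian_bound p_cont p_herm L2_diff e_L2)
    finally show ?thesis using l by (simp add: C_def field_simps)
  qed
  have "uniformly_Cauchy_on UNIV (\<lambda>n. e (Suc n))"
  proof (rule uniformly_Cauchy_onI)
    fix d :: real assume "d > 0"
    define b where "b = (d / (C + 1))\<^sup>2 / 4"
    have "b > 0" using \<open>d > 0\<close> \<open>C \<ge> 0\<close> by (simp add: b_def)
    then have "\<forall>\<^sub>F n in sequentially. dist (E n) L < b"
      using lim unfolding E_def by (intro tendstoD)
    then obtain N where N: "\<And>n. n \<ge> N \<Longrightarrow> dist (E n) L < b"
      by (auto simp: eventually_sequentially)
    have "dist (e (Suc m) x) (e (Suc n) x) < d" if "m \<ge> N" "n \<ge> N" for m n x
    proof -
      have "dist (E (2 * m + 1)) L < b" "dist (E (2 * n + 1)) L < b" "dist (E (m + n + 1)) L < b"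
        using that by (auto intro!: N)
      then have "(L2_norm M (\<lambda>x. e m x - e n x))\<^sup>2 < 4 * b"
        unfolding e_dist dist_real_def by argo
      also have "4 * b = (d / (C + 1))\<^sup>2" by (simp add: b_def)
      finally have "L2_norm M (\<lambda>x. e m x - e n x) < d / (C + 1)"
        by (rule power2_less_imp_less) (use \<open>d > 0\<close> \<open>C \<ge> 0\<close> in simp)
      then have "C * L2_norm M (\<lambda>x. e m x - e n x) \<le> C * (d / (C + 1))"
        using \<open>C \<ge> 0\<close> by (intro mult_left_mono) auto
      also have "\<dots> < d" using \<open>C \<ge> 0\<close> \<open>d > 0\<close> by (simp add: field_simps)
      finally show ?thesis using e_bound[of m x n] by (simp add: dist_norm)
    qed
    then show "\<exists>N. \<forall>x\<in>UNIV. \<forall>m\<ge>N. \<forall>n\<ge>N. dist (e (Suc m) x) (e (Suc n) x) < d" by blast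
  qed
  then obtain f where f: "uniform_limit UNIV (\<lambda>n. e (Suc n)) f sequentially"
    using Cauchy_uniformly_convergent uniformly_convergent_on_def by blast
  have f_cont: "continuous_on UNIV f"
    by (rule uniform_limit_theorem[OF _ f]) (simp_all add: e_cont)
  have f_lim: "(\<lambda>n. e (Suc n) x) \<longlonglongrightarrow> f x" for x
    by (rule tendsto_uniform_limitI[OF f]) simp
  have f_lim': "(\<lambda>n. e (Suc (n + m)) x) \<longlonglongrightarrow> f x" for x m
    using LIMSEQ_ignore_initial_segment[OF f_lim] .
  have conv_lim: "(\<lambda>n. convolve M q (e (Suc n)) x) \<longlonglongrightarrow> convolve M q f x" if "continuous_on UNIV q" for q x
    by (rule convolve_uniform_limit_right[OF that e_cont f_cont f])
  have conv_e: "convolve M (e m) f = f" for m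
  proof
    fix x
    have "(\<lambda>n. e (Suc (n + Suc m)) x) \<longlonglongrightarrow> convolve M (e m) f x"
      using conv_lim[OF e_cont, of m x] by (simp add: e_conv add_ac)
    then show "convolve M (e m) f x = f x" using f_lim' LIMSEQ_unique by blast
  qed
  have "convolve M f f = f"
  proof
    fix x
    have "(\<lambda>n. f x) \<longlonglongrightarrow> convolve M f f x"
      using conv_lim[OF f_cont, of x]
      by (simp only: convolve_commute[OF f_cont e_cont] conv_e)
    then show "convolve M f f x = f x" by (simp add: LIMSEQ_const_iff)
  qed
  moreover have "hermitian f"
    unfolding hermitian_def
  proof
    fix x
    have "(\<lambda>n. cnj (e (Suc n) x)) \<longlonglongrightarrow> cnj (f x)" by (intro tendsto_cnj f_lim)
    then have "(\<lambda>n. e (Suc n) (- x)) \<longlonglongrightarrow> cnj (f x)" using e_herm by (simp add: hermitian_def)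
    then show "f (- x) = cnj (f x)" using f_lim LIMSEQ_unique by blast
  qed
  moreover have "f \<noteq> (\<lambda>x. 0)"
  proof
    assume "f = (\<lambda>x. 0)"
    then have "(\<lambda>n. complex_of_real (E (Suc n))) \<longlonglongrightarrow> 0" using f_lim[of 0] by (simp add: e_0)
    then have "(\<lambda>n. E (Suc n)) \<longlonglongrightarrow> 0" by (simp add: tendsto_of_real_iff[of _ 0, simplified])
    moreover have "(\<lambda>n. E (Suc n)) \<longlonglongrightarrow> L" using lim unfolding E_def by (rule LIMSEQ_Suc)
    ultimately show False using l LIMSEQ_unique by fastforce
  qed
  moreover have "convolve M (convolve M k k) f = (\<lambda>x. of_real \<kappa> * f x)"
  proof
    fix x
    have "(\<lambda>n. of_real \<kappa> * e (Suc (n + 1)) x) \<longlonglongrightarrow> of_real \<kappa> * f x"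
      by (intro tendsto_intros f_lim')
    moreover have "(\<lambda>n. of_real \<kappa> * e (Suc (n + 1)) x) \<longlonglongrightarrow> convolve M (p 1) f x"
      using conv_lim[OF p_cont, of 1 x] unfolding K_e by simp
    moreover have "convolve M k k = p 1" using p_conv[of 0 0] by (simp add: p_0)
    ultimately show "convolve M (convolve M k k) f x = of_real \<kappa> * f x"
      using LIMSEQ_unique by metis
  qed
  moreover have "convolve M f e0 = f" if e0: "continuous_on UNIV e0" "convolve M k e0 = k" for e0
  proof
    fix x
    have p_e0: "convolve M (p n) e0 = p n" for n
    proof (induction n)
      case (Suc n)
      then show ?case
        unfolding p_Suc by (subst convolve_assoc[OF k(1) p_cont continuous_integrable[OF e0(1)]]) simp
    qed (simp add: p_0 e0)
    have "convolve M e0 (e n) = e n" for n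
      unfolding convolve_commute[OF e0(1) e_cont] unfolding e_def convolve_cmult_left p_e0 ..
    then have "(\<lambda>n. e (Suc n) x) \<longlonglongrightarrow> convolve M e0 f x" using conv_lim[OF e0(1), of x] by simp
    then show "convolve M f e0 x = f x"
      using f_lim LIMSEQ_unique convolve_commute[OF e0(1) f_cont] by metis
  qed
  ultimately show thesis using that[of f \<kappa>] f_cont l(1) by blast
qed

end

section \<open>Uniqueness of Fourier coefficients\<close>

context compact_haar
begin

text \<open>
  Since \<open>e\<close> is its own convolution square, its value at \<open>0\<close> is its squared norm and bounds all other
  values. It is the dimension of the space onto which convolution by \<open>e\<close> projects, which is why it is
  at least \<open>1\<close> unless \<open>e\<close> vanishes.
\<close>

lemma hermitian_idempotent_norm:
  assumes e: "continuous_on UNIV e" "hermitian e" "convolve M e e = e"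
  shows "e 0 = of_real ((L2_norm M e)\<^sup>2)" "cmod (e x) \<le> (L2_norm M e)\<^sup>2"
    and "e \<noteq> (\<lambda>x. 0) \<Longrightarrow> 1 \<le> (L2_norm M e)\<^sup>2"
proof -
  note eL = continuous_L2[OF e(1)]
  show "e 0 = of_real ((L2_norm M e)\<^sup>2)"
    using convolve_hermitian_0[OF e(2), of e] by (simp add: e(3) L2_inner_self)
  have le: "cmod (e x) \<le> (L2_norm M e)\<^sup>2" for x
    using convolve_hermitian_bound[OF e(1,2) eL, of x] by (simp add: e(3) power2_eq_square)
  then show "cmod (e x) \<le> (L2_norm M e)\<^sup>2" .
  assume "e \<noteq> (\<lambda>x. 0)"
  then have "L2_norm M e \<noteq> 0" using continuous_L2_norm_0[OF e(1)] by blast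
  then have "0 < L2_norm M e" using L2_norm_nonneg[of M e] by linarith
  moreover have "L2_norm M e \<le> (L2_norm M e)\<^sup>2" by (rule L2_norm_le_sup[OF le eL]) simp
  ultimately have "1 \<le> L2_norm M e" by (simp add: power2_eq_square)
  then show "1 \<le> (L2_norm M e)\<^sup>2" by (rule one_le_power)
qed

text \<open>
  Among the continuous functions without Fourier coefficients a nonzero one leads to a nonzero hermitian
  idempotent \<open>e\<close>. Its value at \<open>0\<close> drops by at least \<open>1\<close> when \<open>e\<close> is replaced by a proper
  subidempotent, so \<open>e\<close> can be taken minimal. By minimality every hermitian kernel \<open>k\<close> with \<open>k * e = k\<close>
  is a multiple of \<open>e\<close>. This applies to the two hermitian combinations of the translates of \<open>e\<close> by \<open>g\<close> and
  \<open>- g\<close>, so each translate of \<open>e\<close> is a multiple of \<open>e\<close>. The factors form a character, and \<open>e\<close>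
  is a multiple of this character, so that \<open>e\<close> has a nonzero Fourier coefficient after all.
\<close>

theorem continuous_fourier_unique:
  assumes f: "continuous_on UNIV f" and f0: "\<And>\<gamma>. \<gamma> \<in> dual \<Longrightarrow> fourier M f \<gamma> = 0"
  shows "f = (\<lambda>x. 0)"
proof (rule ccontr)
  assume "f \<noteq> (\<lambda>x. 0)"
  define idem where "idem e \<longleftrightarrow> continuous_on UNIV e \<and> hermitian e \<and> convolve M e e = e \<and>
    e \<noteq> (\<lambda>x. 0) \<and> (\<forall>\<gamma>\<in>dual. fourier M e \<gamma> = 0)" for e
  \<comment> \<open>the hermitian and the skew-hermitian part of \<open>f\<close> both have zero Fourier transform\<close>
  define f' where "f' = (\<lambda>x. cnj (f (- x)))"
  have f'_cont: "continuous_on UNIV f'"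
    unfolding f'_def by (intro continuous_intros continuous_on_compose_UNIV[OF f])
  have f'0: "fourier M f' \<gamma> = 0" if "\<gamma> \<in> dual" for \<gamma>
  proof -
    have "continuous_on UNIV (\<lambda>x. cnj (f x * cnj (\<gamma> x)))"
      by (intro continuous_intros f dual_cont that)
    from integral_uminus[OF this]
    have "(\<integral>x. cnj (f (- x) * cnj (\<gamma> (- x))) \<partial>M) = cnj (fourier M f \<gamma>)"
      unfolding fourier_def by (simp only: Bochner_Integration.integral_cnj)
    then show ?thesis
      using f0[OF that] unfolding fourier_def f'_def by (simp add: dual_uminus[OF that])
  qed
  have comb: "fourier M (\<lambda>x. c * f x + d * f' x) \<gamma> = 0" if "\<gamma> \<in> dual" for c d \<gamma>
  proof -
    have "L2_inner M (\<lambda>x. c * f x + d * f' x) \<gamma> = 0"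
      using f0[OF that] f'0[OF that]
      unfolding L2_inner_add[OF L2_cmult[OF continuous_L2[OF f]] L2_cmult[OF continuous_L2[OF f'_cont]]
        continuous_L2[OF dual_cont[OF that]]] L2_inner_cmult
      by (simp add: fourier_def L2_inner_def)
    then show ?thesis by (simp add: fourier_def L2_inner_def)
  qed
  have "\<exists>k. continuous_on UNIV k \<and> hermitian k \<and> k \<noteq> (\<lambda>x. 0) \<and> (\<forall>\<gamma>\<in>dual. fourier M k \<gamma> = 0)"
  proof (cases "(\<lambda>x. 1 * f x + 1 * f' x) = (\<lambda>x. 0)")
    case False
    moreover have "hermitian (\<lambda>x. 1 * f x + 1 * f' x)" by (simp add: hermitian_def f'_def add.commute)
    moreover have "continuous_on UNIV (\<lambda>x. 1 * f x + 1 * f' x)" by (intro continuous_intros f f'_cont)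
    ultimately show ?thesis using comb by blast
  next
    case True
    have "(\<lambda>x. \<i> * f x + (- \<i>) * f' x) \<noteq> (\<lambda>x. 0)"
    proof
      assume "(\<lambda>x. \<i> * f x + (- \<i>) * f' x) = (\<lambda>x. 0)"
      then have "\<i> * f x + (- \<i>) * f' x = 0" for x by meson
      moreover have "f' x = - f x" for x using fun_cong[OF True, of x] by (simp add: add_eq_0_iff)
      ultimately have "f x = 0" for x by simp
      then show False using \<open>f \<noteq> (\<lambda>x. 0)\<close> by blast
    qed
    moreover have "hermitian (\<lambda>x. \<i> * f x + (- \<i>) * f' x)"
      by (simp add: hermitian_def f'_def algebra_simps)
    moreover have "continuous_on UNIV (\<lambda>x. \<i> * f x + (- \<i>) * f' x)" by (intro continuous_intros f f'_cont)
    ultimately show ?thesis using comb by blast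
  qed
  then obtain k where k: "continuous_on UNIV k" "hermitian k" "k \<noteq> (\<lambda>x. 0)"
    and k0: "\<And>\<gamma>. \<gamma> \<in> dual \<Longrightarrow> fourier M k \<gamma> = 0" by blast
  have "\<exists>e. idem e"
  proof -
    obtain e \<kappa> where e: "continuous_on UNIV e" "hermitian e" "convolve M e e = e" "e \<noteq> (\<lambda>x. 0)" "\<kappa> \<noteq> 0"
      "convolve M (convolve M k k) e = (\<lambda>x. of_real \<kappa> * e x)"
      using hermitian_kernel_top_idempotent[OF k] by metis
    have "fourier M e \<gamma> = 0" if "\<gamma> \<in> dual" for \<gamma>
    proof -
      have kk: "continuous_on UNIV (convolve M k k)"
        by (intro convolve_continuous k continuous_integrable)
      have "fourier M (convolve M (convolve M k k) e) \<gamma> = 0"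
        using k0[OF that] that k
        by (simp add: fourier_convolve[OF kk continuous_integrable[OF e(1)]]
            fourier_convolve[OF k(1) continuous_integrable[OF k(1)]])
      then show ?thesis using e(5) unfolding e(6) by (simp add: fourier_def mult.assoc)
    qed
    with e show ?thesis unfolding idem_def by blast
  qed
  then obtain e where e: "idem e" and
    min: "\<And>e'. idem e' \<Longrightarrow> nat \<lfloor>(L2_norm M e)\<^sup>2\<rfloor> \<le> nat \<lfloor>(L2_norm M e')\<^sup>2\<rfloor>"
    using ex_has_least_nat[of idem _ "\<lambda>e. nat \<lfloor>(L2_norm M e)\<^sup>2\<rfloor>"] by metis
  have e_cont: "continuous_on UNIV e" and e_herm: "hermitian e" and ee: "convolve M e e = e"
    and e_nz: "e \<noteq> (\<lambda>x. 0)" and e_fourier: "\<And>\<gamma>. \<gamma> \<in> dual \<Longrightarrow> fourier M e \<gamma> = 0"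
    using e unfolding idem_def by auto
  note e_norm = hermitian_idempotent_norm[OF e_cont e_herm ee]
  note e_int = continuous_integrable[OF e_cont]
  have unique: "e' = e" if e': "idem e'" "convolve M e' e = e'" for e'
  proof (rule ccontr)
    assume "e' \<noteq> e"
    have e'_cont: "continuous_on UNIV e'" and e'_herm: "hermitian e'" and e'e': "convolve M e' e' = e'"
      and e'_f: "\<And>\<gamma>. \<gamma> \<in> dual \<Longrightarrow> fourier M e' \<gamma> = 0"
      using e'(1) unfolding idem_def by auto
    note e'_int = continuous_integrable[OF e'_cont]
    have ee': "convolve M e e' = e'" using convolve_commute[OF e_cont e'_cont] e'(2) by simp
    define d where "d = (\<lambda>x. e x + (-1) * e' x)"
    have d_cont: "continuous_on UNIV d" unfolding d_def by (intro continuous_intros e_cont e'_cont)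
    have m_cont: "continuous_on UNIV (\<lambda>x. (-1) * e' x)" by (intro continuous_intros e'_cont)
    have "convolve M d d = d"
      unfolding d_def
      by (simp only: convolve_add_left[OF e_cont m_cont continuous_integrable[OF d_cont, unfolded d_def]]
          convolve_add_right[OF e_cont e_int continuous_integrable[OF m_cont]]
          convolve_add_right[OF m_cont e_int continuous_integrable[OF m_cont]]
          convolve_cmult_left convolve_cmult_right ee ee' e'e' e'(2)) simp
    moreover have "hermitian d" using e_herm e'_herm by (simp add: d_def hermitian_def)
    moreover have "d \<noteq> (\<lambda>x. 0)"
    proof
      assume d0: "d = (\<lambda>x. 0)"
      have "e' = e" using fun_cong[OF d0] by (intro ext) (simp add: d_def)
      with \<open>e' \<noteq> e\<close> show False by blast
    qed
    ultimately have "1 \<le> (L2_norm M d)\<^sup>2" "d 0 = of_real ((L2_norm M d)\<^sup>2)"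
      using hermitian_idempotent_norm[OF d_cont] by blast+
    moreover have "d 0 = of_real ((L2_norm M e)\<^sup>2 - (L2_norm M e')\<^sup>2)"
      unfolding d_def e_norm(1) hermitian_idempotent_norm(1)[OF e'_cont e'_herm e'e'] by simp
    ultimately have "(L2_norm M e')\<^sup>2 + 1 \<le> (L2_norm M e)\<^sup>2"
      by (metis add.commute le_diff_eq of_real_eq_iff)
    then have "\<lfloor>(L2_norm M e')\<^sup>2\<rfloor> + 1 \<le> \<lfloor>(L2_norm M e)\<^sup>2\<rfloor>"
      using floor_mono by fastforce
    moreover have "0 \<le> \<lfloor>(L2_norm M e')\<^sup>2\<rfloor>" by simp
    ultimately show False using min[OF e'(1)] by linarith
  qed
  have square: "\<exists>c::real. convolve M k k = (\<lambda>x. of_real c * e x)"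
    if k: "continuous_on UNIV k" "hermitian k" "convolve M k e = k" for k
  proof (cases "k = (\<lambda>x. 0)")
    case True
    have "convolve M k k = (\<lambda>x. of_real 0 * e x)" unfolding True by (simp add: convolve_def)
    then show ?thesis ..
  next
    case False
    obtain e' \<kappa> where e': "continuous_on UNIV e'" "hermitian e'" "convolve M e' e' = e'" "e' \<noteq> (\<lambda>x. 0)"
      and \<kappa>: "convolve M (convolve M k k) e' = (\<lambda>x. of_real \<kappa> * e' x)" and e'e: "convolve M e' e = e'"
      using hermitian_kernel_top_idempotent[OF k(1,2) False] e_cont k(3) by metis
    have "fourier M e' \<gamma> = 0" if "\<gamma> \<in> dual" for \<gamma>
      using fourier_convolve[OF e'(1) e_int that] e_fourier[OF that] by (simp add: e'e)
    with e' have "idem e'" unfolding idem_def by blast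
    then have "e' = e" using e'e by (rule unique)
    moreover have "convolve M (convolve M k k) e = convolve M k k"
      using convolve_assoc[OF k(1) k(1) e_int] k(3) by simp
    ultimately show ?thesis using \<kappa> by metis
  qed
  \<comment> \<open>the squares of \<open>k\<close> and of \<open>k + e\<close> are multiples of \<open>e\<close>, and their difference is \<open>2 k + e\<close>\<close>
  have scalar: "\<exists>c::real. k = (\<lambda>x. of_real c * e x)"
    if k: "continuous_on UNIV k" "hermitian k" "convolve M k e = k" for k
  proof -
    note k_int = continuous_integrable[OF k(1)]
    have ek: "convolve M e k = k" using convolve_commute[OF e_cont k(1)] k(3) by simp
    have c: "continuous_on UNIV (\<lambda>x. k x + e x)" by (intro continuous_intros k e_cont)
    have h: "hermitian (\<lambda>x. k x + e x)" using k(2) e_herm by (simp add: hermitian_def)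
    have "convolve M (\<lambda>x. k x + e x) e = (\<lambda>x. k x + e x)"
      unfolding convolve_add_left[OF k(1) e_cont e_int] k(3) ee ..
    from square[OF c h this] obtain b :: real
      where "convolve M (\<lambda>x. k x + e x) (\<lambda>x. k x + e x) = (\<lambda>x. of_real b * e x)" by blast
    moreover have "convolve M (\<lambda>x. k x + e x) (\<lambda>x. k x + e x) =
        (\<lambda>x. convolve M k k x + k x + (k x + e x))"
      unfolding convolve_add_left[OF k(1) e_cont continuous_integrable[OF c]]
        convolve_add_right[OF k(1) k_int e_int] convolve_add_right[OF e_cont k_int e_int] k(3) ee ek ..
    moreover obtain a :: real where "convolve M k k = (\<lambda>x. of_real a * e x)" using square[OF k] by blast
    ultimately have eq: "(\<lambda>x. of_real a * e x + k x + (k x + e x)) = (\<lambda>x. of_real b * e x)" by simp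
    have "k x = of_real ((b - a - 1) / 2) * e x" for x
      using fun_cong[OF eq, of x] by (simp add: field_simps)
    then show ?thesis by blast
  qed
  have translate: "\<exists>c. \<forall>x. e (g + x) = c * e x" for g
  proof -
    define u where "u = (\<lambda>x. e (g + x))"
    define v where "v = (\<lambda>x. e (- g + x))"
    have u: "continuous_on UNIV u" and v: "continuous_on UNIV v"
      unfolding u_def v_def by (intro continuous_on_compose_UNIV[OF e_cont] continuous_intros)+
    have ue: "convolve M u e = u" and ve: "convolve M v e = v"
      unfolding u_def v_def convolve_translate ee by simp_all
    have uv: "u (- x) = cnj (v x)" "v (- x) = cnj (u x)" for x
    proof -
      have "g + - x = - (- g + x)" "- g + - x = - (g + x)" by simp_all
      then show "u (- x) = cnj (v x)" "v (- x) = cnj (u x)"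
        using e_herm unfolding hermitian_def u_def v_def by metis+
    qed
    have comb: "convolve M (\<lambda>x. a * u x + b * v x) e = (\<lambda>x. a * u x + b * v x)" for a b
    proof -
      have "continuous_on UNIV (\<lambda>x. a * u x)" "continuous_on UNIV (\<lambda>x. b * v x)"
        by (intro continuous_intros u v)+
      then show ?thesis by (subst convolve_add_left) (auto simp: e_int convolve_cmult_left ue ve)
    qed
    have cont: "continuous_on UNIV (\<lambda>x. a * u x + b * v x)" for a b by (intro continuous_intros u v)
    have "\<exists>c::real. (\<lambda>x. 1 * u x + 1 * v x) = (\<lambda>x. of_real c * e x)"
      by (rule scalar[OF cont _ comb]) (simp add: hermitian_def uv add.commute)
    then obtain a :: real where a: "\<And>x. u x + v x = of_real a * e x" by (auto simp: fun_eq_iff)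
    have "\<exists>c::real. (\<lambda>x. \<i> * u x + (- \<i>) * v x) = (\<lambda>x. of_real c * e x)"
      by (rule scalar[OF cont _ comb]) (simp add: hermitian_def uv algebra_simps)
    then obtain b :: real where b: "\<And>x. \<i> * u x + (- \<i>) * v x = of_real b * e x"
      by (metis (no_types, lifting))
    have "u x = ((of_real a - \<i> * of_real b) / 2) * e x" for x
    proof -
      have "2 * u x = (u x + v x) - \<i> * (\<i> * u x + (- \<i>) * v x)"
        by (simp add: algebra_simps)
      also have "\<dots> = (of_real a - \<i> * of_real b) * e x" unfolding a b by (simp add: algebra_simps)
      finally show ?thesis by (simp add: mult.commute)
    qed
    then show ?thesis unfolding u_def by blast
  qed
  have "1 \<le> (L2_norm M e)\<^sup>2" using e_norm(3) e_nz by blast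
  then have e0: "e 0 \<noteq> 0" unfolding e_norm(1) by auto
  define \<eta> where "\<eta> g = e g / e 0" for g
  have e_tr: "e (g + x) = \<eta> g * e x" for g x
  proof -
    obtain c where c: "\<And>x. e (g + x) = c * e x" using translate by blast
    then show ?thesis using c[of 0] e0 by (simp add: \<eta>_def)
  qed
  have \<eta>_add: "\<eta> (g + h) = \<eta> g * \<eta> h" for g h
    using e_tr[of g h] by (simp add: \<eta>_def)
  have \<eta>_le: "cmod (\<eta> g) \<le> 1" for g
    using e_norm(2)[of g] e0 by (simp add: \<eta>_def norm_divide e_norm(1) norm_power divide_le_eq)
  have "cmod (\<eta> g) = 1" for g
  proof (rule antisym[OF \<eta>_le])
    have "\<eta> g * \<eta> (- g) = 1" using \<eta>_add[of g "- g"] e0 by (simp add: \<eta>_def)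
    then have "cmod (\<eta> g) * cmod (\<eta> (- g)) = 1" by (metis norm_mult norm_one)
    moreover have "cmod (\<eta> g) * cmod (\<eta> (- g)) \<le> cmod (\<eta> g) * 1"
      by (intro mult_left_mono \<eta>_le) simp
    ultimately show "1 \<le> cmod (\<eta> g)" by simp
  qed
  moreover have "continuous_on UNIV \<eta>" unfolding \<eta>_def by (intro continuous_intros e_cont) (use e0 in auto)
  ultimately have \<eta>: "\<eta> \<in> dual" using \<eta>_add by (simp add: dual_def)
  have "e = (\<lambda>x. e 0 * \<eta> x)" using e0 by (auto simp: \<eta>_def)
  then have "fourier M e \<eta> = (\<integral>x. e 0 * \<eta> x * cnj (\<eta> x) \<partial>M)" unfolding fourier_def by metis
  also have "\<dots> = e 0"
    using dual_cnj_mult[OF \<eta>] prob_space by (simp add: mult.assoc mult.commute[of "\<eta> _"])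
  finally show False using e_fourier[OF \<eta>] e0 by simp
qed

text \<open>
  By regularity and Urysohn's lemma the indicator of a Borel set is the limit in the mean of continuous
  functions with values between \<open>0\<close> and \<open>1\<close>. Along a subsequence the limit holds almost everywhere, and dominated
  convergence shows that \<open>f\<close> has integral \<open>0\<close> over the set.
\<close>

lemma integral_continuous_zero_imp_AE:
  fixes f :: "'g \<Rightarrow> complex"
  assumes f: "integrable M f"
    and zero: "\<And>k. continuous_on UNIV k \<Longrightarrow> (\<integral>x. k x * f x \<partial>M) = 0"
  shows "AE x in M. f x = 0"
proof (rule density_zero[OF f])
  fix A assume "A \<in> sets M"
  then have A: "A \<in> sets borel" by simp
  have approx: "\<exists>k::'g \<Rightarrow> real. continuous_on UNIV k \<and> (\<forall>x. 0 \<le> k x \<and> k x \<le> 1) \<and>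
      (\<integral>x. \<bar>k x - indicator A x\<bar> \<partial>M) \<le> 2 * d" if d: "d > 0" for d
  proof -
    have "emeasure M A < emeasure M A + ennreal d"
      using d by (simp add: emeasure_eq_measure ennreal_plus[symmetric] ennreal_less_iff del: ennreal_plus)
    also have "emeasure M A = (INF V\<in>{V. open V \<and> A \<subseteq> V}. emeasure M V)"
      using haar A unfolding normalized_haar_def by blast
    finally obtain V where V: "open V" "A \<subseteq> V" "emeasure M V < emeasure M A + ennreal d"
      unfolding INF_less_iff
      using \<open>emeasure M A = (INF V\<in>{V. open V \<and> A \<subseteq> V}. emeasure M V)\<close> by auto
    have VA: "measure M V < measure M A + d"
      using V(3) d by (simp add: emeasure_eq_measure ennreal_plus[symmetric] ennreal_less_iff del: ennreal_plus)
    have "\<exists>K. compact K \<and> K \<subseteq> V \<and> measure M V < measure M K + d"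
    proof (cases "measure M V < d")
      case True
      then show ?thesis by (intro exI[of _ "{}"]) simp
    next
      case False
      then have "ennreal (measure M V - d) < emeasure M V"
        using d by (simp add: emeasure_eq_measure ennreal_less_iff)
      also have "emeasure M V = (SUP K\<in>{K. compact K \<and> K \<subseteq> V}. emeasure M K)"
        using haar V(1) unfolding normalized_haar_def by blast
      finally obtain K where "compact K" "K \<subseteq> V" "ennreal (measure M V - d) < emeasure M K"
        unfolding less_SUP_iff by auto
      then show ?thesis
        using False by (intro exI[of _ K]) (simp add: emeasure_eq_measure ennreal_less_iff)
    qed
    then obtain K where K: "compact K" "K \<subseteq> V" "measure M V < measure M K + d" by blast
    obtain k :: "'g \<Rightarrow> real" where k: "continuous_on UNIV k" "\<And>x. 0 \<le> k x" "\<And>x. k x \<le> 1"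
      "\<And>x. x \<in> K \<Longrightarrow> k x = 1" "\<And>x. x \<in> - V \<Longrightarrow> k x = 0"
      using Urysohn_function[of K "- V"] K V(1) by (auto intro: compact_imp_closed)
    have [measurable]: "k \<in> borel_measurable M" by (intro continuous_measurable k)
    have VKA [measurable]: "V \<in> sets M" "K \<in> sets M" "A \<in> sets M"
      using V(1) K(1) A by (auto intro: borel_closed compact_imp_closed)
    have ind_int: "integrable M (\<lambda>x. indicator B x :: real)" if "B \<in> sets M" for B
      by (rule integrable_const_bound[where B = 1]) (use that in \<open>auto simp: indicator_def\<close>)
    have abs_le: "\<bar>k x - indicator A x\<bar> \<le> 1" for x
      using k(2)[of x] k(3)[of x] by (cases "x \<in> A") auto
    have "(\<integral>x. \<bar>k x - indicator A x\<bar> \<partial>M) \<le> (\<integral>x. indicator (V - K) x + indicator (V - A) x \<partial>M)"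
    proof (rule integral_mono)
      show "integrable M (\<lambda>x. \<bar>k x - indicator A x\<bar>)"
        by (rule integrable_const_bound[where B = 1]) (use abs_le in auto)
      show "\<bar>k x - indicator A x\<bar> \<le> indicator (V - K) x + indicator (V - A) x" for x
        using k(2)[of x] k(3)[of x] k(4)[of x] k(5)[of x] V(2) K(2) by (auto simp: indicator_def)
      show "integrable M (\<lambda>x. indicator (V - K) x + indicator (V - A) x :: real)"
        by (intro Bochner_Integration.integrable_add ind_int sets.Diff VKA)
    qed
    also have "\<dots> = measure M (V - K) + measure M (V - A)"
      by (subst Bochner_Integration.integral_add) (auto intro!: ind_int sets.Diff VKA simp del: sets_M)
    also have "\<dots> \<le> 2 * d"
      using VA K(3) finite_measure_Diff[OF VKA(1,2) K(2)] finite_measure_Diff[OF VKA(1,3) V(2)]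
      by argo
    finally show ?thesis using k by blast
  qed
  have "\<exists>k::'g \<Rightarrow> real. continuous_on UNIV k \<and> (\<forall>x. 0 \<le> k x \<and> k x \<le> 1) \<and>
      (\<integral>x. \<bar>k x - indicator A x\<bar> \<partial>M) \<le> 2 * (1 / real (Suc n))" for n
    by (rule approx) simp
  then obtain k :: "nat \<Rightarrow> 'g \<Rightarrow> real" where k: "\<And>n. continuous_on UNIV (k n)" "\<And>n x. 0 \<le> k n x" "\<And>n x. k n x \<le> 1"
    and k_lim: "\<And>n. (\<integral>x. \<bar>k n x - indicator A x\<bar> \<partial>M) \<le> 2 * (1 / real (Suc n))"
    by metis
  have [measurable]: "k n \<in> borel_measurable M" for n by (intro continuous_measurable k)
  have [measurable]: "A \<in> sets M" using A by simp
  have "(\<lambda>n. 2 * (1 / real (Suc n))) \<longlonglongrightarrow> 0"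
    using tendsto_mult_right_zero[OF LIMSEQ_inverse_real_of_nat, of 2] by (simp add: inverse_eq_divide)
  then have L1: "(\<lambda>n. \<integral>x. norm (k n x - indicator A x) \<partial>M) \<longlonglongrightarrow> 0"
    by (rule tendsto_sandwich[OF _ _ tendsto_const, rotated 2]) (use k_lim in auto)
  have int: "integrable M (\<lambda>x. k n x - indicator A x)" for n
  proof (rule integrable_const_bound[where B = 1])
    have "norm (k n x - indicator A x) \<le> 1" for x
      using k(2)[of n x] k(3)[of n x] by (cases "x \<in> A") auto
    then show "AE x in M. norm (k n x - indicator A x) \<le> 1" by simp
  qed measurable
  obtain r :: "nat \<Rightarrow> nat" where r: "AE x in M. (\<lambda>n. k (r n) x - indicator A x) \<longlonglongrightarrow> 0"
    using tendsto_L1_AE_subseq[OF int L1] by blast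
  have "(\<lambda>n. \<integral>x. of_real (k (r n) x) * f x \<partial>M) \<longlonglongrightarrow> (\<integral>x. of_real (indicator A x) * f x \<partial>M)"
  proof (rule integral_dominated_convergence[where w = "\<lambda>x. norm (f x)"])
    show "AE x in M. (\<lambda>n. complex_of_real (k (r n) x) * f x) \<longlonglongrightarrow> of_real (indicator A x) * f x"
      using r
    proof eventually_elim
      case (elim x)
      then have "(\<lambda>n. k (r n) x) \<longlonglongrightarrow> indicator A x" by (rule LIM_zero_cancel)
      then show ?case by (intro tendsto_intros)
    qed
    show "AE x in M. norm (complex_of_real (k (r n) x) * f x) \<le> norm (f x)" for n
      using k(2,3) by (auto simp: norm_mult intro!: mult_left_le_one_le)
  qed (use f in auto)
  moreover have "(\<integral>x. of_real (k (r n) x) * f x \<partial>M) = 0" for n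
    by (rule zero) (intro continuous_intros k)
  ultimately have "(\<integral>x. of_real (indicator A x) * f x \<partial>M) = 0" by (simp add: LIMSEQ_const_iff)
  then show "set_lebesgue_integral M A f = 0"
    unfolding set_lebesgue_integral_def scaleR_conv_of_real .
qed

text \<open>
  A convolution of \<open>f\<close> with a continuous kernel is a continuous function without Fourier coefficients,
  hence zero. Its value at \<open>0\<close> is the integral of \<open>f\<close> against the reflected kernel.
\<close>

theorem fourier_unique_AE:
  assumes f: "integrable M f" and f0: "\<And>\<gamma>. \<gamma> \<in> dual \<Longrightarrow> fourier M f \<gamma> = 0"
  shows "AE x in M. f x = 0"
proof (rule integral_continuous_zero_imp_AE[OF f])
  fix k :: "'g \<Rightarrow> complex" assume k: "continuous_on UNIV k"
  have k': "continuous_on UNIV (\<lambda>x. k (- x))"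
    by (intro continuous_on_compose_UNIV[OF k] continuous_intros)
  have "convolve M (\<lambda>x. k (- x)) f = (\<lambda>x. 0)"
    by (rule continuous_fourier_unique[OF convolve_continuous[OF k' f]])
       (simp add: fourier_convolve[OF k' f] f0)
  from fun_cong[OF this, of 0] show "(\<integral>x. k x * f x \<partial>M) = 0" by (simp add: convolve_def)
qed

end

section \<open>Functions with prescribed spectrum\<close>

lemma char_span_char: "\<gamma> \<in> S \<Longrightarrow> \<gamma> \<in> char_span S"
  unfolding char_span_def by (intro CollectI exI[of _ "{\<gamma>}"] exI[of _ "\<lambda>_. 1"]) auto

lemma char_span_zero: "(\<lambda>x. 0) \<in> char_span S"
  unfolding char_span_def by (intro CollectI exI[of _ "{}"]) auto

lemma char_span_cmult:
  assumes "p \<in> char_span S"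
  shows "(\<lambda>x. c * p x) \<in> char_span S"
proof -
  obtain F a where F: "p = (\<lambda>x. \<Sum>\<gamma>\<in>F. a \<gamma> * \<gamma> x)" "finite F" "F \<subseteq> S"
    using assms unfolding char_span_def by blast
  then have "(\<lambda>x. c * p x) = (\<lambda>x. \<Sum>\<gamma>\<in>F. (c * a \<gamma>) * \<gamma> x)"
    by (simp add: sum_distrib_left mult.assoc)
  then show ?thesis unfolding char_span_def using F(2,3)
    by (intro CollectI exI[of _ F] exI[of _ "\<lambda>\<gamma>. c * a \<gamma>"]) auto
qed

lemma char_span_add:
  assumes "p \<in> char_span S" "q \<in> char_span S"
  shows "(\<lambda>x. p x + q x) \<in> char_span S"
proof -
  obtain F a where F: "p = (\<lambda>x. \<Sum>\<gamma>\<in>F. a \<gamma> * \<gamma> x)" "finite F" "F \<subseteq> S"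
    using assms(1) unfolding char_span_def by blast
  obtain G b where G: "q = (\<lambda>x. \<Sum>\<gamma>\<in>G. b \<gamma> * \<gamma> x)" "finite G" "G \<subseteq> S"
    using assms(2) unfolding char_span_def by blast
  define c where "c \<gamma> = (if \<gamma> \<in> F then a \<gamma> else 0) + (if \<gamma> \<in> G then b \<gamma> else 0)" for \<gamma>
  have "(\<Sum>\<gamma>\<in>F. a \<gamma> * \<gamma> x) = (\<Sum>\<gamma>\<in>F \<union> G. (if \<gamma> \<in> F then a \<gamma> else 0) * \<gamma> x)" for x
    using F(2) G(2) by (intro sum.mono_neutral_cong_left) auto
  moreover have "(\<Sum>\<gamma>\<in>G. b \<gamma> * \<gamma> x) = (\<Sum>\<gamma>\<in>F \<union> G. (if \<gamma> \<in> G then b \<gamma> else 0) * \<gamma> x)" for x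
    using F(2) G(2) by (intro sum.mono_neutral_cong_left) auto
  ultimately have "(\<lambda>x. p x + q x) = (\<lambda>x. \<Sum>\<gamma>\<in>F \<union> G. c \<gamma> * \<gamma> x)"
    unfolding F(1) G(1) c_def by (simp add: sum.distrib distrib_right)
  then show ?thesis unfolding char_span_def using F G
    by (intro CollectI exI[of _ "F \<union> G"] exI[of _ c]) auto
qed

lemma char_span_induct [consumes 1, case_names zero step]:
  assumes "p \<in> char_span S" "P (\<lambda>x. 0)"
    and "\<And>c \<gamma> p. \<gamma> \<in> S \<Longrightarrow> p \<in> char_span S \<Longrightarrow> P p \<Longrightarrow> P (\<lambda>x. c * \<gamma> x + p x)"
  shows "P p"
proof -
  obtain F a where F: "p = (\<lambda>x. \<Sum>\<gamma>\<in>F. a \<gamma> * \<gamma> x)" "finite F" "F \<subseteq> S"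
    using assms(1) unfolding char_span_def by blast
  have "(\<lambda>x. \<Sum>\<gamma>\<in>F. a \<gamma> * \<gamma> x) \<in> char_span S \<and> P (\<lambda>x. \<Sum>\<gamma>\<in>F. a \<gamma> * \<gamma> x)"
    using F(2,3)
  proof (induction F)
    case (insert \<gamma> F)
    then have "(\<lambda>x. a \<gamma> * \<gamma> x + (\<Sum>\<gamma>\<in>F. a \<gamma> * \<gamma> x)) \<in> char_span S"
      by (intro char_span_add char_span_cmult) (auto intro: char_span_char)
    moreover have "P (\<lambda>x. a \<gamma> * \<gamma> x + (\<Sum>\<gamma>\<in>F. a \<gamma> * \<gamma> x))" using insert by (intro assms(3)) auto
    ultimately show ?case using insert by simp
  qed (simp add: char_span_zero assms(2))
  then show ?thesis using F by simp
qed

lemma fourier_eq_inner: "fourier M f \<gamma> = L2_inner M f \<gamma>"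
  by (simp add: fourier_def L2_inner_def)

lemma fcnj_fcnj [simp]: "fcnj (fcnj f) = f"
  by (simp add: fcnj_def)

lemma fourier_fcnj: "fourier M (fcnj f) \<gamma> = cnj (fourier M f (fcnj \<gamma>))"
proof -
  have "fourier M (fcnj f) \<gamma> = (\<integral>x. cnj (f x * cnj (fcnj \<gamma> x)) \<partial>M)"
    by (simp add: fourier_def fcnj_def)
  also have "\<dots> = cnj (fourier M f (fcnj \<gamma>))"
    unfolding fourier_def by (rule Bochner_Integration.integral_cnj)
  finally show ?thesis .
qed

lemma fourier_fmult: "fourier M (f \<cdot>\<^sub>f \<gamma>) \<eta> = fourier M f (\<eta> \<cdot>\<^sub>f fcnj \<gamma>)"
  by (simp add: fourier_def fmult_def fcnj_def mult_ac)

text \<open>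
  For \<open>S\<close> equal to \<open>X\<^sub>+\<close> and \<open>X\<^sub>-\<close> these are \<open>H\<^sup>2\<close> and \<open>H\<^sup>2\<^sub>-\<close>, and for \<open>X\<^sub>+\<close> without the unit
  character it is the subspace of \<open>H\<^sup>2\<close> of functions with mean zero.
\<close>

definition spectral_space :: "'g::topological_ab_group_add measure \<Rightarrow> ('g \<Rightarrow> complex) set \<Rightarrow> ('g \<Rightarrow> complex) set" where
  "spectral_space M S = {f\<in>L2 M. \<forall>\<gamma>\<in>dual - S. fourier M f \<gamma> = 0}"

lemma spectral_space_L2: "f \<in> spectral_space M S \<Longrightarrow> f \<in> L2 M"
  by (simp add: spectral_space_def)

context compact_haar
begin

lemma dual_L2: "\<gamma> \<in> dual \<Longrightarrow> \<gamma> \<in> L2 M"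
  by (rule continuous_L2[OF dual_cont])

lemma spectral_space_subspace: "L2_subspace M (spectral_space M S)"
  unfolding L2_subspace_def L2_closed_def
proof (intro conjI allI impI ballI)
  show "spectral_space M S \<subseteq> L2 M" by (auto simp: spectral_space_def)
  have "(\<lambda>x. 0) \<in> spectral_space M S" by (simp add: spectral_space_def fourier_def)
  then show "spectral_space M S \<noteq> {}" by blast
  fix F f assume F: "\<forall>n. F n \<in> spectral_space M S" and f: "f \<in> L2 M"
    and lim: "(\<lambda>n. L2_norm M (\<lambda>x. F n x - f x)) \<longlonglongrightarrow> 0"
  have "fourier M f \<gamma> = 0" if \<gamma>: "\<gamma> \<in> dual - S" for \<gamma>
  proof -
    have "(\<lambda>n. fourier M (F n) \<gamma>) \<longlonglongrightarrow> fourier M f \<gamma>"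
      unfolding fourier_eq_inner
      by (rule L2_inner_tendsto[OF _ f lim]) (use F \<gamma> in \<open>auto simp: spectral_space_def intro: dual_L2\<close>)
    moreover have "fourier M (F n) \<gamma> = 0" for n using F \<gamma> by (simp add: spectral_space_def)
    ultimately show ?thesis by (simp add: LIMSEQ_const_iff)
  qed
  then show "f \<in> spectral_space M S" using f by (simp add: spectral_space_def)
next
  fix f h assume "f \<in> spectral_space M S" "h \<in> spectral_space M S"
  then show "(\<lambda>x. f x + h x) \<in> spectral_space M S"
    by (auto simp: spectral_space_def fourier_eq_inner L2_inner_add dual_L2 intro!: L2_add)
next
  fix f c assume "f \<in> spectral_space M S"
  then show "(\<lambda>x. c * f x) \<in> spectral_space M S"
    by (auto simp: spectral_space_def fourier_eq_inner L2_inner_cmult intro!: L2_cmult)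
qed

lemma spectral_space_add:
  "f \<in> spectral_space M S \<Longrightarrow> h \<in> spectral_space M S \<Longrightarrow> (\<lambda>x. f x + h x) \<in> spectral_space M S"
  using spectral_space_subspace[of S] unfolding L2_subspace_def by blast

lemma spectral_space_cmult:
  "f \<in> spectral_space M S \<Longrightarrow> (\<lambda>x. c * f x) \<in> spectral_space M S"
  using spectral_space_subspace[of S] unfolding L2_subspace_def by blast

lemma integral_dual:
  assumes "\<gamma> \<in> dual"
  shows "(\<integral>x. \<gamma> x \<partial>M) = (if \<gamma> = unit_char then 1 else 0)"
proof (cases "\<gamma> = unit_char")
  case True
  then show ?thesis using prob_space by (simp add: unit_char_def)
next
  case False
  then obtain g where g: "\<gamma> g \<noteq> 1" by (auto simp: unit_char_def fun_eq_iff)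
  have "(\<integral>x. \<gamma> (g + x) \<partial>M) = \<gamma> g * (\<integral>x. \<gamma> x \<partial>M)"
    by (simp add: dual_add[OF assms])
  then have "(\<integral>x. \<gamma> x \<partial>M) = \<gamma> g * (\<integral>x. \<gamma> x \<partial>M)"
    using integral_translate[OF continuous_measurable[OF dual_cont[OF assms]]] by metis
  then show ?thesis using g False by simp
qed

lemma fourier_dual:
  assumes "\<gamma> \<in> dual" "\<psi> \<in> dual"
  shows "fourier M \<gamma> \<psi> = (if \<gamma> = \<psi> then 1 else 0)"
proof -
  have "\<gamma> \<cdot>\<^sub>f fcnj \<psi> = unit_char \<longleftrightarrow> \<gamma> = \<psi>"
  proof
    assume *: "\<gamma> \<cdot>\<^sub>f fcnj \<psi> = unit_char"
    have "\<gamma> x = \<psi> x" for x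
    proof -
      have "\<gamma> x * cnj (\<psi> x) = 1" using fun_cong[OF *, of x] by (simp add: fmult_def fcnj_def unit_char_def)
      then have "\<gamma> x * (cnj (\<psi> x) * \<psi> x) = \<psi> x" by (simp flip: mult.assoc)
      then show ?thesis by (simp add: dual_cnj_mult[OF assms(2)])
    qed
    then show "\<gamma> = \<psi>" by blast
  qed (use dual_cnj_mult[OF assms(2)] in \<open>auto simp: fmult_def fcnj_def unit_char_def mult.commute\<close>)
  then show ?thesis
    using integral_dual[OF dual_fmult[OF assms(1) dual_fcnj[OF assms(2)]]]
    by (simp add: fourier_def fmult_def fcnj_def)
qed

lemma spectral_space_char: "\<gamma> \<in> dual \<Longrightarrow> \<gamma> \<in> S \<Longrightarrow> \<gamma> \<in> spectral_space M S"
  by (auto simp: spectral_space_def dual_L2 fourier_dual)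

lemma char_span_continuous:
  assumes "p \<in> char_span S" "S \<subseteq> dual"
  shows "continuous_on UNIV p"
  using assms(1)
proof (induction rule: char_span_induct)
  case (step c \<gamma> p)
  then have "continuous_on UNIV \<gamma>" using assms(2) by (auto intro: dual_cont)
  with step show ?case by (intro continuous_intros)
qed simp

lemma char_span_spectral:
  assumes "p \<in> char_span S" "S \<subseteq> dual"
  shows "p \<in> spectral_space M S"
  using assms(1)
proof (induction rule: char_span_induct)
  case zero
  then show ?case by (simp add: spectral_space_def fourier_def)
next
  case (step c \<gamma> p)
  then show ?case
    using assms(2) by (intro spectral_space_add spectral_space_cmult) (auto intro: spectral_space_char)
qed

text \<open>
  Project \<open>f\<close> onto the closure of the polynomials. The remainder is orthogonal to the characters in
  \<open>S\<close>, and its other Fourier coefficients vanish as well, so it is zero.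
\<close>

lemma spectral_space_dense:
  assumes S: "S \<subseteq> dual" and f: "f \<in> spectral_space M S"
  obtains F where "\<And>n. F n \<in> char_span S" "(\<lambda>n. L2_norm M (\<lambda>x. F n x - f x)) \<longlonglongrightarrow> 0"
proof -
  have spanL: "p \<in> L2 M" if "p \<in> char_span S" for p
    using char_span_spectral[OF that S] by (rule spectral_space_L2)
  have fL: "f \<in> L2 M" using f by (rule spectral_space_L2)
  define Z where "Z = {h\<in>L2 M. \<forall>e>0. \<exists>p\<in>char_span S. L2_norm M (\<lambda>x. p x - h x) < e}"
  have span_Z: "p \<in> Z" if "p \<in> char_span S" for p
    unfolding Z_def using that spanL by (auto intro!: bexI[of _ p])
  have "L2_subspace M Z"
    unfolding L2_subspace_def L2_closed_def
  proof (intro conjI allI impI ballI)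
    show "Z \<subseteq> L2 M" by (auto simp: Z_def)
    show "Z \<noteq> {}" using span_Z[OF char_span_zero] by blast
    fix F h assume F: "\<forall>n. F n \<in> Z" and h: "h \<in> L2 M"
      and lim: "(\<lambda>n. L2_norm M (\<lambda>x. F n x - h x)) \<longlonglongrightarrow> 0"
    have "\<exists>p\<in>char_span S. L2_norm M (\<lambda>x. p x - h x) < e" if e: "e > 0" for e
    proof -
      have "\<forall>\<^sub>F n in sequentially. L2_norm M (\<lambda>x. F n x - h x) < e / 2"
        using order_tendstoD(2)[OF lim, of "e / 2"] e by simp
      then obtain n where n: "L2_norm M (\<lambda>x. F n x - h x) < e / 2" by (auto simp: eventually_sequentially)
      have Fn: "F n \<in> L2 M" and apx: "\<forall>e>0. \<exists>p\<in>char_span S. L2_norm M (\<lambda>x. p x - F n x) < e"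
        using F by (auto simp: Z_def)
      obtain p where p: "p \<in> char_span S" "L2_norm M (\<lambda>x. p x - F n x) < e / 2"
        using apx[rule_format, of "e / 2"] e by auto
      show ?thesis
        using L2_norm_triangle_diff[OF spanL[OF p(1)] Fn h] p n by (intro bexI[OF _ p(1)]) linarith
    qed
    then show "h \<in> Z" using h by (simp add: Z_def)
  next
    fix g h assume g: "g \<in> Z" and h: "h \<in> Z"
    have "\<exists>p\<in>char_span S. L2_norm M (\<lambda>x. p x - (g x + h x)) < e" if e: "e > 0" for e
    proof -
      obtain p where p: "p \<in> char_span S" "L2_norm M (\<lambda>x. p x - g x) < e / 2"
        using g e half_gt_zero unfolding Z_def by blast
      obtain q where q: "q \<in> char_span S" "L2_norm M (\<lambda>x. q x - h x) < e / 2"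
        using h e half_gt_zero unfolding Z_def by blast
      have "L2_norm M (\<lambda>x. (p x - g x) + (q x - h x)) \<le> L2_norm M (\<lambda>x. p x - g x) + L2_norm M (\<lambda>x. q x - h x)"
        using g h p q spanL by (intro L2_norm_triangle L2_diff) (auto simp: Z_def)
      then have "L2_norm M (\<lambda>x. (p x + q x) - (g x + h x)) < e" using p q by (simp add: algebra_simps)
      then show ?thesis by (rule bexI[OF _ char_span_add[OF p(1) q(1)]])
    qed
    then show "(\<lambda>x. g x + h x) \<in> Z" using g h by (auto simp: Z_def intro: L2_add)
  next
    fix g c assume g: "g \<in> Z"
    have "\<exists>p\<in>char_span S. L2_norm M (\<lambda>x. p x - c * g x) < e" if e: "e > 0" for e
    proof -
      have "e / (cmod c + 1) > 0" using e by (simp add: add_nonneg_pos)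
      then obtain p where p: "p \<in> char_span S" "L2_norm M (\<lambda>x. p x - g x) < e / (cmod c + 1)"
        using g unfolding Z_def by blast
      have "L2_norm M (\<lambda>x. c * p x - c * g x) = cmod c * L2_norm M (\<lambda>x. p x - g x)"
        using L2_norm_cmult[of M c "\<lambda>x. p x - g x"] by (simp add: right_diff_distrib)
      also have "\<dots> \<le> cmod c * (e / (cmod c + 1))" using p(2) by (intro mult_left_mono) auto
      also have "\<dots> < e" using e by (simp add: field_simps add_pos_nonneg)
      finally show ?thesis by (rule bexI[OF _ char_span_cmult[OF p(1)]])
    qed
    then show "(\<lambda>x. c * g x) \<in> Z" using g by (auto simp: Z_def intro: L2_cmult)
  qed
  then obtain p where p: "p \<in> Z" and orth: "\<And>h. h \<in> Z \<Longrightarrow> L2_inner M (\<lambda>x. f x - p x) h = 0"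
    using L2_projection[OF prob_M _ fL] by blast
  have pL: "p \<in> L2 M" using p by (simp add: Z_def)
  have approx: "\<exists>F. (\<forall>n. F n \<in> char_span S) \<and> (\<lambda>n. L2_norm M (\<lambda>x. F n x - p x)) \<longlonglongrightarrow> 0"
  proof -
    have apx: "\<forall>e>0. \<exists>q\<in>char_span S. L2_norm M (\<lambda>x. q x - p x) < e"
      using p by (simp add: Z_def)
    have "\<exists>q\<in>char_span S. L2_norm M (\<lambda>x. q x - p x) < inverse (real (Suc n))" for n
      by (rule apx[rule_format]) simp
    then obtain F where F: "\<And>n. F n \<in> char_span S" "\<And>n. L2_norm M (\<lambda>x. F n x - p x) < inverse (real (Suc n))"
      by metis
    have "(\<lambda>n. L2_norm M (\<lambda>x. F n x - p x)) \<longlonglongrightarrow> 0"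
      by (rule tendsto_sandwich[OF _ _ tendsto_const LIMSEQ_inverse_real_of_nat])
         (use F(2) in \<open>auto intro!: always_eventually less_imp_le\<close>)
    then show ?thesis using F(1) by blast
  qed
  then obtain F where F: "\<And>n. F n \<in> char_span S" "(\<lambda>n. L2_norm M (\<lambda>x. F n x - p x)) \<longlonglongrightarrow> 0" by blast
  have "p \<in> spectral_space M S"
    using spectral_space_subspace[of S] char_span_spectral[OF F(1) S] F(2) pL
    unfolding L2_subspace_def by (blast intro: L2_closedD)
  have "fourier M (\<lambda>x. f x - p x) \<gamma> = 0" if "\<gamma> \<in> dual" for \<gamma>
  proof (cases "\<gamma> \<in> S")
    case True
    then show ?thesis unfolding fourier_eq_inner by (intro orth span_Z char_span_char)
  next
    case False
    then have "fourier M f \<gamma> = 0" "fourier M p \<gamma> = 0"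
      using that f \<open>p \<in> spectral_space M S\<close> by (auto simp: spectral_space_def)
    then show ?thesis by (simp add: fourier_eq_inner L2_inner_diff fL pL dual_L2 that)
  qed
  then have "AE x in M. f x - p x = 0"
    by (intro fourier_unique_AE L2_integrable L2_diff fL pL)
  then have "L2_norm M (\<lambda>x. F n x - p x) = L2_norm M (\<lambda>x. F n x - f x)" for n
    by (intro L2_norm_cong_AE L2_measurable L2_diff F(1)[THEN spanL] fL pL) (auto elim!: eventually_mono)
  then show thesis using that[of F] F by simp
qed

lemma spectral_space_orthogonal:
  assumes "S \<subseteq> dual" "T \<subseteq> dual" "S \<inter> T = {}" "f \<in> spectral_space M S" "h \<in> spectral_space M T"
  shows "L2_inner M h f = 0"
proof -
  obtain F where F: "\<And>n. F n \<in> char_span T" "(\<lambda>n. L2_norm M (\<lambda>x. F n x - h x)) \<longlonglongrightarrow> 0"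
    using spectral_space_dense[OF assms(2,5)] by blast
  have fL: "f \<in> L2 M" and hL: "h \<in> L2 M" using assms by (auto intro: spectral_space_L2)
  have span_L2: "p \<in> L2 M" if "p \<in> char_span T" for p
    using char_span_spectral[OF that assms(2)] by (rule spectral_space_L2)
  have "L2_inner M p f = 0" if "p \<in> char_span T" for p
    using that
  proof (induction rule: char_span_induct)
    case (step c \<gamma> p)
    have g: "\<gamma> \<in> dual - S" using step(1) assms by blast
    then have "L2_inner M \<gamma> f = cnj (fourier M f \<gamma>)" by (simp add: fourier_eq_inner L2_inner_cnj)
    then have "L2_inner M \<gamma> f = 0" using g assms(4) by (simp add: spectral_space_def)
    then show ?case
      using step g by (simp add: L2_inner_add L2_inner_cmult L2_cmult dual_L2 fL span_L2)
  qed (simp add: L2_inner_def)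
  then have "L2_inner M (F n) f = 0" for n using F(1) by blast
  then show ?thesis
    using L2_inner_tendsto[OF span_L2[OF F(1)] hL F(2) fL] by (simp add: LIMSEQ_const_iff)
qed

end

section \<open>The ordered dual and analytic factorization\<close>

locale ordered_haar = compact_haar M
  for M :: "'g::{topological_ab_group_add, t2_space} measure" +
  fixes r :: "('g \<Rightarrow> complex) rel"
  assumes order: "dual_order r"
begin

abbreviation "Xp \<equiv> X_plus r"
abbreviation "Xp0 \<equiv> X_plus r - {unit_char}"
abbreviation "Xm \<equiv> X_minus r"

lemma r_trans: "(a, b) \<in> r \<Longrightarrow> (b, c) \<in> r \<Longrightarrow> (a, c) \<in> r"
  using order unfolding dual_order_def linear_order_on_def partial_order_on_def preorder_on_def
  by (meson transD)

lemma r_mult: "(a, b) \<in> r \<Longrightarrow> a \<in> dual \<Longrightarrow> b \<in> dual \<Longrightarrow> c \<in> dual \<Longrightarrow> (a \<cdot>\<^sub>f c, b \<cdot>\<^sub>f c) \<in> r"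
  using order unfolding dual_order_def by blast

lemma r_total: "a \<in> dual \<Longrightarrow> b \<in> dual \<Longrightarrow> (a, b) \<in> r \<or> (b, a) \<in> r"
  using order unfolding dual_order_def linear_order_on_def partial_order_on_def preorder_on_def
    total_on_def refl_on_def by metis

lemma r_antisym: "(a, b) \<in> r \<Longrightarrow> (b, a) \<in> r \<Longrightarrow> a = b"
  using order unfolding dual_order_def linear_order_on_def partial_order_on_def
  by (meson antisymD)

lemma Xp_dual: "\<gamma> \<in> Xp \<Longrightarrow> \<gamma> \<in> dual" and Xm_dual: "\<gamma> \<in> Xm \<Longrightarrow> \<gamma> \<in> dual"
  by (auto simp: X_plus_def X_minus_def)

lemma Xp_sub: "Xp \<subseteq> dual" and Xp0_sub: "Xp0 \<subseteq> dual" and Xm_sub: "Xm \<subseteq> dual"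
  by (auto simp: X_plus_def X_minus_def)

lemma unit_fmult [simp]: "unit_char \<cdot>\<^sub>f \<gamma> = \<gamma>"
  by (simp add: fmult_def unit_char_def)

lemma fmult_commute: "\<gamma> \<cdot>\<^sub>f \<psi> = \<psi> \<cdot>\<^sub>f \<gamma>"
  by (simp add: fmult_def mult.commute)

lemma fmult_fcnj: "\<gamma> \<in> dual \<Longrightarrow> \<gamma> \<cdot>\<^sub>f fcnj \<gamma> = unit_char"
  using dual_cnj_mult[of \<gamma>] by (simp add: fmult_def fcnj_def unit_char_def mult.commute)

lemma fcnj_fmult: "fcnj (\<gamma> \<cdot>\<^sub>f \<psi>) = fcnj \<gamma> \<cdot>\<^sub>f fcnj \<psi>"
  by (simp add: fmult_def fcnj_def)

lemma unit_Xp: "unit_char \<in> Xp"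
  using r_total[OF dual_unit_char dual_unit_char] dual_unit_char by (auto simp: X_plus_def)

lemma Xp_fmult:
  assumes "\<gamma> \<in> Xp" "\<psi> \<in> Xp"
  shows "\<gamma> \<cdot>\<^sub>f \<psi> \<in> Xp"
proof -
  have "(unit_char \<cdot>\<^sub>f \<psi>, \<gamma> \<cdot>\<^sub>f \<psi>) \<in> r"
    using assms by (intro r_mult dual_unit_char) (auto simp: X_plus_def)
  then have "(unit_char, \<gamma> \<cdot>\<^sub>f \<psi>) \<in> r" using assms by (auto simp: X_plus_def intro: r_trans)
  then show ?thesis using assms by (auto simp: X_plus_def intro: dual_fmult)
qed

lemma Xp_or_fcnj:
  assumes "\<gamma> \<in> dual"
  shows "\<gamma> \<in> Xp \<or> fcnj \<gamma> \<in> Xp"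
proof (cases "\<gamma> \<in> Xp")
  case False
  then have "(\<gamma>, unit_char) \<in> r"
    using r_total[OF assms dual_unit_char] assms by (auto simp: X_plus_def)
  then have "(\<gamma> \<cdot>\<^sub>f fcnj \<gamma>, unit_char \<cdot>\<^sub>f fcnj \<gamma>) \<in> r"
    by (intro r_mult assms dual_unit_char dual_fcnj)
  then show ?thesis using assms by (simp add: fmult_fcnj X_plus_def dual_fcnj)
qed simp

lemma Xp_fcnj_unit:
  assumes "\<gamma> \<in> Xp" "fcnj \<gamma> \<in> Xp"
  shows "\<gamma> = unit_char"
proof -
  have \<gamma>: "\<gamma> \<in> dual" using assms by (simp add: X_plus_def)
  have "(unit_char \<cdot>\<^sub>f \<gamma>, fcnj \<gamma> \<cdot>\<^sub>f \<gamma>) \<in> r"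
    using assms by (intro r_mult dual_unit_char) (auto simp: X_plus_def)
  then have "(\<gamma>, unit_char) \<in> r"
    using fmult_fcnj[OF \<gamma>] by (simp add: fmult_commute)
  moreover have "(unit_char, \<gamma>) \<in> r" using assms by (simp add: X_plus_def)
  ultimately show ?thesis by (rule r_antisym)
qed

lemma fcnj_Xm_iff: "\<gamma> \<in> dual \<Longrightarrow> fcnj \<gamma> \<in> Xm \<longleftrightarrow> \<gamma> \<in> Xp0"
  using Xp_or_fcnj[of \<gamma>] Xp_fcnj_unit[of \<gamma>] dual_fcnj[of \<gamma>] unit_Xp
  by (auto simp: X_minus_def) (auto simp: fcnj_def unit_char_def)

lemma fcnj_Xp0_iff: "\<gamma> \<in> dual \<Longrightarrow> fcnj \<gamma> \<in> Xp0 \<longleftrightarrow> \<gamma> \<in> Xm"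
  using fcnj_Xm_iff[of "fcnj \<gamma>"] dual_fcnj[of \<gamma>] by simp

lemma Xp_fmult_Xp0:
  assumes "\<gamma> \<in> Xp" "\<xi> \<in> Xp0"
  shows "\<gamma> \<cdot>\<^sub>f \<xi> \<in> Xp0"
proof -
  have d: "\<gamma> \<in> dual" "\<xi> \<in> dual" using assms by (auto simp: X_plus_def)
  have "\<gamma> \<cdot>\<^sub>f \<xi> \<noteq> unit_char"
  proof
    assume *: "\<gamma> \<cdot>\<^sub>f \<xi> = unit_char"
    have "fcnj \<gamma> = fcnj \<gamma> \<cdot>\<^sub>f (\<gamma> \<cdot>\<^sub>f \<xi>)" unfolding * by (simp add: fmult_def unit_char_def)
    also have "\<dots> = \<gamma> \<cdot>\<^sub>f fcnj \<gamma> \<cdot>\<^sub>f \<xi>" by (simp add: fmult_def mult_ac)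
    finally have "fcnj \<gamma> = \<xi>" by (simp add: fmult_fcnj d)
    then have "\<gamma> = unit_char" using assms Xp_fcnj_unit[of \<gamma>] by simp
    then show False using * assms by simp
  qed
  then show ?thesis using Xp_fmult[of \<gamma> \<xi>] assms by simp
qed

lemma H2_eq: "H2 M r = spectral_space M Xp"
  using Xp_sub by (auto simp: H2_def spectral_space_def X_minus_def)

lemma H2_minus_eq: "H2_minus M r = spectral_space M Xm"
proof (intro equalityI subsetI)
  fix f assume f: "f \<in> H2_minus M r"
  have "fourier M f \<gamma> = 0" if "\<gamma> \<in> dual - Xm" for \<gamma>
  proof -
    have "\<gamma> \<in> H2 M r" unfolding H2_eq using that by (intro spectral_space_char) (auto simp: X_minus_def)
    then show ?thesis using f by (simp add: H2_minus_def fourier_eq_inner)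
  qed
  then show "f \<in> spectral_space M Xm" using f by (simp add: spectral_space_def H2_minus_def)
next
  fix f assume f: "f \<in> spectral_space M Xm"
  have "L2_inner M f h = 0" if "h \<in> H2 M r" for h
    by (rule spectral_space_orthogonal[OF Xp_sub Xm_sub _ that[unfolded H2_eq] f]) (auto simp: X_minus_def)
  then show "f \<in> H2_minus M r" using f by (simp add: H2_minus_def spectral_space_L2)
qed

lemma fcnj_spectral_Xm:
  assumes "f \<in> spectral_space M Xm"
  shows "fcnj f \<in> spectral_space M Xp0"
  using assms by (auto simp: spectral_space_def L2_fcnj fourier_fcnj dual_fcnj fcnj_Xm_iff simp del: Diff_iff)

lemma spectral_Xp_fmult_Xp0:
  assumes "f \<in> spectral_space M Xp" "\<xi> \<in> Xp0"
  shows "f \<cdot>\<^sub>f \<xi> \<in> spectral_space M Xp0"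
proof -
  have \<xi>: "\<xi> \<in> dual" using assms by (simp add: X_plus_def)
  have "f \<cdot>\<^sub>f \<xi> \<in> L2 M"
    using L2_bounded_mult[OF spectral_space_L2[OF assms(1)] continuous_measurable[OF dual_cont[OF \<xi>]], of 1]
    by (simp add: dual_norm[OF \<xi>] fmult_def mult.commute)
  moreover have "fourier M (f \<cdot>\<^sub>f \<xi>) \<gamma> = 0" if \<gamma>: "\<gamma> \<in> dual - Xp0" for \<gamma>
  proof -
    have d: "\<gamma> \<cdot>\<^sub>f fcnj \<xi> \<in> dual" using \<gamma> \<xi> by (intro dual_fmult dual_fcnj) auto
    have "fcnj \<gamma> \<in> Xp"
    proof (cases "\<gamma> = unit_char")
      case True
      then show ?thesis using unit_Xp by (simp add: fcnj_def unit_char_def)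
    next
      case False
      then show ?thesis using \<gamma> Xp_or_fcnj[of \<gamma>] by blast
    qed
    then have "fcnj \<gamma> \<cdot>\<^sub>f \<xi> \<in> Xp0" using assms(2) by (rule Xp_fmult_Xp0)
    moreover have "fcnj \<gamma> \<cdot>\<^sub>f \<xi> = fcnj (\<gamma> \<cdot>\<^sub>f fcnj \<xi>)" by (simp add: fcnj_fmult)
    ultimately have "\<gamma> \<cdot>\<^sub>f fcnj \<xi> \<in> Xm" using fcnj_Xp0_iff[OF d] by simp
    then show ?thesis
      using assms(1) d by (auto simp: fourier_fmult spectral_space_def X_minus_def)
  qed
  ultimately show ?thesis by (simp add: spectral_space_def)
qed

text \<open>
  This is a device of Szego. For a weight \<open>w\<close> bounded away from \<open>0\<close>, subtract from the constant
  \<open>1\<close> its projection, in \<open>L\<^sup>2(w)\<close>, onto the functions in \<open>H\<^sup>2\<close> with mean zero. The remainder \<open>q\<close> is such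
  that \<open>w \<bar>q\<bar>\<^sup>2\<close> has no Fourier coefficient except its mean \<open>c\<close>, and is therefore constant. So
  \<open>u = w q\<^sup>* / \<surd>c\<close> has \<open>\<bar>u\<bar>\<^sup>2 = w\<close>, its inverse is \<open>q / \<surd>c\<close>, and both are in \<open>H\<^sup>2\<close>. With
  \<open>w = \<bar>f\<bar> + e\<close> the factorization is \<open>f = u (f / u)\<close>.
\<close>

lemma analytic_polynomial_factorization:
  assumes f: "f \<in> char_span Xp0" and e: "e > 0"
  obtains u v where "u \<in> spectral_space M Xp" "v \<in> spectral_space M Xp0"
    "AE x in M. f x = u x * v x" "AE x in M. (cmod (u x))\<^sup>2 = cmod (f x) + e"
    "AE x in M. (cmod (v x))\<^sup>2 \<le> cmod (f x)"
proof -
  define w where "w x = cmod (f x) + e" for x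
  \<comment> \<open>multiplication by \<open>s\<close> identifies \<open>L\<^sup>2(w)\<close> with \<open>L\<^sup>2\<close>, and \<open>H0\<close> with \<open>Z\<close>\<close>
  define s where "s x = complex_of_real (sqrt (w x))" for x
  have f_cont: "continuous_on UNIV f" by (rule char_span_continuous[OF f Xp0_sub])
  have f_meas [measurable]: "f \<in> borel_measurable M" by (rule continuous_measurable[OF f_cont])
  have w_meas [measurable]: "w \<in> borel_measurable M" unfolding w_def by measurable
  have s_meas [measurable]: "s \<in> borel_measurable M" unfolding s_def by measurable
  obtain C where C: "C > 0" "\<And>x. cmod (f x) \<le> C" using continuous_bounded[OF compact_UNIV f_cont] by blast
  have w: "w x \<ge> e" "w x > 0" "w x \<le> C + e" for x
    using e C(2)[of x] by (auto simp: w_def add_nonneg_pos)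
  have s_nz: "s x \<noteq> 0" for x using w(2)[of x] by (simp add: s_def)
  have s_norm: "cmod (s x) = sqrt (w x)" for x using w(2)[of x] by (simp add: s_def less_imp_le)
  have ss: "s x * cnj (s x) = of_real (w x)" for x
    using w(2)[of x] by (simp add: s_def flip: of_real_mult)
  have s_le: "cmod (s x) \<le> sqrt (C + e)" for x using w(3) by (simp add: s_norm)
  have s_ge: "sqrt e \<le> cmod (s x)" for x using w(1) by (simp add: s_norm)
  have sL: "s \<in> L2 M" by (rule bounded_L2[OF s_meas]) (use s_le in auto)
  define H0 where "H0 = spectral_space M Xp0"
  have H0L: "h \<in> L2 M" if "h \<in> H0" for h using that unfolding H0_def by (rule spectral_space_L2)
  have sH0: "(\<lambda>x. s x * h x) \<in> L2 M" if "h \<in> L2 M" for h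
    by (rule L2_bounded_mult[OF that s_meas]) (use s_le in auto)
  define Z where "Z = (\<lambda>p x. s x * p x) ` H0"
  have "L2_subspace M Z"
    unfolding L2_subspace_def L2_closed_def
  proof (intro conjI allI impI ballI)
    show "Z \<subseteq> L2 M" unfolding Z_def using H0L sH0 by auto
    show "Z \<noteq> {}" using spectral_space_subspace[of Xp0] by (auto simp: Z_def H0_def L2_subspace_def)
    fix F h assume F: "\<forall>n. F n \<in> Z" and h: "h \<in> L2 M"
      and lim: "(\<lambda>n. L2_norm M (\<lambda>x. F n x - h x)) \<longlonglongrightarrow> 0"
    have "\<exists>p. \<forall>n. p n \<in> H0 \<and> F n = (\<lambda>x. s x * p n x)" using F unfolding Z_def by (intro choice) auto
    then obtain p where p: "\<And>n. p n \<in> H0" "\<And>n. F n = (\<lambda>x. s x * p n x)" by blast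
    have [measurable]: "h \<in> borel_measurable M" using h by (rule L2_measurable)
    have [measurable]: "p n \<in> borel_measurable M" for n using H0L[OF p(1)] by (rule L2_measurable)
    have div: "cmod (z / s x) \<le> (1 / sqrt e) * cmod z" for z x
      using s_ge[of x] e by (auto simp: norm_divide intro!: divide_left_mono mult_pos_pos)
    have hs: "(\<lambda>x. h x / s x) \<in> L2 M"
      by (rule L2_dominated[OF h, where c = "1 / sqrt e"]) (use div in auto)
    have FL: "F n \<in> L2 M" for n unfolding p(2) by (rule sH0[OF H0L[OF p(1)]])
    have le: "L2_norm M (\<lambda>x. p n x - h x / s x) \<le> (1 / sqrt e) * L2_norm M (\<lambda>x. F n x - h x)" for n
    proof (rule L2_norm_mono[OF L2_diff[OF FL h]])
      have "p n x - h x / s x = (F n x - h x) / s x" for x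
        using s_nz[of x] by (simp add: p(2) field_simps)
      then show "AE x in M. cmod (p n x - h x / s x) \<le> (1 / sqrt e) * cmod (F n x - h x)"
        by (intro AE_I2) (simp only: div)
    qed (use e in auto)
    have "(\<lambda>n. L2_norm M (\<lambda>x. p n x - h x / s x)) \<longlonglongrightarrow> 0"
      by (rule tendsto_sandwich[OF _ _ tendsto_const tendsto_mult_right_zero[OF lim, of "1 / sqrt e"]])
         (use le in auto)
    then have "(\<lambda>x. h x / s x) \<in> H0"
      using spectral_space_subspace[of Xp0] p(1) hs unfolding L2_subspace_def H0_def by (blast intro: L2_closedD)
    then have "(\<lambda>x. s x * (h x / s x)) \<in> Z" unfolding Z_def by (rule imageI)
    then show "h \<in> Z" using s_nz by simp
  next
    fix g h assume "g \<in> Z" "h \<in> Z"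
    then obtain p q where "p \<in> H0" "q \<in> H0" "g = (\<lambda>x. s x * p x)" "h = (\<lambda>x. s x * q x)" by (auto simp: Z_def)
    then show "(\<lambda>x. g x + h x) \<in> Z"
      using spectral_space_add[of p Xp0 q] unfolding Z_def H0_def
      by (intro image_eqI[of _ _ "\<lambda>x. p x + q x"]) (auto simp: algebra_simps)
  next
    fix g c assume "g \<in> Z"
    then obtain p where "p \<in> H0" "g = (\<lambda>x. s x * p x)" by (auto simp: Z_def)
    then show "(\<lambda>x. c * g x) \<in> Z"
      using spectral_space_cmult[of p Xp0 c] unfolding Z_def H0_def
      by (intro image_eqI[of _ _ "\<lambda>x. c * p x"]) (auto simp: algebra_simps)
  qed
  then obtain p where p: "p \<in> H0" and orth: "\<And>v. v \<in> H0 \<Longrightarrow> L2_inner M (\<lambda>x. s x - s x * p x) (\<lambda>x. s x * v x) = 0"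
    using L2_projection[OF prob_M _ sL, of Z] unfolding Z_def by auto
  define q where "q x = 1 - p x" for x
  have one: "unit_char \<in> spectral_space M Xp"
    by (intro spectral_space_char dual_unit_char unit_Xp)
  have pL: "p \<in> L2 M" by (rule H0L[OF p])
  have p_Xp: "p \<in> spectral_space M Xp" using p by (auto simp: H0_def spectral_space_def)
  have q_Xp: "q \<in> spectral_space M Xp"
    using spectral_space_add[OF one spectral_space_cmult[OF p_Xp, of "-1"]]
    by (simp add: q_def[abs_def] unit_char_def)
  then have qL: "q \<in> L2 M" by (rule spectral_space_L2)
  have q_meas [measurable]: "q \<in> borel_measurable M" using qL by (rule L2_measurable)
  have wq: "(\<integral>x. of_real (w x) * q x * cnj (v x) \<partial>M) = 0" if "v \<in> H0" for v
  proof -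
    have "(s x - s x * p x) * cnj (s x * v x) = of_real (w x) * q x * cnj (v x)" for x
      by (simp add: q_def ss[symmetric] algebra_simps)
    then show ?thesis using orth[OF that] unfolding L2_inner_def by presburger
  qed
  define g where "g x = complex_of_real (w x * (cmod (q x))\<^sup>2)" for x
  have g_int: "integrable M g"
    unfolding g_def
  proof (rule integrable_of_real, rule Bochner_Integration.integrable_bound)
    show "integrable M (\<lambda>x. (C + e) * (cmod (q x))\<^sup>2)" using qL by (simp add: L2_def)
    show "AE x in M. norm (w x * (cmod (q x))\<^sup>2) \<le> norm ((C + e) * (cmod (q x))\<^sup>2)"
      using w(2,3) C(1) e by (auto simp: abs_mult less_imp_le intro!: mult_right_mono)
  qed measurable
  have g_alt: "g x = of_real (w x) * q x * cnj (q x)" for x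
    unfolding g_def using complex_norm_square[of "q x"] by (simp add: mult.assoc)
  have g_Xp0: "fourier M g \<gamma> = 0" if "\<gamma> \<in> Xp0" for \<gamma>
  proof -
    have "q \<cdot>\<^sub>f \<gamma> \<in> H0" unfolding H0_def by (rule spectral_Xp_fmult_Xp0[OF q_Xp that])
    from wq[OF this] show ?thesis by (simp add: fourier_def g_alt fmult_def mult_ac)
  qed
  have g_other: "fourier M g \<gamma> = 0" if "\<gamma> \<in> dual" "\<gamma> \<noteq> unit_char" for \<gamma>
  proof (cases "\<gamma> \<in> Xp0")
    case False
    then have "fcnj \<gamma> \<in> Xp0" using that Xp_or_fcnj[OF that(1)] fcnj_Xp0_iff[OF that(1)] by (auto simp: X_minus_def)
    moreover have "fcnj g = g" by (rule ext) (simp add: fcnj_def g_def)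
    ultimately show ?thesis using g_Xp0[of "fcnj \<gamma>"] fourier_fcnj[of M g \<gamma>] by simp
  qed (rule g_Xp0)
  define c where "c = (\<integral>x. w x * (cmod (q x))\<^sup>2 \<partial>M)"
  have gc: "(\<integral>x. g x \<partial>M) = of_real c"
    unfolding g_def c_def by (rule integral_complex_of_real)
  have "AE x in M. g x - of_real c = 0"
  proof (rule fourier_unique_AE)
    show "integrable M (\<lambda>x. g x - of_real c)" using g_int by simp
    fix \<gamma> :: "'g \<Rightarrow> complex" assume \<gamma>: "\<gamma> \<in> dual"
    have "integrable M (\<lambda>x. g x * cnj (\<gamma> x))"
      using integrable_bounded_mult[OF g_int, of "\<lambda>x. cnj (\<gamma> x)" 1] \<gamma>
      by (simp add: dual_norm mult.commute continuous_measurable dual_cont continuous_on_cnj)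
    moreover have "integrable M (\<lambda>x. of_real c * cnj (\<gamma> x))"
      by (intro continuous_integrable continuous_intros dual_cont \<gamma>)
    ultimately have "fourier M (\<lambda>x. g x - of_real c) \<gamma> = fourier M g \<gamma> - of_real c * fourier M unit_char \<gamma>"
      by (simp add: fourier_def left_diff_distrib unit_char_def)
    also have "\<dots> = 0"
    proof (cases "\<gamma> = unit_char")
      case True
      then show ?thesis using gc fourier_dual[OF dual_unit_char \<gamma>] by (simp add: fourier_def unit_char_def)
    next
      case False
      then show ?thesis using g_other[OF \<gamma>] fourier_dual[OF dual_unit_char \<gamma>] by auto
    qed
    finally show "fourier M (\<lambda>x. g x - of_real c) \<gamma> = 0" .
  qed
  then have w_c: "AE x in M. w x * (cmod (q x))\<^sup>2 = c"
    by eventually_elim (simp only: g_def eq_iff_diff_eq_0[symmetric] of_real_eq_iff)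
  have "c > 0"
  proof -
    have "fourier M p unit_char = 0" using p by (simp add: H0_def spectral_space_def dual_unit_char)
    then have "(\<integral>x. q x \<partial>M) = 1"
      using L2_integrable[OF pL] prob_space by (simp add: q_def[abs_def] fourier_def unit_char_def)
    then have "1 \<le> L2_norm M q"
      using integral_norm_bound[of M q] L1_le_L2[OF qL] by simp
    then have "1 \<le> (L2_norm M q)\<^sup>2" by (rule one_le_power)
    then have "e \<le> e * (\<integral>x. (cmod (q x))\<^sup>2 \<partial>M)" using e by (simp add: L2_norm_power2)
    also have "\<dots> = (\<integral>x. e * (cmod (q x))\<^sup>2 \<partial>M)" by simp
    also have "\<dots> \<le> c"
      unfolding c_def
    proof (rule integral_mono)
      show "integrable M (\<lambda>x. e * (cmod (q x))\<^sup>2)" using qL by (simp add: L2_def)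
      show "integrable M (\<lambda>x. w x * (cmod (q x))\<^sup>2)"
        using integrable_Re[OF g_int] by (simp add: g_def)
      show "e * (cmod (q x))\<^sup>2 \<le> w x * (cmod (q x))\<^sup>2" for x by (intro mult_right_mono w) simp
    qed
    finally show ?thesis using e by linarith
  qed
  define k where "k = complex_of_real (1 / sqrt c)"
  have k2: "(cmod k)\<^sup>2 = 1 / c" using \<open>c > 0\<close> by (simp add: k_def norm_divide power_divide)
  have kk: "k * k = of_real (1 / c)" using \<open>c > 0\<close> by (simp add: k_def flip: of_real_mult)
  define u where "u x = k * (of_real (w x) * cnj (q x))" for x
  define v where "v x = k * (f x * q x)" for x
  have wqL: "(\<lambda>x. of_real (w x) * cnj (q x)) \<in> L2 M"
    by (rule L2_bounded_mult[OF L2_cnj[OF qL], of _ "C + e"]) (use w in \<open>auto simp: less_imp_le\<close>)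
  have "(\<lambda>x. of_real (w x) * cnj (q x)) \<in> spectral_space M Xp"
  proof -
    have "fourier M (\<lambda>x. of_real (w x) * cnj (q x)) \<gamma> = 0" if \<gamma>: "\<gamma> \<in> dual - Xp" for \<gamma>
    proof -
      have "fcnj \<gamma> \<in> H0" unfolding H0_def
        using \<gamma> fcnj_Xp0_iff[of \<gamma>] by (intro spectral_space_char dual_fcnj) (auto simp: X_minus_def)
      then have "(\<integral>x. cnj (of_real (w x) * q x * cnj (fcnj \<gamma> x)) \<partial>M) = 0"
        using wq by (simp only: Bochner_Integration.integral_cnj complex_cnj_zero)
      then show ?thesis by (simp add: fourier_def fcnj_def)
    qed
    then show ?thesis using wqL by (simp add: spectral_space_def)
  qed
  then have u: "u \<in> spectral_space M Xp" unfolding u_def by (rule spectral_space_cmult)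
  have "(\<lambda>x. f x * q x) \<in> spectral_space M Xp0"
    using f
  proof (induction rule: char_span_induct)
    case zero
    then show ?case by (simp add: spectral_space_def fourier_def)
  next
    case (step a \<xi> h)
    have "(\<lambda>x. a * (q \<cdot>\<^sub>f \<xi>) x + h x * q x) \<in> spectral_space M Xp0"
      using step by (intro spectral_space_add spectral_space_cmult spectral_Xp_fmult_Xp0 q_Xp)
    then show ?case by (simp add: fmult_def algebra_simps)
  qed
  then have v: "v \<in> spectral_space M Xp0" unfolding v_def by (rule spectral_space_cmult)
  have "AE x in M. f x = u x * v x \<and> (cmod (u x))\<^sup>2 = cmod (f x) + e \<and> (cmod (v x))\<^sup>2 \<le> cmod (f x)"
    using w_c
  proof eventually_elim
    case (elim x)
    have "u x * v x = (k * k) * f x * g x" by (simp add: u_def v_def g_alt mult_ac)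
    also have "g x = of_real c" by (simp add: g_def elim)
    finally have 1: "f x = u x * v x" using \<open>c > 0\<close> by (simp add: kk)
    have q2: "(cmod (q x))\<^sup>2 = c / w x" using elim w(2)[of x] by (simp add: field_simps)
    have "(cmod (u x))\<^sup>2 = (1 / c) * ((w x)\<^sup>2 * (c / w x))"
      unfolding k2[symmetric] q2[symmetric] by (simp add: u_def norm_mult power_mult_distrib)
    also have "\<dots> = w x" using w(2)[of x] \<open>c > 0\<close> by (simp add: power2_eq_square)
    finally have 2: "(cmod (u x))\<^sup>2 = w x" .
    have "(cmod (v x))\<^sup>2 = (cmod (f x))\<^sup>2 / w x"
      using w(2)[of x] \<open>c > 0\<close> by (simp add: v_def norm_mult power_mult_distrib k2 q2)
    also have "\<dots> \<le> cmod (f x)"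
      using w(2)[of x] e by (simp add: divide_le_eq power2_eq_square w_def mult_left_mono)
    finally show ?case using 1 2 by (simp add: w_def)
  qed
  then show thesis using that[OF u v] by auto
qed

end

section \<open>Nehari's theorem\<close>

context compact_haar
begin

lemma L2_norm_le_AE:
  assumes "f \<in> borel_measurable M" "AE x in M. cmod (f x) \<le> C" "C \<ge> 0"
  shows "L2_norm M f \<le> C"
  using L2_norm_mono[OF continuous_L2[of "\<lambda>x. 1"] assms(1), of C] assms(2,3) prob_space
  by (simp add: L2_norm_def)

lemma AE_bounded_L2_limit:
  assumes F: "\<And>n. F n \<in> L2 M" "\<And>n. AE x in M. cmod (F n x) \<le> C" and f: "f \<in> L2 M"
    and lim: "(\<lambda>n. L2_norm M (\<lambda>x. F n x - f x)) \<longlonglongrightarrow> 0"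
  shows "AE x in M. cmod (f x) \<le> C"
proof -
  have int: "integrable M (\<lambda>x. F n x - f x)" for n by (intro L2_integrable L2_diff F f)
  have L1: "(\<lambda>n. \<integral>x. norm (F n x - f x) \<partial>M) \<longlonglongrightarrow> 0"
    by (rule tendsto_sandwich[OF _ _ tendsto_const lim])
       (use F f in \<open>auto intro!: always_eventually L1_le_L2 L2_diff\<close>)
  obtain k :: "nat \<Rightarrow> nat" where k: "AE x in M. (\<lambda>n. F (k n) x - f x) \<longlonglongrightarrow> 0"
    using tendsto_L1_AE_subseq[OF int L1] by blast
  have "AE x in M. \<forall>n. cmod (F n x) \<le> C" using F(2) by (simp add: AE_all_countable)
  with k show ?thesis
  proof eventually_elim
    case (elim x)
    then have "(\<lambda>n. F (k n) x) \<longlonglongrightarrow> f x" by (simp add: LIM_zero_iff)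
    then have "(\<lambda>n. cmod (F (k n) x)) \<longlonglongrightarrow> cmod (f x)" by (rule tendsto_norm)
    then show ?case by (rule LIMSEQ_le_const2) (use elim in auto)
  qed
qed

text \<open>
  This plays the role of the Hahn-Banach theorem together with the duality between \<open>L\<^sup>1\<close> and
  \<open>L\<^sup>\<infinity>\<close>. Among the functions bounded by \<open>C\<close> choose \<open>\<phi>\<close> such that the projection \<open>d\<close> of \<open>b - \<phi>\<close> onto
  \<open>N\<close> is as short as possible; such a \<open>\<phi>\<close> lies in the intersection of nested convex sets. Moving from \<open>\<phi>\<close>
  towards \<open>C sgn d\<close> does not shorten \<open>d\<close>, that is, \<open>C \<integral> \<bar>d\<bar> \<le> Re \<langle>\<phi>, d\<rangle>\<close>. Since
  \<open>Re \<langle>b, d\<rangle> \<le> C \<integral> \<bar>d\<bar>\<close> by hypothesis, \<open>\<parallel>d\<parallel>\<^sup>2 = Re \<langle>b - \<phi>, d\<rangle> \<le> 0\<close>.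
\<close>

lemma L1_bounded_functional_representation:
  assumes N: "L2_subspace M N" and b: "b \<in> L2 M" and C: "C \<ge> 0"
    and bound: "\<And>d. d \<in> N \<Longrightarrow> cmod (L2_inner M b d) \<le> C * (\<integral>x. cmod (d x) \<partial>M)"
  obtains \<phi> where "\<phi> \<in> L2 M" "AE x in M. cmod (\<phi> x) \<le> C"
    "\<And>d. d \<in> N \<Longrightarrow> L2_inner M \<phi> d = L2_inner M b d"
proof -
  have NL: "v \<in> L2 M" if "v \<in> N" for v using N that by (auto simp: L2_subspace_def L2_closed_def)
  define B where "B = {\<phi>\<in>L2 M. AE x in M. cmod (\<phi> x) \<le> C}"
  have BL: "\<phi> \<in> L2 M" if "\<phi> \<in> B" for \<phi> using that by (simp add: B_def)
  have B_convex: "(\<lambda>x. of_real (1 - t) * f x + of_real t * h x) \<in> B"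
    if "f \<in> B" "h \<in> B" "0 \<le> t" "t \<le> 1" for f h and t :: real
  proof -
    have "AE x in M. cmod (f x) \<le> C" "AE x in M. cmod (h x) \<le> C" using that by (auto simp: B_def)
    then have "AE x in M. cmod (of_real (1 - t) * f x + of_real t * h x) \<le> C"
    proof eventually_elim
      case (elim x)
      have "cmod (of_real (1 - t) * f x + of_real t * h x) \<le> (1 - t) * cmod (f x) + t * cmod (h x)"
        using norm_triangle_ineq[of "of_real (1 - t) * f x" "of_real t * h x"] that(3,4)
        by (simp only: norm_mult norm_of_real abs_of_nonneg diff_ge_0_iff_ge)
      also have "\<dots> \<le> (1 - t) * C + t * C" using elim that by (intro add_mono mult_left_mono) auto
      finally show ?case by (simp add: algebra_simps)
    qed
    then show ?thesis using that by (auto simp: B_def intro!: L2_add L2_cmult)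
  qed
  \<comment> \<open>\<open>c\<close> belongs to \<open>W\<close> if some \<open>b - \<phi>\<close> with \<open>\<phi>\<close> in \<open>B\<close> has a projection onto \<open>N\<close> of norm at most \<open>c\<close>\<close>
  define W where "W = {c. 0 \<le> c \<and> (\<exists>\<phi>\<in>B. \<forall>v\<in>N. cmod (L2_inner M (\<lambda>x. \<phi> x - b x) v) \<le> c * L2_norm M v)}"
  have W_bdd: "bdd_below W" by (rule bdd_belowI[of _ 0]) (simp add: W_def)
  have "L2_norm M b \<in> W"
  proof -
    have "(\<lambda>x. 0) \<in> B" using C by (simp add: B_def)
    moreover have "cmod (L2_inner M (\<lambda>x. 0 - b x) v) \<le> L2_norm M b * L2_norm M v" if "v \<in> N" for v
      using L2_Cauchy_Schwarz[OF L2_uminus[OF b] NL[OF that]] by simp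
    ultimately show ?thesis unfolding W_def by (intro CollectI conjI bexI[of _ "\<lambda>x. 0"]) auto
  qed
  then have W_ne: "W \<noteq> {}" by blast
  define d0 where "d0 = Inf W"
  have d0_le: "d0 \<le> c" if "c \<in> W" for c unfolding d0_def by (rule cInf_lower[OF that W_bdd])
  have d0_ge: "d0 \<ge> 0" unfolding d0_def by (rule cInf_greatest[OF W_ne]) (simp add: W_def)
  define S where "S n = {\<phi>\<in>B. \<forall>v\<in>N. cmod (L2_inner M (\<lambda>x. \<phi> x - b x) v) \<le> (d0 + 1 / real (Suc n)) * L2_norm M v}" for n
  have "\<exists>\<phi>. \<forall>n. \<phi> \<in> S n"
  proof (rule L2_nested_convex_Inter_nonempty[OF prob_M])
    show "L2_closed M (S n)" for n
      unfolding L2_closed_def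
    proof (intro conjI allI impI)
      show "S n \<subseteq> L2 M" by (auto simp: S_def B_def)
      fix F f assume F: "\<forall>k. F k \<in> S n" and f: "f \<in> L2 M"
        and lim: "(\<lambda>k. L2_norm M (\<lambda>x. F k x - f x)) \<longlonglongrightarrow> 0"
      have FL: "F k \<in> L2 M" for k using F by (auto simp: S_def B_def)
      have "f \<in> B" using AE_bounded_L2_limit[OF FL _ f lim, of C] F f by (auto simp: S_def B_def)
      moreover have "cmod (L2_inner M (\<lambda>x. f x - b x) v) \<le> (d0 + 1 / real (Suc n)) * L2_norm M v" if "v \<in> N" for v
      proof (rule LIMSEQ_le_const2)
        have "(\<lambda>k. L2_inner M (F k) v - L2_inner M b v) \<longlonglongrightarrow> L2_inner M f v - L2_inner M b v"
          by (intro tendsto_intros L2_inner_tendsto[OF FL f lim] NL that)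
        then show "(\<lambda>k. cmod (L2_inner M (\<lambda>x. F k x - b x) v)) \<longlonglongrightarrow> cmod (L2_inner M (\<lambda>x. f x - b x) v)"
          by (intro tendsto_norm) (simp add: L2_inner_diff FL f b NL that)
      qed (use F that in \<open>auto simp: S_def\<close>)
      ultimately show "f \<in> S n" by (simp add: S_def)
    qed
    show "convex_set (S n)" for n
      unfolding convex_set_def
    proof (intro ballI allI impI)
      fix f h and t :: real assume f: "f \<in> S n" and h: "h \<in> S n" and t: "0 \<le> t" "t \<le> 1"
      have fB: "f \<in> B" and hB: "h \<in> B" using f h by (auto simp: S_def)
      have "cmod (L2_inner M (\<lambda>x. (of_real (1 - t) * f x + of_real t * h x) - b x) v) \<le> (d0 + 1 / real (Suc n)) * L2_norm M v"
        if v: "v \<in> N" for v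
      proof -
        define a where "a = (d0 + 1 / real (Suc n)) * L2_norm M v"
        have "(\<lambda>x. (of_real (1 - t) * f x + of_real t * h x) - b x) =
            (\<lambda>x. of_real (1 - t) * (f x - b x) + of_real t * (h x - b x))"
          by (auto simp: algebra_simps)
        then have "L2_inner M (\<lambda>x. (of_real (1 - t) * f x + of_real t * h x) - b x) v =
            of_real (1 - t) * L2_inner M (\<lambda>x. f x - b x) v + of_real t * L2_inner M (\<lambda>x. h x - b x) v"
          using L2_inner_add[OF L2_cmult[OF L2_diff[OF BL[OF fB] b]] L2_cmult[OF L2_diff[OF BL[OF hB] b]] NL[OF v]]
          by (simp only: L2_inner_cmult)
        also have "cmod \<dots> \<le> (1 - t) * cmod (L2_inner M (\<lambda>x. f x - b x) v) + t * cmod (L2_inner M (\<lambda>x. h x - b x) v)"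
          using norm_triangle_ineq[of "of_real (1 - t) * L2_inner M (\<lambda>x. f x - b x) v" "of_real t * L2_inner M (\<lambda>x. h x - b x) v"] t
          by (simp only: norm_mult norm_of_real abs_of_nonneg diff_ge_0_iff_ge)
        also have "\<dots> \<le> (1 - t) * a + t * a"
          unfolding a_def using f h v t by (intro add_mono mult_left_mono) (auto simp: S_def)
        also have "(1 - t) * a + t * a = a" by (simp add: algebra_simps)
        finally show ?thesis by (simp only: a_def)
      qed
      then show "(\<lambda>x. of_real (1 - t) * f x + of_real t * h x) \<in> S n"
        using B_convex[OF fB hB t] by (simp add: S_def)
    qed
    show "S n \<noteq> {}" for n
    proof -
      have "Inf W < d0 + 1 / real (Suc n)" by (simp add: d0_def)
      then obtain c where c: "c \<in> W" "c < d0 + 1 / real (Suc n)" using cInf_lessD[OF W_ne] by blast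
      then obtain \<phi> where \<phi>: "\<phi> \<in> B" "\<And>v. v \<in> N \<Longrightarrow> cmod (L2_inner M (\<lambda>x. \<phi> x - b x) v) \<le> c * L2_norm M v"
        by (auto simp: W_def)
      have "c * L2_norm M v \<le> (d0 + 1 / real (Suc n)) * L2_norm M v" for v
        using c(2) by (intro mult_right_mono) auto
      then have "\<phi> \<in> S n" unfolding S_def using \<phi> by (blast intro: order_trans)
      then show ?thesis by blast
    qed
    show "S (Suc n) \<subseteq> S n" for n
    proof -
      have "1 / real (Suc (Suc n)) \<le> 1 / real (Suc n)" by (simp add: field_simps)
      then have "(d0 + 1 / real (Suc (Suc n))) * L2_norm M v \<le> (d0 + 1 / real (Suc n)) * L2_norm M v" for v
        by (intro mult_right_mono) auto
      then show ?thesis unfolding S_def by (blast intro: order_trans)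
    qed
    show "L2_norm M f \<le> C" if "f \<in> S 0" for f
      using that C by (intro L2_norm_le_AE) (auto simp: S_def B_def L2_def)
  qed
  then obtain \<phi> where \<phi>S: "\<And>n. \<phi> \<in> S n" by blast
  have \<phi>: "\<phi> \<in> B" using \<phi>S[of 0] by (simp add: S_def)
  have \<phi>L: "\<phi> \<in> L2 M" by (rule BL[OF \<phi>])
  have \<phi>_d0: "cmod (L2_inner M (\<lambda>x. \<phi> x - b x) v) \<le> d0 * L2_norm M v" if "v \<in> N" for v
  proof (rule LIMSEQ_le_const)
    show "(\<lambda>n. (d0 + 1 / real (Suc n)) * L2_norm M v) \<longlonglongrightarrow> d0 * L2_norm M v"
      using tendsto_mult_right[OF tendsto_add[OF tendsto_const LIMSEQ_inverse_real_of_nat], of d0]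
      by (simp add: inverse_eq_divide)
    show "\<exists>N. \<forall>n\<ge>N. cmod (L2_inner M (\<lambda>x. \<phi> x - b x) v) \<le> (d0 + 1 / real (Suc n)) * L2_norm M v"
      using \<phi>S that by (auto simp: S_def)
  qed
  have diffL: "(\<lambda>x. b x - \<phi> x) \<in> L2 M" by (intro L2_diff b \<phi>L)
  obtain d where d: "d \<in> N" and d_orth: "\<And>v. v \<in> N \<Longrightarrow> L2_inner M (\<lambda>x. (b x - \<phi> x) - d x) v = 0"
    using L2_projection[OF prob_M N diffL] by blast
  have dL: "d \<in> L2 M" by (rule NL[OF d])
  have d_inner: "L2_inner M (\<lambda>x. b x - \<phi> x) v = L2_inner M d v" if "v \<in> N" for v
    using d_orth[OF that] by (simp add: L2_inner_diff[OF diffL dL NL[OF that]])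
  have neg: "L2_inner M (\<lambda>x. \<phi> x - b x) v = - L2_inner M (\<lambda>x. b x - \<phi> x) v" if "v \<in> N" for v
    by (simp add: L2_inner_diff b \<phi>L NL that)
  have d_le: "L2_norm M d \<le> d0"
  proof (cases "L2_norm M d = 0")
    case False
    have "cmod (L2_inner M d d) \<le> d0 * L2_norm M d"
      using \<phi>_d0[OF d] by (simp add: neg[OF d] d_inner[OF d])
    then have "L2_norm M d * L2_norm M d \<le> d0 * L2_norm M d"
      by (simp add: L2_inner_self norm_power power2_eq_square norm_mult)
    then show ?thesis using False L2_norm_nonneg[of M d] by (simp add: mult_le_cancel_right)
  qed (use d0_ge in simp)
  have variation: "Re (L2_inner M (\<lambda>x. \<psi> x - \<phi> x) d) \<le> 0" if \<psi>: "\<psi> \<in> B" for \<psi>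
  proof -
    have \<psi>L: "\<psi> \<in> L2 M" by (rule BL[OF \<psi>])
    have dif: "(\<lambda>x. \<psi> x - \<phi> x) \<in> L2 M" by (intro L2_diff \<psi>L \<phi>L)
    obtain e where e: "e \<in> N" and e_orth: "\<And>v. v \<in> N \<Longrightarrow> L2_inner M (\<lambda>x. (\<psi> x - \<phi> x) - e x) v = 0"
      using L2_projection[OF prob_M N dif] by blast
    have eL: "e \<in> L2 M" by (rule NL[OF e])
    have e_inner: "L2_inner M (\<lambda>x. \<psi> x - \<phi> x) v = L2_inner M e v" if "v \<in> N" for v
      using e_orth[OF that] by (simp add: L2_inner_diff[OF dif eL NL[OF that]])
    define a where "a = Re (L2_inner M d e)"
    have "2 * a \<le> t * (L2_norm M e)\<^sup>2" if t: "0 < t" "t \<le> 1" for t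
    proof -
      define \<phi>t where "\<phi>t = (\<lambda>x. of_real (1 - t) * \<phi> x + of_real t * \<psi> x)"
      have \<phi>tB: "\<phi>t \<in> B" unfolding \<phi>t_def using t by (intro B_convex \<phi> \<psi>) auto
      define g where "g = (\<lambda>x. d x - of_real t * e x)"
      have gL: "g \<in> L2 M" unfolding g_def by (intro L2_diff L2_cmult dL eL)
      have "cmod (L2_inner M (\<lambda>x. \<phi>t x - b x) v) \<le> L2_norm M g * L2_norm M v" if v: "v \<in> N" for v
      proof -
        have "(\<lambda>x. \<phi>t x - b x) = (\<lambda>x. of_real t * (\<psi> x - \<phi> x) - (b x - \<phi> x))"
          by (auto simp: \<phi>t_def algebra_simps)
        then have "L2_inner M (\<lambda>x. \<phi>t x - b x) v = of_real t * L2_inner M e v - L2_inner M d v"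
          using L2_inner_diff[OF L2_cmult[OF dif] diffL NL[OF v], of "of_real t"]
          by (simp only: L2_inner_cmult e_inner[OF v] d_inner[OF v])
        also have "\<dots> = - L2_inner M g v"
          unfolding g_def L2_inner_diff[OF dL L2_cmult[OF eL] NL[OF v]] L2_inner_cmult by simp
        finally show ?thesis using L2_Cauchy_Schwarz[OF gL NL[OF v]] by simp
      qed
      then have "L2_norm M g \<in> W" unfolding W_def using \<phi>tB by auto
      then have "L2_norm M d \<le> L2_norm M g" using d_le d0_le by (meson order_trans)
      then have "(L2_norm M d)\<^sup>2 \<le> (L2_norm M g)\<^sup>2" by (rule power_mono) simp
      also have "\<dots> = (L2_norm M d)\<^sup>2 + t\<^sup>2 * (L2_norm M e)\<^sup>2 - 2 * (t * a)"
        unfolding g_def L2_norm_diff_power2[OF dL L2_cmult[OF eL]] L2_norm_cmult L2_inner_cmult_right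
        by (simp add: a_def power_mult_distrib)
      finally have "t * (2 * a) \<le> t * (t * (L2_norm M e)\<^sup>2)" by (simp add: power2_eq_square algebra_simps)
      then show ?thesis using t(1) by simp
    qed
    note le = this
    have "a \<le> 0"
    proof (rule ccontr)
      assume "\<not> a \<le> 0"
      define n where "n = (L2_norm M e)\<^sup>2"
      have n: "n \<ge> 0" by (simp add: n_def)
      define t where "t = min 1 (a / (n + 1))"
      have t: "0 < t" "t \<le> 1" using \<open>\<not> a \<le> 0\<close> n by (auto simp: t_def)
      have "2 * a \<le> t * n" using le[OF t] by (simp add: n_def)
      also have "t * n \<le> a / (n + 1) * n" using n by (intro mult_right_mono) (auto simp: t_def)
      also have "\<dots> \<le> a" using \<open>\<not> a \<le> 0\<close> n by (simp add: field_simps)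
      finally show False using \<open>\<not> a \<le> 0\<close> by simp
    qed
    moreover have "Re (L2_inner M e d) = a" unfolding a_def by (subst L2_inner_cnj[symmetric]) simp
    ultimately show ?thesis using e_inner[OF d] by simp
  qed
  have d_meas [measurable]: "d \<in> borel_measurable M" using dL by (rule L2_measurable)
  \<comment> \<open>\<open>C sgn d\<close>; at zeros of \<open>d\<close> the quotient is \<open>0 / 0 = 0\<close>\<close>
  define \<psi> where "\<psi> = (\<lambda>x. of_real C * (d x / of_real (cmod (d x))))"
  have \<psi>: "\<psi> \<in> B"
  proof -
    have "\<psi> \<in> borel_measurable M" unfolding \<psi>_def by measurable
    moreover have "cmod (\<psi> x) \<le> C" for x using C by (simp add: \<psi>_def norm_mult norm_divide)
    ultimately show ?thesis unfolding B_def by (auto intro!: bounded_L2[of _ C])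
  qed
  have "\<psi> x * cnj (d x) = of_real (C * cmod (d x))" for x
  proof (cases "d x = 0")
    case False
    have "\<psi> x * cnj (d x) = of_real C * (d x * cnj (d x)) / of_real (cmod (d x))" by (simp add: \<psi>_def)
    also have "d x * cnj (d x) = of_real (cmod (d x) * cmod (d x))"
      using complex_norm_square[of "d x"] by (simp add: power2_eq_square)
    finally show ?thesis using False by simp
  qed (simp add: \<psi>_def)
  then have "L2_inner M \<psi> d = of_real (C * (\<integral>x. cmod (d x) \<partial>M))"
    unfolding L2_inner_def by (simp only: integral_complex_of_real integral_mult_right_zero)
  then have 1: "C * (\<integral>x. cmod (d x) \<partial>M) \<le> Re (L2_inner M \<phi> d)"
    using variation[OF \<psi>] by (simp add: L2_inner_diff BL[OF \<psi>] \<phi>L dL)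
  have 2: "Re (L2_inner M b d) \<le> C * (\<integral>x. cmod (d x) \<partial>M)"
    using bound[OF d] complex_Re_le_cmod order_trans by blast
  have "(L2_norm M d)\<^sup>2 = Re (L2_inner M d d)" by (simp add: L2_inner_self)
  also have "\<dots> = Re (L2_inner M b d) - Re (L2_inner M \<phi> d)"
    using d_inner[OF d] by (simp add: L2_inner_diff b \<phi>L dL flip: d_inner[OF d])
  also have "\<dots> \<le> 0" using 1 2 by simp
  finally have d_0: "L2_norm M d = 0" by simp
  have "L2_inner M \<phi> v = L2_inner M b v" if v: "v \<in> N" for v
  proof -
    have "cmod (L2_inner M d v) \<le> 0" using L2_Cauchy_Schwarz[OF dL NL[OF v]] d_0 by simp
    then show ?thesis using d_inner[OF v] by (simp add: L2_inner_diff b \<phi>L NL v)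
  qed
  then show thesis using that[of \<phi>] \<phi> by (auto simp: B_def)
qed

end

context ordered_haar
begin

text \<open>
  Insert the factorization \<open>f = u v\<close> of a polynomial into the bilinear bound. The factors are not
  polynomials, so the bound has to be extended first. It extends to all \<open>v\<close> while \<open>u\<close> is a
  polynomial, since then \<open>b u\<close> is square-integrable, and afterwards to all \<open>u\<close> for bounded \<open>v\<close>. The
  factor \<open>v\<close> is bounded because \<open>\<bar>v\<bar>\<^sup>2 \<le> \<bar>f\<bar>\<close>.
\<close>

lemma Hankel_form_L1_bound:
  assumes b: "b \<in> L2 M" and C: "C \<ge> 0"
    and bd: "\<And>u v. u \<in> char_span Xp \<Longrightarrow> v \<in> char_span Xp0 \<Longrightarrow>
      cmod (\<integral>x. b x * (u x * v x) \<partial>M) \<le> C * L2_norm M u * L2_norm M v"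
    and f: "f \<in> spectral_space M Xp0"
  shows "cmod (\<integral>x. b x * f x \<partial>M) \<le> C * (\<integral>x. cmod (f x) \<partial>M)"
proof -
  have pL: "u \<in> L2 M" if "u \<in> char_span Xp" for u
    using char_span_spectral[OF that Xp_sub] by (rule spectral_space_L2)
  have p0L: "u \<in> L2 M" if "u \<in> char_span Xp0" for u
    using char_span_spectral[OF that Xp0_sub] by (rule spectral_space_L2)
  have 1: "cmod (\<integral>x. b x * (u x * v x) \<partial>M) \<le> C * L2_norm M u * L2_norm M v"
    if u: "u \<in> char_span Xp" and v: "v \<in> spectral_space M Xp0" for u v
  proof -
    obtain V where V: "\<And>n. V n \<in> char_span Xp0" "(\<lambda>n. L2_norm M (\<lambda>x. V n x - v x)) \<longlonglongrightarrow> 0"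
      using spectral_space_dense[OF Xp0_sub v] by blast
    have vL: "v \<in> L2 M" using v by (rule spectral_space_L2)
    have uc: "continuous_on UNIV u" using u Xp_sub by (rule char_span_continuous)
    obtain K where "\<And>x. cmod (u x) \<le> K" using continuous_bounded[OF compact_UNIV uc] by blast
    then have bu: "(\<lambda>x. u x * b x) \<in> L2 M"
      by (intro L2_bounded_mult[OF b, of _ K] continuous_measurable uc) auto
    show ?thesis
    proof (rule LIMSEQ_le)
      have "(\<lambda>n. \<integral>x. V n x * (u x * b x) \<partial>M) \<longlonglongrightarrow> (\<integral>x. v x * (u x * b x) \<partial>M)"
        by (rule L2_integral_mult_tendsto[OF p0L[OF V(1)] vL V(2) bu])
      then show "(\<lambda>n. cmod (\<integral>x. b x * (u x * V n x) \<partial>M)) \<longlonglongrightarrow> cmod (\<integral>x. b x * (u x * v x) \<partial>M)"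
        by (intro tendsto_norm) (simp add: mult_ac)
      show "(\<lambda>n. C * L2_norm M u * L2_norm M (V n)) \<longlonglongrightarrow> C * L2_norm M u * L2_norm M v"
        by (intro tendsto_intros L2_norm_tendsto p0L V vL)
    qed (use bd[OF u V(1)] in auto)
  qed
  have 2: "cmod (\<integral>x. b x * (u x * v x) \<partial>M) \<le> C * L2_norm M u * L2_norm M v"
    if u: "u \<in> spectral_space M Xp" and v: "v \<in> spectral_space M Xp0" "AE x in M. cmod (v x) \<le> K" for u v K
  proof -
    obtain U where U: "\<And>n. U n \<in> char_span Xp" "(\<lambda>n. L2_norm M (\<lambda>x. U n x - u x)) \<longlonglongrightarrow> 0"
      using spectral_space_dense[OF Xp_sub u] by blast
    have uL: "u \<in> L2 M" using u by (rule spectral_space_L2)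
    have bv: "(\<lambda>x. v x * b x) \<in> L2 M"
      using v spectral_space_L2[OF v(1)] by (intro L2_bounded_mult[OF b, of _ K]) (auto intro: L2_measurable)
    show ?thesis
    proof (rule LIMSEQ_le)
      have "(\<lambda>n. \<integral>x. U n x * (v x * b x) \<partial>M) \<longlonglongrightarrow> (\<integral>x. u x * (v x * b x) \<partial>M)"
        by (rule L2_integral_mult_tendsto[OF pL[OF U(1)] uL U(2) bv])
      then show "(\<lambda>n. cmod (\<integral>x. b x * (U n x * v x) \<partial>M)) \<longlonglongrightarrow> cmod (\<integral>x. b x * (u x * v x) \<partial>M)"
        by (intro tendsto_norm) (simp add: mult_ac)
      show "(\<lambda>n. C * L2_norm M (U n) * L2_norm M v) \<longlonglongrightarrow> C * L2_norm M u * L2_norm M v"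
        by (intro tendsto_intros L2_norm_tendsto pL U uL)
    qed (use 1[OF U(1) v(1)] in auto)
  qed
  have 3: "cmod (\<integral>x. b x * f x \<partial>M) \<le> C * (\<integral>x. cmod (f x) \<partial>M)" if f: "f \<in> char_span Xp0" for f
  proof (rule field_le_epsilon)
    fix \<delta> :: real assume "\<delta> > 0"
    define e where "e = \<delta> / (C + 1)"
    have "e > 0" using \<open>\<delta> > 0\<close> C by (simp add: e_def)
    define I where "I = (\<integral>x. cmod (f x) \<partial>M)"
    have "I \<ge> 0" by (simp add: I_def)
    have fc: "continuous_on UNIV f" using f Xp0_sub by (rule char_span_continuous)
    have fint: "integrable M (\<lambda>x. cmod (f x))" by (intro integrable_norm continuous_integrable fc)
    obtain u v where u: "u \<in> spectral_space M Xp" and v: "v \<in> spectral_space M Xp0"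
      and fuv: "AE x in M. f x = u x * v x" and u2: "AE x in M. (cmod (u x))\<^sup>2 = cmod (f x) + e"
      and v2: "AE x in M. (cmod (v x))\<^sup>2 \<le> cmod (f x)"
      using analytic_polynomial_factorization[OF f \<open>e > 0\<close>] by blast
    note uL = spectral_space_L2[OF u] and vL = spectral_space_L2[OF v]
    have [measurable]: "u \<in> borel_measurable M" "v \<in> borel_measurable M" "f \<in> borel_measurable M" "b \<in> borel_measurable M"
      using uL vL fc b by (auto intro: L2_measurable continuous_measurable)
    obtain K where K: "\<And>x. cmod (f x) \<le> K" using continuous_bounded[OF compact_UNIV fc] by blast
    have "AE x in M. cmod (v x) \<le> sqrt K"
      using v2 by eventually_elim (use K in \<open>metis real_le_rsqrt order_trans\<close>)
    from 2[OF u v this] have uv: "cmod (\<integral>x. b x * (u x * v x) \<partial>M) \<le> C * L2_norm M u * L2_norm M v" .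
    have u_norm: "L2_norm M u = sqrt (I + e)"
    proof -
      have "(\<integral>x. (cmod (u x))\<^sup>2 \<partial>M) = (\<integral>x. cmod (f x) + e \<partial>M)"
        by (rule integral_cong_AE) (use u2 in auto)
      also have "\<dots> = I + e" using fint prob_space by (simp add: I_def)
      finally show ?thesis by (simp add: L2_norm_def)
    qed
    have v_norm: "L2_norm M v \<le> sqrt (I + e)"
    proof -
      have "(\<integral>x. (cmod (v x))\<^sup>2 \<partial>M) \<le> I"
        unfolding I_def by (rule integral_mono_AE) (use v2 vL fint in \<open>auto simp: L2_def\<close>)
      then show ?thesis using \<open>e > 0\<close> by (simp add: L2_norm_def)
    qed
    have "(\<integral>x. b x * f x \<partial>M) = (\<integral>x. b x * (u x * v x) \<partial>M)"
      by (rule integral_cong_AE) (use fuv in auto)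
    then have "cmod (\<integral>x. b x * f x \<partial>M) \<le> C * sqrt (I + e) * L2_norm M v" using uv u_norm by simp
    also have "\<dots> \<le> C * sqrt (I + e) * sqrt (I + e)"
      using C \<open>I \<ge> 0\<close> \<open>e > 0\<close> by (intro mult_left_mono v_norm) auto
    also have "\<dots> = C * I + C * e" using \<open>I \<ge> 0\<close> \<open>e > 0\<close> by (simp add: algebra_simps)
    also have "C * e \<le> \<delta>" using \<open>\<delta> > 0\<close> C by (simp add: e_def field_simps)
    finally show "cmod (\<integral>x. b x * f x \<partial>M) \<le> C * (\<integral>x. cmod (f x) \<partial>M) + \<delta>"
      by (simp add: I_def)
  qed
  obtain F where F: "\<And>n. F n \<in> char_span Xp0" "(\<lambda>n. L2_norm M (\<lambda>x. F n x - f x)) \<longlonglongrightarrow> 0"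
    using spectral_space_dense[OF Xp0_sub f] by blast
  have fL: "f \<in> L2 M" using f by (rule spectral_space_L2)
  show ?thesis
  proof (rule LIMSEQ_le)
    have "(\<lambda>n. \<integral>x. F n x * b x \<partial>M) \<longlonglongrightarrow> (\<integral>x. f x * b x \<partial>M)"
      by (rule L2_integral_mult_tendsto[OF p0L[OF F(1)] fL F(2) b])
    then show "(\<lambda>n. cmod (\<integral>x. b x * F n x \<partial>M)) \<longlonglongrightarrow> cmod (\<integral>x. b x * f x \<partial>M)"
      by (intro tendsto_norm) (simp add: mult.commute)
    have "(\<lambda>n. (\<integral>x. cmod (F n x) \<partial>M) - (\<integral>x. cmod (f x) \<partial>M)) \<longlonglongrightarrow> 0"
    proof (rule Lim_null_comparison[OF _ F(2)], rule always_eventually, rule allI)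
      fix n
      have i: "integrable M (F n)" "integrable M f" using p0L[OF F(1)] fL by (auto intro: L2_integrable)
      have "norm ((\<integral>x. cmod (F n x) \<partial>M) - (\<integral>x. cmod (f x) \<partial>M)) = norm (\<integral>x. cmod (F n x) - cmod (f x) \<partial>M)"
        using i by simp
      also have "\<dots> \<le> (\<integral>x. norm (cmod (F n x) - cmod (f x)) \<partial>M)" by (rule integral_norm_bound)
      also have "\<dots> \<le> (\<integral>x. cmod (F n x - f x) \<partial>M)"
        by (rule integral_mono) (use i in \<open>auto simp: norm_triangle_ineq3\<close>)
      also have "\<dots> \<le> L2_norm M (\<lambda>x. F n x - f x)" by (intro L1_le_L2 L2_diff p0L F fL)
      finally show "norm ((\<integral>x. cmod (F n x) \<partial>M) - (\<integral>x. cmod (f x) \<partial>M)) \<le> L2_norm M (\<lambda>x. F n x - f x)" .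
    qed
    then show "(\<lambda>n. C * (\<integral>x. cmod (F n x) \<partial>M)) \<longlonglongrightarrow> C * (\<integral>x. cmod (f x) \<partial>M)"
      by (intro tendsto_mult_left) (rule LIM_zero_cancel)
  qed (use 3[OF F(1)] in auto)
qed

theorem Nehari:
  assumes b: "b \<in> L2 M" and C: "C \<ge> 0"
    and bd: "\<And>u v. u \<in> char_span Xp \<Longrightarrow> v \<in> char_span Xp0 \<Longrightarrow>
      cmod (\<integral>x. b x * (u x * v x) \<partial>M) \<le> C * L2_norm M u * L2_norm M v"
  obtains \<phi> where "\<phi> \<in> L2 M" "AE x in M. cmod (\<phi> x) \<le> C"
    "\<And>\<gamma>. \<gamma> \<in> Xm \<Longrightarrow> fourier M \<phi> \<gamma> = fourier M b \<gamma>"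
proof -
  have "cmod (L2_inner M b d) \<le> C * (\<integral>x. cmod (d x) \<partial>M)" if "d \<in> spectral_space M Xm" for d
    using Hankel_form_L1_bound[OF b C bd fcnj_spectral_Xm[OF that]] by (simp add: L2_inner_def fcnj_def)
  then obtain \<phi> where "\<phi> \<in> L2 M" "AE x in M. cmod (\<phi> x) \<le> C"
    "\<And>d. d \<in> spectral_space M Xm \<Longrightarrow> L2_inner M \<phi> d = L2_inner M b d"
    using L1_bounded_functional_representation[OF spectral_space_subspace b C] by blast
  then show thesis
    using that spectral_space_char[OF Xm_dual] by (simp add: fourier_eq_inner)
qed

end

section \<open>Homomorphisms of the dual are evaluations\<close>

text \<open>
  \<open>twisted m p q\<close> relates a trigonometric polynomial \<open>p\<close> to the one in which every character
  \<open>\<gamma>\<close> has been multiplied by \<open>m \<gamma>\<close>. If \<open>m\<close> is evaluation at \<open>g\<close>, then \<open>q\<close> is the translate of \<open>p\<close>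
  by \<open>g\<close>.
\<close>

inductive twisted :: "(('g::topological_ab_group_add \<Rightarrow> complex) \<Rightarrow> complex) \<Rightarrow> ('g \<Rightarrow> complex) \<Rightarrow> ('g \<Rightarrow> complex) \<Rightarrow> bool"
  for m where
  char: "\<gamma> \<in> dual \<Longrightarrow> twisted m (\<lambda>x. c * \<gamma> x) (\<lambda>x. c * m \<gamma> * \<gamma> x)"
| add: "twisted m p p' \<Longrightarrow> twisted m q q' \<Longrightarrow> twisted m (\<lambda>x. p x + q x) (\<lambda>x. p' x + q' x)"

lemma twisted_continuous:
  assumes "twisted m p p'"
  shows "continuous_on UNIV p \<and> continuous_on UNIV p'"
  using assms
proof induction
  case (char \<gamma> c)
  show ?case by (intro conjI continuous_on_mult continuous_on_const dual_cont char)
qed (auto intro: continuous_on_add)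

lemma twisted_mult:
  assumes hom: "\<And>\<gamma> \<psi>. \<gamma> \<in> dual \<Longrightarrow> \<psi> \<in> dual \<Longrightarrow> m (\<gamma> \<cdot>\<^sub>f \<psi>) = m \<gamma> * m \<psi>"
    and "twisted m p p'" "twisted m q q'"
  shows "twisted m (\<lambda>x. p x * q x) (\<lambda>x. p' x * q' x)"
  using assms(2)
proof induction
  case (char \<gamma> c)
  from assms(3) show ?case
  proof induction
    case (char \<psi> d)
    have "twisted m (\<lambda>x. (c * d) * (\<gamma> \<cdot>\<^sub>f \<psi>) x) (\<lambda>x. (c * d) * m (\<gamma> \<cdot>\<^sub>f \<psi>) * (\<gamma> \<cdot>\<^sub>f \<psi>) x)"
      by (intro twisted.char dual_fmult char \<open>\<gamma> \<in> dual\<close>)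
    then show ?case unfolding hom[OF \<open>\<gamma> \<in> dual\<close> char] by (simp add: fmult_def mult_ac)
  next
    case (add p p' q q')
    from twisted.add[OF add.IH] show ?case by (simp add: distrib_left)
  qed
next
  case (add p p' q q')
  from twisted.add[OF add.IH] show ?case by (simp add: distrib_right)
qed

context compact_haar
begin

text \<open>
  The integral of a trigonometric polynomial is its coefficient at the unit character, where \<open>m\<close> is \<open>1\<close>.
\<close>

lemma twisted_integral:
  assumes one: "m unit_char = 1" and "twisted m p p'"
  shows "(\<integral>x. p x \<partial>M) = (\<integral>x. p' x \<partial>M)"
  using assms(2)
proof induction
  case (char \<gamma> c)
  then show ?case using one by (simp add: integral_dual)
next
  case (add p p' q q')
  then show ?case
    using twisted_continuous[OF add.hyps(1)] twisted_continuous[OF add.hyps(2)]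
    by (simp add: continuous_integrable)
qed

text \<open>
  The moments of \<open>q = \<Sum>\<gamma>\<in>F. 2 + 2 Re (m(\<gamma>)\<^sup>* \<gamma>)\<close> agree with those of \<open>\<Sum>\<gamma>\<in>F. 2 + 2 Re \<gamma>\<close>, since
  the second function is the twist of the first, and powers are compatible with twisting. Both functions are
  nonnegative and continuous, so their maxima agree too. The second has the value \<open>4\<close> per summand at \<open>0\<close>,
  and where \<open>q\<close> attains this, every summand is maximal, that is, \<open>m(\<gamma>)\<^sup>* \<gamma> = 1\<close>.
\<close>

lemma dual_hom_point_finite:
  fixes m :: "('g \<Rightarrow> complex) \<Rightarrow> complex"
  assumes hom: "\<And>\<gamma> \<psi>. \<gamma> \<in> dual \<Longrightarrow> \<psi> \<in> dual \<Longrightarrow> m (\<gamma> \<cdot>\<^sub>f \<psi>) = m \<gamma> * m \<psi>"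
    and norm: "\<And>\<gamma>. \<gamma> \<in> dual \<Longrightarrow> cmod (m \<gamma>) = 1"
    and F: "finite F" "F \<subseteq> dual"
  shows "\<exists>g. \<forall>\<gamma>\<in>F. \<gamma> g = m \<gamma>"
proof -
  have cm: "cnj (m \<gamma>) * m \<gamma> = 1" if "\<gamma> \<in> dual" for \<gamma>
    using complex_norm_square[of "m \<gamma>"] norm[OF that] by (simp add: mult.commute)
  have "unit_char \<cdot>\<^sub>f unit_char = (unit_char :: 'g \<Rightarrow> complex)" by (simp add: fmult_def unit_char_def)
  then have "m unit_char = m unit_char * m unit_char" using hom[OF dual_unit_char dual_unit_char] by simp
  moreover have "m unit_char \<noteq> 0" using norm[OF dual_unit_char] by auto
  ultimately have one: "m unit_char = 1" by simp
  have inv: "m \<gamma> * m (fcnj \<gamma>) = 1" if "\<gamma> \<in> dual" for \<gamma>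
  proof -
    have "\<gamma> \<cdot>\<^sub>f fcnj \<gamma> = unit_char"
      using dual_cnj_mult[OF that] by (simp add: fmult_def fcnj_def unit_char_def mult.commute)
    then show ?thesis using hom[OF that dual_fcnj[OF that]] one by simp
  qed
  have const: "twisted m (\<lambda>x. c) (\<lambda>x. c)" for c
    using twisted.char[OF dual_unit_char, of m c] unfolding one by (simp add: unit_char_def)
  define q where "q x = (\<Sum>\<gamma>\<in>F. 2 + 2 * Re (cnj (m \<gamma>) * \<gamma> x))" for x
  define q' where "q' x = (\<Sum>\<gamma>\<in>F. 2 + 2 * Re (\<gamma> x))" for x
  have "twisted m (\<lambda>x. \<Sum>\<gamma>\<in>F. 2 + (cnj (m \<gamma>) * \<gamma> x + m \<gamma> * fcnj \<gamma> x)) (\<lambda>x. \<Sum>\<gamma>\<in>F. 2 + (\<gamma> x + fcnj \<gamma> x))"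
    using F
  proof (induction F)
    case (insert \<gamma> F)
    then have \<gamma>: "\<gamma> \<in> dual" by simp
    have A: "twisted m (\<lambda>x. cnj (m \<gamma>) * \<gamma> x) (\<lambda>x. \<gamma> x)"
      using twisted.char[OF \<gamma>, of m "cnj (m \<gamma>)"] cm[OF \<gamma>] by simp
    have B: "twisted m (\<lambda>x. m \<gamma> * fcnj \<gamma> x) (\<lambda>x. fcnj \<gamma> x)"
      using twisted.char[OF dual_fcnj[OF \<gamma>], of m "m \<gamma>"] inv[OF \<gamma>] by simp
    have "F \<subseteq> dual" using insert by simp
    from twisted.add[OF twisted.add[OF const[of 2] twisted.add[OF A B]] insert.IH[OF this]]
    show ?case unfolding sum.insert[OF insert.hyps(1,2)] .
  qed (use const[of 0] in simp)
  moreover have "2 + (cnj (m \<gamma>) * \<gamma> x + m \<gamma> * fcnj \<gamma> x) = of_real (2 + 2 * Re (cnj (m \<gamma>) * \<gamma> x))" for \<gamma> x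
    using complex_add_cnj[of "cnj (m \<gamma>) * \<gamma> x"] by (simp add: fcnj_def)
  moreover have "2 + (\<gamma> x + fcnj \<gamma> x) = of_real (2 + 2 * Re (\<gamma> x))" for \<gamma> and x :: 'g
    using complex_add_cnj[of "\<gamma> x"] by (simp add: fcnj_def)
  ultimately have tw: "twisted m (\<lambda>x. of_real (q x)) (\<lambda>x. of_real (q' x))"
    unfolding q_def q'_def of_real_sum by (simp only:)
  have pow: "twisted m (\<lambda>x. of_real (q x ^ n)) (\<lambda>x. of_real (q' x ^ n))" for n
  proof (induction n)
    case (Suc n)
    from twisted_mult[OF hom tw Suc] show ?case by simp
  qed (use const[of 1] in simp)
  have "(\<integral>x. complex_of_real (q x ^ n) \<partial>M) = (\<integral>x. complex_of_real (q' x ^ n) \<partial>M)" for n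
    by (rule twisted_integral[of m, OF one pow])
  then have moments: "(\<integral>x. q x ^ n \<partial>M) = (\<integral>x. q' x ^ n \<partial>M)" for n
    by (metis integral_complex_of_real of_real_eq_iff)
  have contF: "continuous_on UNIV \<gamma>" if "\<gamma> \<in> F" for \<gamma> using that F by (auto intro: dual_cont)
  have q_cont: "continuous_on UNIV q" and q'_cont: "continuous_on UNIV q'"
    unfolding q_def q'_def by (auto intro!: continuous_intros contF)
  have Re_le: "\<bar>Re (cnj (m \<gamma>) * \<gamma> x)\<bar> \<le> 1" if "\<gamma> \<in> F" for \<gamma> x
  proof -
    have "cmod (cnj (m \<gamma>) * \<gamma> x) = 1" using that F norm[of \<gamma>] dual_norm[of \<gamma>] by (auto simp: norm_mult)
    then show ?thesis using abs_Re_le_cmod[of "cnj (m \<gamma>) * \<gamma> x"] by linarith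
  qed
  have q_nonneg: "q x \<ge> 0" for x
    unfolding q_def using Re_le[of _ x] by (intro sum_nonneg) (smt (verit))
  have q'_nonneg: "q' x \<ge> 0" for x
    unfolding q'_def
  proof (rule sum_nonneg)
    fix \<gamma> assume "\<gamma> \<in> F"
    then have "cmod (\<gamma> x) = 1" using F dual_norm by blast
    then show "0 \<le> 2 + 2 * Re (\<gamma> x)" using abs_Re_le_cmod[of "\<gamma> x"] by linarith
  qed
  define N where "N = 4 * real (card F)"
  have q'_0: "q' 0 = N" using F by (simp add: q'_def N_def subset_iff dual_0)
  obtain g where g: "\<And>x. q x \<le> q g"
    using continuous_attains_sup[OF compact_UNIV _ q_cont] by auto
  have "N \<le> q g"
  proof (rule ccontr)
    assume "\<not> N \<le> q g"
    define a where "a = q g"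
    define b where "b = (a + N) / 2"
    have ab: "0 \<le> a" "a < b" "b < N" using \<open>\<not> N \<le> q g\<close> q_nonneg[of g] by (auto simp: a_def b_def)
    define U where "U = {x. b < q' x}"
    have U: "open U" "0 \<in> U"
      unfolding U_def using q'_0 ab by (auto intro!: open_Collect_less continuous_intros q'_cont)
    then have "measure M U > 0" by (intro open_measure_pos) auto
    have pow_int: "integrable M (\<lambda>x. h x ^ n)" if "continuous_on UNIV h" for h :: "'g \<Rightarrow> real" and n
    proof -
      have "continuous_on UNIV (\<lambda>x. complex_of_real (h x ^ n))" by (intro continuous_intros that)
      then have "integrable M (\<lambda>x. Re (of_real (h x ^ n)))" by (intro integrable_Re continuous_integrable)
      then show ?thesis by simp
    qed
    have le: "b ^ n * measure M U \<le> a ^ n" for n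
    proof -
      have "b ^ n * measure M U = (\<integral>x. b ^ n * indicator U x \<partial>M)" using U by simp
      also have "\<dots> \<le> (\<integral>x. q' x ^ n \<partial>M)"
      proof (rule integral_mono)
        show "integrable M (\<lambda>x. b ^ n * indicator U x)"
          using U by (intro integrable_mult_right integrable_real_indicator) (auto simp: emeasure_eq_measure)
        show "b ^ n * indicator U x \<le> q' x ^ n" for x
          using ab q'_nonneg[of x] by (auto simp: U_def indicator_def intro!: power_mono)
      qed (rule pow_int[OF q'_cont])
      also have "\<dots> = (\<integral>x. q x ^ n \<partial>M)" by (rule moments[symmetric])
      also have "\<dots> \<le> (\<integral>x. a ^ n \<partial>M)"
        by (rule integral_mono[OF pow_int[OF q_cont]])
           (use g q_nonneg in \<open>auto simp: a_def intro!: power_mono\<close>)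
      also have "\<dots> = a ^ n" using prob_space by simp
      finally show ?thesis .
    qed
    obtain n where "(a / b) ^ n < measure M U"
      using real_arch_pow_inv[OF \<open>measure M U > 0\<close>, of "a / b"] ab by auto
    then have "a ^ n < b ^ n * measure M U"
      using ab by (simp add: power_divide divide_less_eq mult.commute)
    then show False using le[of n] by linarith
  qed
  then have "(\<Sum>\<gamma>\<in>F. 2 - 2 * Re (cnj (m \<gamma>) * \<gamma> g)) \<le> 0"
    by (simp add: q_def N_def sum.distrib sum_subtractf)
  moreover have nn: "0 \<le> 2 - 2 * Re (cnj (m \<gamma>) * \<gamma> g)" if "\<gamma> \<in> F" for \<gamma>
    using Re_le[OF that, of g] by linarith
  ultimately have sum_0: "(\<Sum>\<gamma>\<in>F. 2 - 2 * Re (cnj (m \<gamma>) * \<gamma> g)) = 0"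
    by (intro antisym sum_nonneg)
  have "(\<Sum>\<gamma>\<in>F. 2 - 2 * Re (cnj (m \<gamma>) * \<gamma> g)) = 0 \<longleftrightarrow> (\<forall>\<gamma>\<in>F. 2 - 2 * Re (cnj (m \<gamma>) * \<gamma> g) = 0)"
    by (rule sum_nonneg_eq_0_iff[OF F(1) nn])
  from this sum_0 have all: "\<forall>\<gamma>\<in>F. 2 - 2 * Re (cnj (m \<gamma>) * \<gamma> g) = 0" by (rule iffD1)
  have "\<gamma> g = m \<gamma>" if "\<gamma> \<in> F" for \<gamma>
  proof -
    have \<gamma>: "\<gamma> \<in> dual" using that F by blast
    define z where "z = cnj (m \<gamma>) * \<gamma> g"
    have "Re z = 1" using all that by (auto simp: z_def)
    moreover have "(Re z)\<^sup>2 + (Im z)\<^sup>2 = 1"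
      using norm[OF \<gamma>] dual_norm[OF \<gamma>, of g] cmod_power2[of z] by (simp add: z_def norm_mult)
    ultimately have "z = 1" by (simp add: complex_eq_iff)
    then have 1: "m \<gamma> * (cnj (m \<gamma>) * \<gamma> g) = m \<gamma>" by (simp add: z_def)
    have "\<gamma> g = (cnj (m \<gamma>) * m \<gamma>) * \<gamma> g" using cm[OF \<gamma>] by simp
    also have "\<dots> = m \<gamma> * (cnj (m \<gamma>) * \<gamma> g)" by (simp only: mult_ac)
    finally show ?thesis using 1 by simp
  qed
  then show ?thesis by blast
qed

text \<open>
  The closed sets of points where a single character agrees with \<open>m\<close> have the finite intersection property.
\<close>

theorem dual_hom_point:
  fixes m :: "('g \<Rightarrow> complex) \<Rightarrow> complex"
  assumes hom: "\<And>\<gamma> \<psi>. \<gamma> \<in> dual \<Longrightarrow> \<psi> \<in> dual \<Longrightarrow> m (\<gamma> \<cdot>\<^sub>f \<psi>) = m \<gamma> * m \<psi>"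
    and norm: "\<And>\<gamma>. \<gamma> \<in> dual \<Longrightarrow> cmod (m \<gamma>) = 1"
  obtains g where "\<And>\<gamma>. \<gamma> \<in> dual \<Longrightarrow> \<gamma> g = m \<gamma>"
proof -
  define K where "K \<gamma> = {g. \<gamma> g = m \<gamma>}" for \<gamma>
  have "UNIV \<inter> \<Inter> (K ` dual) \<noteq> {}"
  proof (rule compact_imp_fip[OF compact_UNIV])
    show "closed T" if "T \<in> K ` dual" for T
      using that by (auto simp: K_def intro!: closed_Collect_eq continuous_intros dual_cont)
    fix \<F> assume "finite \<F>" "\<F> \<subseteq> K ` dual"
    then obtain F where F: "finite F" "F \<subseteq> dual" "\<F> = K ` F" by (meson finite_subset_image)
    obtain g where "\<forall>\<gamma>\<in>F. \<gamma> g = m \<gamma>" using dual_hom_point_finite[OF hom norm F(1,2)] by blast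
    then show "UNIV \<inter> \<Inter> \<F> \<noteq> {}" unfolding F(3) K_def by blast
  qed
  then show thesis using that by (auto simp: K_def)
qed

end

context ordered_haar
begin

text \<open>
  Every character is a quotient of two elements of \<open>X\<^sub>+\<close>, so a unimodular semi-character extends to a
  homomorphism of the dual.
\<close>

lemma semicharacter_point:
  assumes \<mu>: "generalized_semicharacter r \<mu>" and norm: "\<forall>\<gamma>\<in>Xp. cmod (\<mu> \<gamma>) = 1"
  obtains g where "\<And>\<gamma>. \<gamma> \<in> Xp \<Longrightarrow> \<gamma> g = \<mu> \<gamma>"
proof -
  have hom: "\<mu> (\<gamma> \<cdot>\<^sub>f \<psi>) = \<mu> \<gamma> * \<mu> \<psi>" if "\<gamma> \<in> Xp" "\<psi> \<in> Xp" for \<gamma> \<psi>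
    using \<mu> that by (simp add: generalized_semicharacter_def)
  have cm: "cnj (\<mu> \<gamma>) * \<mu> \<gamma> = 1" if "\<gamma> \<in> Xp" for \<gamma>
    using complex_norm_square[of "\<mu> \<gamma>"] norm that by (simp add: mult.commute)
  have one: "\<mu> unit_char = 1"
  proof -
    have "\<mu> unit_char = \<mu> unit_char * \<mu> unit_char" using hom[OF unit_Xp unit_Xp] by simp
    moreover have "\<mu> unit_char \<noteq> 0" using norm unit_Xp by force
    ultimately show ?thesis by simp
  qed
  define m where "m \<gamma> = (if \<gamma> \<in> Xp then \<mu> \<gamma> else cnj (\<mu> (fcnj \<gamma>)))" for \<gamma>
  have quot: "m (\<alpha> \<cdot>\<^sub>f fcnj \<beta>) = \<mu> \<alpha> * cnj (\<mu> \<beta>)" if "\<alpha> \<in> Xp" "\<beta> \<in> Xp" for \<alpha> \<beta>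
  proof -
    have d: "\<alpha> \<in> dual" "\<beta> \<in> dual" using that by (auto simp: X_plus_def)
    define \<gamma> where "\<gamma> = \<alpha> \<cdot>\<^sub>f fcnj \<beta>"
    have \<gamma>: "\<gamma> \<in> dual" unfolding \<gamma>_def by (intro dual_fmult dual_fcnj d)
    have 1: "\<gamma> \<cdot>\<^sub>f \<beta> = \<alpha>" "fcnj \<gamma> \<cdot>\<^sub>f \<alpha> = \<beta>"
      using dual_cnj_mult[OF d(1)] dual_cnj_mult[OF d(2)]
      by (auto simp: \<gamma>_def fmult_def fcnj_def mult_ac intro!: ext)
    show ?thesis
    proof (cases "\<gamma> \<in> Xp")
      case True
      have e: "\<mu> \<alpha> = \<mu> \<gamma> * \<mu> \<beta>" using hom[OF True that(2)] 1 by simp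
      have "\<mu> \<alpha> * cnj (\<mu> \<beta>) = \<mu> \<gamma> * (cnj (\<mu> \<beta>) * \<mu> \<beta>)" unfolding e by (simp only: mult_ac)
      then show ?thesis using True cm[OF that(2)] by (simp add: m_def \<gamma>_def)
    next
      case False
      then have c: "fcnj \<gamma> \<in> Xp" using Xp_or_fcnj[OF \<gamma>] by blast
      then have "\<mu> (fcnj \<gamma>) * \<mu> \<alpha> = \<mu> \<beta>" using hom[OF c that(1)] 1 by simp
      then have e: "cnj (\<mu> \<beta>) = cnj (\<mu> (fcnj \<gamma>)) * cnj (\<mu> \<alpha>)" by (metis complex_cnj_mult)
      have "\<mu> \<alpha> * cnj (\<mu> \<beta>) = cnj (\<mu> (fcnj \<gamma>)) * (cnj (\<mu> \<alpha>) * \<mu> \<alpha>)"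
        unfolding e by (simp only: mult_ac)
      then show ?thesis using False cm[OF that(1)] by (simp add: m_def \<gamma>_def)
    qed
  qed
  have rep: "\<exists>\<alpha>\<in>Xp. \<exists>\<beta>\<in>Xp. \<gamma> = \<alpha> \<cdot>\<^sub>f fcnj \<beta>" if "\<gamma> \<in> dual" for \<gamma>
  proof (cases "\<gamma> \<in> Xp")
    case True
    have "\<gamma> = \<gamma> \<cdot>\<^sub>f fcnj unit_char" by (simp add: fmult_def fcnj_def unit_char_def)
    then show ?thesis using True unit_Xp by blast
  next
    case False
    then have "fcnj \<gamma> \<in> Xp" using Xp_or_fcnj[OF that] by blast
    moreover have "\<gamma> = unit_char \<cdot>\<^sub>f fcnj (fcnj \<gamma>)" by simp
    ultimately show ?thesis using unit_Xp by blast
  qed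
  have "m (\<gamma> \<cdot>\<^sub>f \<psi>) = m \<gamma> * m \<psi>" if "\<gamma> \<in> dual" "\<psi> \<in> dual" for \<gamma> \<psi>
  proof -
    obtain \<alpha> \<beta> where 1: "\<alpha> \<in> Xp" "\<beta> \<in> Xp" "\<gamma> = \<alpha> \<cdot>\<^sub>f fcnj \<beta>" using rep[OF \<open>\<gamma> \<in> dual\<close>] by blast
    obtain \<alpha>' \<beta>' where 2: "\<alpha>' \<in> Xp" "\<beta>' \<in> Xp" "\<psi> = \<alpha>' \<cdot>\<^sub>f fcnj \<beta>'" using rep[OF \<open>\<psi> \<in> dual\<close>] by blast
    have "\<gamma> \<cdot>\<^sub>f \<psi> = (\<alpha> \<cdot>\<^sub>f \<alpha>') \<cdot>\<^sub>f fcnj (\<beta> \<cdot>\<^sub>f \<beta>')" unfolding 1 2 by (simp add: fmult_def fcnj_def mult_ac)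
    then show ?thesis
      using quot[OF Xp_fmult[OF 1(1) 2(1)] Xp_fmult[OF 1(2) 2(2)]] quot[OF 1(1,2)] quot[OF 2(1,2)] 1 2
      by (simp add: hom mult_ac)
  qed
  moreover have "cmod (m \<gamma>) = 1" if "\<gamma> \<in> dual" for \<gamma>
    using norm Xp_or_fcnj[OF that] by (auto simp: m_def)
  ultimately obtain g where g: "\<And>\<gamma>. \<gamma> \<in> dual \<Longrightarrow> \<gamma> g = m \<gamma>" using dual_hom_point by blast
  have "\<gamma> g = \<mu> \<gamma>" if "\<gamma> \<in> Xp" for \<gamma> using g[OF Xp_dual[OF that]] that by (simp add: m_def)
  then show thesis using that by blast
qed

end

section \<open>Bounded \<open>\<mu>\<close>-Hankel operators\<close>

context ordered_haar
begin

lemma L_infty_AE: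
  assumes "\<phi> \<in> L_infty M"
  shows "\<phi> \<in> borel_measurable M" "AE x in M. cmod (\<phi> x) \<le> L_infty_norm M \<phi>" "0 \<le> L_infty_norm M \<phi>"
proof -
  define s where "s = esssup M (\<lambda>x. ereal (cmod (\<phi> x)))"
  have AE: "AE x in M. ereal (cmod (\<phi> x)) \<le> s" unfolding s_def by (rule esssup_AE)
  have "0 \<le> s"
  proof (rule ccontr)
    assume "\<not> 0 \<le> s"
    have "AE x in M. False"
      using AE
    proof eventually_elim
      case (elim x)
      have "0 \<le> ereal (cmod (\<phi> x))" by simp
      with elim \<open>\<not> 0 \<le> s\<close> show False by (meson order_trans)
    qed
    then show False by simp
  qed
  moreover have "s < \<infinity>" using assms by (simp add: L_infty_def s_def)
  ultimately have s: "s = ereal (L_infty_norm M \<phi>)" "0 \<le> L_infty_norm M \<phi>"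
    unfolding L_infty_norm_def s_def[symmetric] by (cases s; simp)+
  show "\<phi> \<in> borel_measurable M" using assms by (simp add: L_infty_def)
  show "AE x in M. cmod (\<phi> x) \<le> L_infty_norm M \<phi>" using AE by (simp add: s(1))
  show "0 \<le> L_infty_norm M \<phi>" by (rule s(2))
qed

lemma L_infty_bounded:
  assumes "\<phi> \<in> borel_measurable M" "AE x in M. cmod (\<phi> x) \<le> C"
  shows "\<phi> \<in> L_infty M" "L_infty_norm M \<phi> \<le> C"
proof -
  have le: "esssup M (\<lambda>x. ereal (cmod (\<phi> x))) \<le> ereal C"
    using assms by (intro esssup_I) auto
  then have "esssup M (\<lambda>x. ereal (cmod (\<phi> x))) < \<infinity>" by auto
  then show \<phi>: "\<phi> \<in> L_infty M" using assms by (simp add: L_infty_def)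
  have "AE x in M. 0 \<le> C" using assms(2) by eventually_elim (meson norm_ge_zero order_trans)
  then have "0 \<le> C" by simp
  then show "L_infty_norm M \<phi> \<le> C"
    using le unfolding L_infty_norm_def
    by (cases "esssup M (\<lambda>x. ereal (cmod (\<phi> x)))") auto
qed

lemma L_infty_L2: "\<phi> \<in> L_infty M \<Longrightarrow> \<phi> \<in> L2 M"
  using L_infty_AE by (blast intro: bounded_L2)

lemma L_infty_diff:
  assumes "\<phi> \<in> L_infty M" "\<psi> \<in> L_infty M"
  shows "(\<lambda>x. \<phi> x - \<psi> x) \<in> L_infty M"
proof (rule L_infty_bounded(1))
  have [measurable]: "\<phi> \<in> borel_measurable M" "\<psi> \<in> borel_measurable M" using assms L_infty_AE by blast+
  show "(\<lambda>x. \<phi> x - \<psi> x) \<in> borel_measurable M" by measurable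
  show "AE x in M. cmod (\<phi> x - \<psi> x) \<le> L_infty_norm M \<phi> + L_infty_norm M \<psi>"
    using L_infty_AE(2)[OF assms(1)] L_infty_AE(2)[OF assms(2)]
    by eventually_elim (meson add_mono norm_triangle_ineq4 order_trans)
qed

lemma L_infty_mult_L2:
  assumes "\<phi> \<in> L_infty M" "f \<in> L2 M"
  shows "\<phi> \<cdot>\<^sub>f f \<in> L2 M" "L2_norm M (\<phi> \<cdot>\<^sub>f f) \<le> L_infty_norm M \<phi> * L2_norm M f"
proof -
  note \<phi> = L_infty_AE[OF assms(1)]
  show *: "\<phi> \<cdot>\<^sub>f f \<in> L2 M"
    unfolding fmult_def by (rule L2_bounded_mult[OF assms(2) \<phi>(1,2)])
  show "L2_norm M (\<phi> \<cdot>\<^sub>f f) \<le> L_infty_norm M \<phi> * L2_norm M f"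
    by (rule L2_norm_mono[OF assms(2) L2_measurable[OF *] _ \<phi>(3)])
       (use \<phi>(2) in eventually_elim, auto simp: fmult_def norm_mult intro: mult_right_mono)
qed

lemma Hankel_spec:
  assumes "\<phi> \<in> L_infty M" "f \<in> L2 M"
  shows "Hankel M r \<phi> f \<in> spectral_space M Xm"
    and "v \<in> spectral_space M Xm \<Longrightarrow> L2_inner M (Hankel M r \<phi> f) v = L2_inner M (\<phi> \<cdot>\<^sub>f f) v"
proof -
  note \<phi>f = L_infty_mult_L2(1)[OF assms]
  define p where "p = Hankel M r \<phi> f"
  have "\<exists>p\<in>spectral_space M Xm. \<forall>h\<in>spectral_space M Xm. L2_inner M (\<lambda>x. (\<phi> \<cdot>\<^sub>f f) x - p x) h = 0"
    by (rule L2_projection[OF prob_M spectral_space_subspace \<phi>f])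
  then have "\<exists>p. p \<in> spectral_space M Xm \<and> (\<forall>h\<in>spectral_space M Xm. L2_inner M (\<lambda>x. (\<phi> \<cdot>\<^sub>f f) x - p x) h = 0)"
    by blast
  from someI_ex[OF this]
  have p: "p \<in> spectral_space M Xm" "\<And>h. h \<in> spectral_space M Xm \<Longrightarrow> L2_inner M (\<lambda>x. (\<phi> \<cdot>\<^sub>f f) x - p x) h = 0"
    unfolding p_def Hankel_def P_minus_def orth_proj_def H2_minus_eq by blast+
  show "Hankel M r \<phi> f \<in> spectral_space M Xm" using p(1) by (simp add: p_def)
  assume v: "v \<in> spectral_space M Xm"
  show "L2_inner M (Hankel M r \<phi> f) v = L2_inner M (\<phi> \<cdot>\<^sub>f f) v"
    using p(2)[OF v] L2_inner_diff[OF \<phi>f spectral_space_L2[OF p(1)] spectral_space_L2[OF v]]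
    by (simp add: p_def)
qed

text \<open>
  Multiplication by \<open>\<psi>\<close> maps \<open>X\<^sub>+\<close> into \<open>H\<^sup>2\<close>, hence also its closed span.
\<close>

lemma H_infty_mult_orthogonal:
  assumes \<psi>: "\<psi> \<in> H_infty M r" and f: "f \<in> spectral_space M Xp" and v: "v \<in> spectral_space M Xm"
  shows "L2_inner M (\<psi> \<cdot>\<^sub>f f) v = 0"
proof -
  have \<psi>i: "\<psi> \<in> L_infty M" using \<psi> by (simp add: H_infty_def)
  have \<psi>s: "\<psi> \<in> spectral_space M Xp"
    using \<psi> L_infty_L2[OF \<psi>i] by (auto simp: H_infty_def spectral_space_def X_minus_def)
  note vL = spectral_space_L2[OF v] and fL = spectral_space_L2[OF f]
  have w: "(\<lambda>x. \<psi> x * cnj (v x)) \<in> L2 M"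
    using L_infty_mult_L2(1)[OF \<psi>i L2_cnj[OF vL]] by (simp add: fmult_def)
  have orth: "L2_inner M h v = 0" if "h \<in> spectral_space M Xp" for h
    by (rule spectral_space_orthogonal[OF Xm_sub Xp_sub _ v that]) (auto simp: X_minus_def)
  have char: "\<psi> \<cdot>\<^sub>f \<gamma> \<in> spectral_space M Xp" if "\<gamma> \<in> Xp" for \<gamma>
  proof (cases "\<gamma> = unit_char")
    case True
    then show ?thesis using \<psi>s by (simp add: fmult_def unit_char_def)
  next
    case False
    then have "\<psi> \<cdot>\<^sub>f \<gamma> \<in> spectral_space M Xp0" using that by (intro spectral_Xp_fmult_Xp0 \<psi>s) simp
    then show ?thesis by (auto simp: spectral_space_def)
  qed
  have poly: "(\<integral>x. p x * (\<psi> x * cnj (v x)) \<partial>M) = 0" if "p \<in> char_span Xp" for p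
    using that
  proof (induction rule: char_span_induct)
    case (step c \<gamma> p)
    have \<gamma>: "\<gamma> \<in> L2 M" using step(1) by (intro dual_L2 Xp_dual)
    have p: "p \<in> L2 M" using char_span_spectral[OF step(2) Xp_sub] by (rule spectral_space_L2)
    have "(\<integral>x. \<gamma> x * (\<psi> x * cnj (v x)) \<partial>M) = 0"
      using orth[OF char[OF step(1)]] by (simp add: L2_inner_def fmult_def mult_ac)
    then show ?case
      using step(3) L2_integrable_mult[OF \<gamma> w] L2_integrable_mult[OF p w]
      by (simp add: distrib_right mult.assoc)
  qed simp
  obtain F where F: "\<And>n. F n \<in> char_span Xp" "(\<lambda>n. L2_norm M (\<lambda>x. F n x - f x)) \<longlonglongrightarrow> 0"
    using spectral_space_dense[OF Xp_sub f] by blast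
  have FL: "F n \<in> L2 M" for n using char_span_spectral[OF F(1) Xp_sub] by (rule spectral_space_L2)
  have "(\<integral>x. f x * (\<psi> x * cnj (v x)) \<partial>M) = 0"
    using L2_integral_mult_tendsto[OF FL fL F(2) w] by (simp add: poly[OF F(1)] LIMSEQ_const_iff)
  then show ?thesis by (simp add: L2_inner_def fmult_def mult_ac)
qed

text \<open>
  The symbols \<open>\<phi>\<close> and \<open>\<phi> - \<psi>\<close> define the same Hankel operator on \<open>H\<^sup>2\<close>.
\<close>

lemma Hankel_norm_le:
  assumes \<phi>: "\<phi> \<in> L_infty M" and \<psi>: "\<psi> \<in> H_infty M r" and f: "f \<in> spectral_space M Xp"
  shows "L2_norm M (Hankel M r \<phi> f) \<le> L_infty_norm M (\<lambda>x. \<phi> x - \<psi> x) * L2_norm M f"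
proof -
  note fL = spectral_space_L2[OF f]
  define p where "p = Hankel M r \<phi> f"
  have p: "p \<in> spectral_space M Xm" unfolding p_def by (rule Hankel_spec(1)[OF \<phi> fL])
  note pL = spectral_space_L2[OF p]
  have \<psi>i: "\<psi> \<in> L_infty M" using \<psi> by (simp add: H_infty_def)
  have dif: "(\<lambda>x. \<phi> x - \<psi> x) \<in> L_infty M" by (rule L_infty_diff[OF \<phi> \<psi>i])
  have eq: "(\<lambda>x. \<phi> x - \<psi> x) \<cdot>\<^sub>f f = (\<lambda>x. (\<phi> \<cdot>\<^sub>f f) x - (\<psi> \<cdot>\<^sub>f f) x)"
    by (simp add: fmult_def left_diff_distrib)
  have "L2_inner M p p = L2_inner M ((\<lambda>x. \<phi> x - \<psi> x) \<cdot>\<^sub>f f) p"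
    unfolding eq L2_inner_diff[OF L_infty_mult_L2(1)[OF \<phi> fL] L_infty_mult_L2(1)[OF \<psi>i fL] pL]
    using Hankel_spec(2)[OF \<phi> fL p] H_infty_mult_orthogonal[OF \<psi> f p] by (simp add: p_def)
  then have "(L2_norm M p)\<^sup>2 = cmod (L2_inner M ((\<lambda>x. \<phi> x - \<psi> x) \<cdot>\<^sub>f f) p)"
    by (metis L2_inner_self norm_of_real abs_of_nonneg zero_le_power2)
  also have "\<dots> \<le> L2_norm M ((\<lambda>x. \<phi> x - \<psi> x) \<cdot>\<^sub>f f) * L2_norm M p"
    by (intro L2_Cauchy_Schwarz L_infty_mult_L2 dif fL pL)
  also have "\<dots> \<le> (L_infty_norm M (\<lambda>x. \<phi> x - \<psi> x) * L2_norm M f) * L2_norm M p"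
    by (intro mult_right_mono L_infty_mult_L2 dif fL) simp
  finally have "L2_norm M p * L2_norm M p \<le> (L_infty_norm M (\<lambda>x. \<phi> x - \<psi> x) * L2_norm M f) * L2_norm M p"
    by (simp add: power2_eq_square)
  moreover have "0 \<le> L_infty_norm M (\<lambda>x. \<phi> x - \<psi> x) * L2_norm M f"
    using L_infty_AE(3)[OF dif] by simp
  ultimately show ?thesis
    unfolding p_def[symmetric] using L2_norm_nonneg[of M p]
    by (cases "L2_norm M p = 0") (simp_all add: mult_le_cancel_right)
qed

lemma L2_translation:
  assumes "f \<in> L2 M"
  shows "translation g f \<in> L2 M" "L2_norm M (translation g f) = L2_norm M f"
proof -
  have m: "(\<lambda>x. (cmod (f x))\<^sup>2) \<in> borel_measurable M" using assms by (auto simp: L2_def)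
  show "translation g f \<in> L2 M"
    using assms measurable_translate[of f g] integrable_translate[of "\<lambda>x. (cmod (f x))\<^sup>2" g]
    by (simp add: L2_def translation_def)
  show "L2_norm M (translation g f) = L2_norm M f"
    using integral_translate[OF m, of g] by (simp add: L2_norm_def translation_def)
qed

lemma spectral_space_translation:
  assumes "f \<in> spectral_space M S"
  shows "translation g f \<in> spectral_space M S"
proof -
  note fL = spectral_space_L2[OF assms]
  have "fourier M (translation g f) \<gamma> = 0" if \<gamma>: "\<gamma> \<in> dual - S" for \<gamma>
  proof -
    have \<gamma>d: "\<gamma> \<in> dual" using \<gamma> by simp
    have "(\<lambda>x. f x * cnj (\<gamma> x)) \<in> borel_measurable M"
      using L2_integrable_inner[OF fL dual_L2[OF \<gamma>d]] by simp
    from integral_translate[OF this, of g]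
    have "(\<integral>x. f (g + x) * cnj (\<gamma> (g + x)) \<partial>M) = 0"
      using assms \<gamma> by (simp add: spectral_space_def fourier_def)
    moreover have "f (g + x) * cnj (\<gamma> (g + x)) = cnj (\<gamma> g) * (f (g + x) * cnj (\<gamma> x))" for x
      by (simp add: dual_add[OF \<gamma>d])
    ultimately have "cnj (\<gamma> g) * (\<integral>x. f (g + x) * cnj (\<gamma> x) \<partial>M) = 0"
      by (simp only: integral_mult_right_zero)
    moreover have "\<gamma> g \<noteq> 0" using dual_norm[OF \<gamma>d, of g] by auto
    ultimately show ?thesis by (simp add: fourier_def translation_def)
  qed
  then show ?thesis using L2_translation(1)[OF fL] by (simp add: spectral_space_def)
qed

lemma char_span_translation:
  assumes "p \<in> char_span S" "S \<subseteq> dual"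
  shows "translation g p \<in> char_span S"
  using assms(1)
proof (induction rule: char_span_induct)
  case zero
  then show ?case by (simp add: translation_def char_span_zero)
next
  case (step c \<gamma> p)
  have \<gamma>: "\<gamma> \<in> dual" using step assms by blast
  have "(\<lambda>x. (c * \<gamma> g) * \<gamma> x + translation g p x) \<in> char_span S"
    using step by (intro char_span_add char_span_cmult) (auto intro: char_span_char)
  then show ?case by (simp add: translation_def dual_add[OF \<gamma>] mult.assoc)
qed

lemma spectral_Xm_eqI:
  assumes "f \<in> spectral_space M Xm" "h \<in> spectral_space M Xm"
    and "\<And>\<xi>. \<xi> \<in> Xp0 \<Longrightarrow> L2_inner M f (fcnj \<xi>) = L2_inner M h (fcnj \<xi>)"
  shows "AE x in M. f x = h x"
proof -
  note fL = spectral_space_L2[OF assms(1)] and hL = spectral_space_L2[OF assms(2)]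
  have "fourier M (\<lambda>x. f x - h x) \<gamma> = 0" if \<gamma>: "\<gamma> \<in> dual" for \<gamma>
  proof -
    have "fourier M (\<lambda>x. f x - h x) \<gamma> = fourier M f \<gamma> - fourier M h \<gamma>"
      unfolding fourier_eq_inner by (rule L2_inner_diff[OF fL hL dual_L2[OF \<gamma>]])
    also have "\<dots> = 0"
    proof (cases "\<gamma> \<in> Xm")
      case True
      then have "fcnj \<gamma> \<in> Xp0" using fcnj_Xp0_iff[OF \<gamma>] by simp
      from assms(3)[OF this] show ?thesis by (simp add: fourier_eq_inner)
    next
      case False
      then show ?thesis using assms(1,2) \<gamma> by (simp add: spectral_space_def)
    qed
    finally show ?thesis .
  qed
  then have "AE x in M. f x - h x = 0" by (intro fourier_unique_AE L2_integrable L2_diff fL hL)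
  then show ?thesis by eventually_elim simp
qed

lemma domain_between_facts:
  assumes "domain_between M r D"
  shows "char_span Xp \<subseteq> D" "f \<in> D \<Longrightarrow> f \<in> spectral_space M Xp"
    and "f \<in> D \<Longrightarrow> h \<in> D \<Longrightarrow> (\<lambda>x. f x + h x) \<in> D" "f \<in> D \<Longrightarrow> (\<lambda>x. c * f x) \<in> D"
  using assms unfolding domain_between_def H2_eq by blast+

lemma linear_operator_between_facts:
  assumes "linear_operator_between M r D A"
  shows "domain_between M r D" "f \<in> D \<Longrightarrow> A f \<in> spectral_space M Xm"
    and "f \<in> D \<Longrightarrow> h \<in> D \<Longrightarrow> AE x in M. A (\<lambda>y. f y + h y) x = A f x + A h x"
    and "f \<in> D \<Longrightarrow> AE x in M. A (\<lambda>y. c * f y) x = c * A f x"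
  using assms unfolding linear_operator_between_def H2_minus_eq by blast+

lemma operator_combination:
  assumes A: "linear_operator_between M r D A" and f: "f \<in> D" and h: "h \<in> D"
  shows "AE x in M. A (\<lambda>y. c * f y + h y) x = c * A f x + A h x"
proof -
  note D = domain_between_facts[OF linear_operator_between_facts(1)[OF A]]
  from linear_operator_between_facts(3)[OF A D(4)[OF f, of c] h] linear_operator_between_facts(4)[OF A f, of c]
  show ?thesis by eventually_elim simp
qed

text \<open>
  The hypothesis says that \<open>A\<close> composed with the inverse translation has the Hankel matrix of the symbol
  \<open>b\<close>; the factor \<open>\<gamma> g\<close> is undone by the translation.
\<close>

lemma mu_Hankel_form:
  assumes A: "linear_operator_between M r D A"
    and a: "\<And>\<gamma> \<xi>. \<gamma> \<in> Xp \<Longrightarrow> \<xi> \<in> Xp0 \<Longrightarrow> L2_inner M (A \<gamma>) (fcnj \<xi>) = \<gamma> g * (\<integral>x. b x * (\<gamma> x * \<xi> x) \<partial>M)"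
    and b: "b \<in> L2 M" and u: "u \<in> char_span Xp" and v: "v \<in> char_span Xp0"
  shows "(\<integral>x. A (translation (- g) u) x * v x \<partial>M) = (\<integral>x. b x * (u x * v x) \<partial>M)"
proof -
  note D = domain_between_facts[OF linear_operator_between_facts(1)[OF A]]
  have AL: "A f \<in> L2 M" if "f \<in> D" for f
    using linear_operator_between_facts(2)[OF A that] by (rule spectral_space_L2)
  have spD: "translation (- g) p \<in> D" if "p \<in> char_span Xp" for p
    using D(1) char_span_translation[OF that Xp_sub] by blast
  have cts: "continuous_on UNIV (\<lambda>x. p x * q x)" if "p \<in> char_span Xp" "q \<in> char_span Xp0" for p q
    by (intro continuous_intros char_span_continuous[OF that(1) Xp_sub] char_span_continuous[OF that(2) Xp0_sub])
  have bint: "integrable M (\<lambda>x. b x * (p x * q x))" if "p \<in> char_span Xp" "q \<in> char_span Xp0" for p q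
    by (rule L2_integrable_mult[OF b continuous_L2[OF cts[OF that]]])
  have vchar: "(\<integral>x. A (translation (- g) p) x * \<xi> x \<partial>M) = (\<integral>x. b x * (p x * \<xi> x) \<partial>M)"
    if p: "p \<in> char_span Xp" and \<xi>: "\<xi> \<in> Xp0" for p \<xi>
    using p
  proof (induction rule: char_span_induct)
    case zero
    have "AE x in M. A (\<lambda>y. 0 * unit_char y) x = 0 * A unit_char x"
      using D(1) unit_Xp by (intro linear_operator_between_facts(4)[OF A]) (auto intro: char_span_char)
    then have "AE x in M. A (\<lambda>x. 0) x = 0" by simp
    moreover have "(\<lambda>x. 0) \<in> D" using D(1) char_span_zero by blast
    ultimately have "(\<integral>x. A (\<lambda>x. 0) x * \<xi> x \<partial>M) = (\<integral>x. 0 \<partial>M)"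
      using AL[of "\<lambda>x. 0"] dual_L2[of \<xi>] Xp_dual[of \<xi>] \<xi>
      by (intro integral_cong_AE) (auto intro: L2_measurable borel_measurable_times)
    then show ?case by (simp add: translation_def)
  next
    case (step c \<gamma> p)
    have \<gamma>: "\<gamma> \<in> dual" and \<xi>d: "\<xi> \<in> dual" using step \<xi> by (auto intro: Xp_dual)
    have \<gamma>D: "\<gamma> \<in> D" using D(1) step(1) by (auto intro: char_span_char)
    note \<xi>L = dual_L2[OF \<xi>d]
    have "translation (- g) (\<lambda>x. c * \<gamma> x + p x) = (\<lambda>x. (c * \<gamma> (- g)) * \<gamma> x + translation (- g) p x)"
      unfolding translation_def dual_add[OF \<gamma>] by (simp add: mult.assoc)
    then have "AE x in M. A (translation (- g) (\<lambda>x. c * \<gamma> x + p x)) x = (c * \<gamma> (- g)) * A \<gamma> x + A (translation (- g) p) x"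
      using operator_combination[OF A \<gamma>D spD[OF step(2)], of "c * \<gamma> (- g)"] by simp
    moreover have "(\<lambda>x. c * \<gamma> x + p x) \<in> char_span Xp"
      using step by (intro char_span_add char_span_cmult) (auto intro: char_span_char)
    ultimately have "(\<integral>x. A (translation (- g) (\<lambda>x. c * \<gamma> x + p x)) x * \<xi> x \<partial>M) =
        (\<integral>x. (c * \<gamma> (- g)) * (A \<gamma> x * \<xi> x) + A (translation (- g) p) x * \<xi> x \<partial>M)"
      using AL[OF \<gamma>D] AL[OF spD[OF step(2)]] AL[OF spD] \<xi>L
      by (intro integral_cong_AE) (auto simp: algebra_simps dest!: L2_measurable)
    also have "\<dots> = (c * \<gamma> (- g)) * (\<integral>x. A \<gamma> x * \<xi> x \<partial>M) + (\<integral>x. A (translation (- g) p) x * \<xi> x \<partial>M)"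
      using L2_integrable_mult[OF AL[OF \<gamma>D] \<xi>L] L2_integrable_mult[OF AL[OF spD[OF step(2)]] \<xi>L] by simp
    also have "(\<integral>x. A \<gamma> x * \<xi> x \<partial>M) = \<gamma> g * (\<integral>x. b x * (\<gamma> x * \<xi> x) \<partial>M)"
      using a[OF step(1) \<xi>] by (simp add: L2_inner_def fcnj_def)
    also have "c * \<gamma> (- g) * (\<gamma> g * (\<integral>x. b x * (\<gamma> x * \<xi> x) \<partial>M)) = c * (\<integral>x. b x * (\<gamma> x * \<xi> x) \<partial>M)"
      using dual_cnj_mult[OF \<gamma>, of g] by (simp add: dual_uminus[OF \<gamma>] flip: mult.assoc)
    also have "c * (\<integral>x. b x * (\<gamma> x * \<xi> x) \<partial>M) + (\<integral>x. A (translation (- g) p) x * \<xi> x \<partial>M) =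
        (\<integral>x. c * (b x * (\<gamma> x * \<xi> x)) + b x * (p x * \<xi> x) \<partial>M)"
      using bint[OF char_span_char[OF step(1)] char_span_char[OF \<xi>]] bint[OF step(2) char_span_char[OF \<xi>]] step(3)
      by simp
    finally show ?case by (simp add: algebra_simps)
  qed
  from v show ?thesis
  proof (induction rule: char_span_induct)
    case (step c \<xi> q)
    have \<xi>L: "\<xi> \<in> L2 M" and qL: "q \<in> L2 M"
      using step(1,2) Xp0_sub by (auto intro: dual_L2 Xp_dual continuous_L2 char_span_continuous)
    note AuL = AL[OF spD[OF u]]
    have "(\<integral>x. A (translation (- g) u) x * (c * \<xi> x + q x) \<partial>M) =
        (\<integral>x. c * (A (translation (- g) u) x * \<xi> x) + A (translation (- g) u) x * q x \<partial>M)"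
      by (simp add: algebra_simps)
    also have "\<dots> = c * (\<integral>x. b x * (u x * \<xi> x) \<partial>M) + (\<integral>x. b x * (u x * q x) \<partial>M)"
      using L2_integrable_mult[OF AuL \<xi>L] L2_integrable_mult[OF AuL qL] vchar[OF u step(1)] step(3) by simp
    also have "\<dots> = (\<integral>x. c * (b x * (u x * \<xi> x)) + b x * (u x * q x) \<partial>M)"
      using bint[OF u char_span_char[OF step(1)]] bint[OF u step(2)] by simp
    finally show ?case by (simp add: algebra_simps)
  qed simp
qed

lemma bounded_form:
  assumes A: "linear_operator_between M r D A"
    and a: "\<And>\<gamma> \<xi>. \<gamma> \<in> Xp \<Longrightarrow> \<xi> \<in> Xp0 \<Longrightarrow> L2_inner M (A \<gamma>) (fcnj \<xi>) = \<gamma> g * (\<integral>x. b x * (\<gamma> x * \<xi> x) \<partial>M)"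
    and b: "b \<in> L2 M" and C: "\<And>f. f \<in> D \<Longrightarrow> L2_norm M (A f) \<le> C * L2_norm M f"
    and u: "u \<in> char_span Xp" and v: "v \<in> char_span Xp0"
  shows "cmod (\<integral>x. b x * (u x * v x) \<partial>M) \<le> C * L2_norm M u * L2_norm M v"
proof -
  note D = domain_between_facts[OF linear_operator_between_facts(1)[OF A]]
  have uL: "u \<in> L2 M" and vL: "v \<in> L2 M"
    using u v Xp_sub Xp0_sub by (auto intro: continuous_L2 char_span_continuous)
  have uD: "translation (- g) u \<in> D" using D(1) char_span_translation[OF u Xp_sub] by blast
  have "cmod (\<integral>x. A (translation (- g) u) x * v x \<partial>M) \<le> L2_norm M (A (translation (- g) u)) * L2_norm M v"
    using linear_operator_between_facts(2)[OF A uD] by (intro L2_Cauchy_Schwarz_mult vL spectral_space_L2)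
  also have "\<dots> \<le> C * L2_norm M (translation (- g) u) * L2_norm M v"
    by (intro mult_right_mono C uD) simp
  also have "L2_norm M (translation (- g) u) = L2_norm M u" by (rule L2_translation(2)[OF uL])
  also have "(\<integral>x. A (translation (- g) u) x * v x \<partial>M) = (\<integral>x. b x * (u x * v x) \<partial>M)"
    by (rule mu_Hankel_form[OF A a b u v])
  finally show ?thesis .
qed

lemma op_eq_Hankel_inner:
  assumes A: "linear_operator_between M r D A" and \<phi>: "\<phi> \<in> L_infty M"
    and eq: "op_eq M D A (\<lambda>f. Hankel M r \<phi> (translation g f))"
    and \<gamma>: "\<gamma> \<in> Xp" and \<xi>: "\<xi> \<in> Xp0"
  shows "L2_inner M (A \<gamma>) (fcnj \<xi>) = \<gamma> g * (\<integral>x. \<phi> x * (\<gamma> x * \<xi> x) \<partial>M)"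
proof -
  note D = domain_between_facts[OF linear_operator_between_facts(1)[OF A]]
  have d: "\<gamma> \<in> dual" "\<xi> \<in> dual" using \<gamma> \<xi> by (auto intro: Xp_dual)
  have \<gamma>D: "\<gamma> \<in> D" using D(1) \<gamma> by (auto intro: char_span_char)
  have tL: "translation g \<gamma> \<in> L2 M" by (intro L2_translation dual_L2 d)
  have \<xi>m: "fcnj \<xi> \<in> spectral_space M Xm"
    using \<xi> fcnj_Xm_iff[OF d(2)] by (intro spectral_space_char dual_fcnj d) simp
  have "AE x in M. A \<gamma> x = Hankel M r \<phi> (translation g \<gamma>) x" using eq \<gamma>D by (simp add: op_eq_def)
  then have "L2_inner M (A \<gamma>) (fcnj \<xi>) = L2_inner M (Hankel M r \<phi> (translation g \<gamma>)) (fcnj \<xi>)"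
    using linear_operator_between_facts(2)[OF A \<gamma>D] Hankel_spec(1)[OF \<phi> tL] \<xi>m
    by (intro L2_inner_cong_AE L2_measurable spectral_space_L2)
  also have "\<dots> = L2_inner M (\<phi> \<cdot>\<^sub>f translation g \<gamma>) (fcnj \<xi>)" by (rule Hankel_spec(2)[OF \<phi> tL \<xi>m])
  also have "\<dots> = (\<integral>x. \<gamma> g * (\<phi> x * (\<gamma> x * \<xi> x)) \<partial>M)"
    by (simp add: L2_inner_def fmult_def fcnj_def translation_def dual_add[OF d(1)] mult_ac)
  also have "\<dots> = \<gamma> g * (\<integral>x. \<phi> x * (\<gamma> x * \<xi> x) \<partial>M)" by (rule integral_mult_right_zero)
  finally show ?thesis .
qed

lemma op_eq_Hankel_norm_le:
  assumes A: "linear_operator_between M r D A" and \<phi>: "\<phi> \<in> L_infty M" and \<psi>: "\<psi> \<in> H_infty M r"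
    and eq: "op_eq M D A (\<lambda>f. Hankel M r \<phi> (translation g f))" and f: "f \<in> D"
  shows "L2_norm M (A f) \<le> L_infty_norm M (\<lambda>x. \<phi> x - \<psi> x) * L2_norm M f"
proof -
  note D = domain_between_facts[OF linear_operator_between_facts(1)[OF A]]
  have fs: "f \<in> spectral_space M Xp" by (rule D(2)[OF f])
  note fL = spectral_space_L2[OF fs]
  have t: "translation g f \<in> spectral_space M Xp" by (rule spectral_space_translation[OF fs])
  have "AE x in M. A f x = Hankel M r \<phi> (translation g f) x" using eq f by (simp add: op_eq_def)
  then have "L2_norm M (A f) = L2_norm M (Hankel M r \<phi> (translation g f))"
    using linear_operator_between_facts(2)[OF A f] Hankel_spec(1)[OF \<phi> spectral_space_L2[OF t]]
    by (intro L2_norm_cong_AE L2_measurable spectral_space_L2)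
  also have "\<dots> \<le> L_infty_norm M (\<lambda>x. \<phi> x - \<psi> x) * L2_norm M (translation g f)"
    by (rule Hankel_norm_le[OF \<phi> \<psi> t])
  finally show ?thesis by (simp add: L2_translation(2)[OF fL])
qed

lemma zero_H_infty: "(\<lambda>x. 0) \<in> H_infty M r"
  using L_infty_bounded(1)[of "\<lambda>x. 0" 0] by (simp add: H_infty_def fourier_def)

text \<open>
  Every symbol \<open>\<phi> - \<psi>\<close> with \<open>\<psi>\<close> in \<open>H\<^sup>\<infinity>\<close> bounds the norm from above. Conversely, Nehari's theorem for
  \<open>b = \<phi>\<close> yields a symbol of the same operator whose supremum norm is at most the operator norm.
\<close>

theorem op_norm_eq_dist:
  assumes A: "linear_operator_between M r D A" and \<phi>: "\<phi> \<in> L_infty M"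
    and eq: "op_eq M D A (\<lambda>f. Hankel M r \<phi> (translation g f))"
  shows "op_norm M D A = L_infty_dist M \<phi> (H_infty M r)"
proof (rule antisym)
  note D = domain_between_facts[OF linear_operator_between_facts(1)[OF A]]
  note le = op_eq_Hankel_norm_le[OF A \<phi> _ eq]
  have nn: "0 \<le> L_infty_norm M (\<lambda>x. \<phi> x - \<psi> x)" if "\<psi> \<in> H_infty M r" for \<psi>
    using L_infty_AE(3)[OF L_infty_diff[OF \<phi>]] that by (simp add: H_infty_def)
  have le1: "L2_norm M (A f) \<le> L_infty_norm M (\<lambda>x. \<phi> x - \<psi> x)"
    if "f \<in> D" "L2_norm M f \<le> 1" "\<psi> \<in> H_infty M r" for f \<psi>
    using le[OF that(3,1)] mult_left_mono[OF that(2) nn[OF that(3)]] by simp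
  have zero_D: "(\<lambda>x. 0) \<in> D" using D(1) char_span_zero by blast
  show "op_norm M D A \<le> L_infty_dist M \<phi> (H_infty M r)"
    unfolding op_norm_def L_infty_dist_def
  proof (intro cSUP_least cINF_greatest)
    show "{f \<in> D. L2_norm M f \<le> 1} \<noteq> {}" using zero_D by (auto intro!: exI[of _ "\<lambda>x. 0"])
    show "H_infty M r \<noteq> {}" using zero_H_infty by blast
    show "L2_norm M (A f) \<le> L_infty_norm M (\<lambda>x. \<phi> x - \<psi> x)"
      if "f \<in> {f \<in> D. L2_norm M f \<le> 1}" "\<psi> \<in> H_infty M r" for f \<psi>
      using that by (intro le1) auto
  qed
  define C where "C = op_norm M D A"
  have bdd: "bdd_above ((\<lambda>f. L2_norm M (A f)) ` {f \<in> D. L2_norm M f \<le> 1})"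
    by (rule bdd_aboveI2) (use le1[OF _ _ zero_H_infty] in blast)
  have C_ge: "L2_norm M (A f) \<le> C" if "f \<in> D" "L2_norm M f \<le> 1" for f
    unfolding C_def op_norm_def using that by (intro cSUP_upper bdd) auto
  have "L2_norm M (A (\<lambda>x. 0)) \<le> C" by (rule C_ge[OF zero_D]) simp
  then have C_nn: "0 \<le> C" by (rule order_trans[OF L2_norm_nonneg])
  have C_le: "L2_norm M (A f) \<le> C * L2_norm M f" if f: "f \<in> D" for f
  proof (cases "L2_norm M f = 0")
    case True
    then show ?thesis using le[OF zero_H_infty f] by simp
  next
    case False
    then have pos: "L2_norm M f > 0" using L2_norm_nonneg[of M f] by linarith
    define c where "c = complex_of_real (1 / L2_norm M f)"
    have c: "cmod c = 1 / L2_norm M f" using pos by (simp add: c_def norm_divide)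
    have cD: "(\<lambda>x. c * f x) \<in> D" by (rule D(4)[OF f])
    have "L2_norm M (\<lambda>x. c * f x) \<le> 1" using pos by (simp add: L2_norm_cmult c)
    then have "L2_norm M (A (\<lambda>x. c * f x)) \<le> C" by (rule C_ge[OF cD])
    moreover have "L2_norm M (A (\<lambda>x. c * f x)) = L2_norm M (\<lambda>x. c * A f x)"
      using linear_operator_between_facts(2)[OF A] linear_operator_between_facts(4)[OF A f] f cD
      by (intro L2_norm_cong_AE L2_measurable L2_cmult spectral_space_L2)
    ultimately show ?thesis using pos by (simp add: L2_norm_cmult c field_simps)
  qed
  have \<phi>L: "\<phi> \<in> L2 M" by (rule L_infty_L2[OF \<phi>])
  have "\<And>u v. u \<in> char_span Xp \<Longrightarrow> v \<in> char_span Xp0 \<Longrightarrow>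
      cmod (\<integral>x. \<phi> x * (u x * v x) \<partial>M) \<le> C * L2_norm M u * L2_norm M v"
    by (rule bounded_form[OF A op_eq_Hankel_inner[OF A \<phi> eq] \<phi>L C_le])
  from Nehari[OF \<phi>L C_nn this]
  obtain \<phi>' where \<phi>': "\<phi>' \<in> L2 M" "AE x in M. cmod (\<phi>' x) \<le> C"
    "\<And>\<gamma>. \<gamma> \<in> Xm \<Longrightarrow> fourier M \<phi>' \<gamma> = fourier M \<phi> \<gamma>" by blast
  note \<phi>'i = L_infty_bounded[OF L2_measurable[OF \<phi>'(1)] \<phi>'(2)]
  have "(\<lambda>x. \<phi> x - \<phi>' x) \<in> H_infty M r"
    using L_infty_diff[OF \<phi> \<phi>'i(1)] \<phi>'(3)
    by (auto simp: H_infty_def fourier_eq_inner L2_inner_diff \<phi>L \<phi>'(1) dual_L2 Xm_dual)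
  then have "L_infty_dist M \<phi> (H_infty M r) \<le> L_infty_norm M (\<lambda>x. \<phi> x - (\<phi> x - \<phi>' x))"
    unfolding L_infty_dist_def using nn by (intro cINF_lower bdd_belowI2[of _ 0]) auto
  also have "\<dots> \<le> C" using \<phi>'i(2) by simp
  finally show "L_infty_dist M \<phi> (H_infty M r) \<le> op_norm M D A" by (simp add: C_def)
qed

text \<open>
  The function \<open>b = A 1\<close> is a square-integrable symbol on the polynomials, and Nehari's theorem replaces
  it by a bounded one. Since the polynomials are dense in \<open>H\<^sup>2\<close> and both operators are
  bounded, they then agree on all of \<open>D\<close>.
\<close>

theorem bounded_mu_Hankel_imp_Hankel:
  assumes A: "linear_operator_between M r D A" and bdd: "bounded_operator M D A"
    and \<mu>: "mu_Hankel M r \<mu> A" and g: "\<And>\<gamma>. \<gamma> \<in> Xp \<Longrightarrow> \<gamma> g = \<mu> \<gamma>"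
  obtains \<phi> where "\<phi> \<in> L_infty M" "op_eq M D A (\<lambda>f. Hankel M r \<phi> (translation g f))"
proof -
  note D = domain_between_facts[OF linear_operator_between_facts(1)[OF A]]
  have AL: "A f \<in> L2 M" if "f \<in> D" for f
    using linear_operator_between_facts(2)[OF A that] by (rule spectral_space_L2)
  obtain C where "\<And>f. f \<in> D \<Longrightarrow> L2_norm M (A f) \<le> C * L2_norm M f"
    using bdd by (auto simp: bounded_operator_def)
  then have C: "L2_norm M (A f) \<le> \<bar>C\<bar> * L2_norm M f" if "f \<in> D" for f
    using that mult_right_mono[OF abs_ge_self[of C] L2_norm_nonneg[of M f]] by (meson order_trans)
  obtain a where a: "\<And>\<gamma> \<xi>. \<gamma> \<in> Xp \<Longrightarrow> \<xi> \<in> Xp0 \<Longrightarrow> L2_inner M (A \<gamma>) (fcnj \<xi>) = \<mu> \<gamma> * a (\<gamma> \<cdot>\<^sub>f \<xi>)"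
    using \<mu> unfolding mu_Hankel_def by blast
  define b where "b = A unit_char"
  have "unit_char \<in> D" using D(1) unit_Xp by (auto intro: char_span_char)
  then have bL: "b \<in> L2 M" unfolding b_def by (rule AL)
  have "\<mu> unit_char = 1" using g[OF unit_Xp] by (simp add: unit_char_def)
  then have a_b: "a \<eta> = (\<integral>x. b x * \<eta> x \<partial>M)" if "\<eta> \<in> Xp0" for \<eta>
    using a[OF unit_Xp that] by (simp add: b_def L2_inner_def fcnj_def)
  have form: "L2_inner M (A \<gamma>) (fcnj \<xi>) = \<gamma> g * (\<integral>x. b x * (\<gamma> x * \<xi> x) \<partial>M)" if "\<gamma> \<in> Xp" "\<xi> \<in> Xp0" for \<gamma> \<xi>
    using a[OF that] a_b[OF Xp_fmult_Xp0[OF that]] g[OF that(1)] by (simp add: fmult_def)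
  obtain \<phi> where \<phi>: "\<phi> \<in> L2 M" "AE x in M. cmod (\<phi> x) \<le> \<bar>C\<bar>" "\<And>\<gamma>. \<gamma> \<in> Xm \<Longrightarrow> fourier M \<phi> \<gamma> = fourier M b \<gamma>"
    using Nehari[OF bL abs_ge_zero bounded_form[OF A form bL C]] by blast
  have \<phi>i: "\<phi> \<in> L_infty M" by (rule L_infty_bounded(1)[OF L2_measurable[OF \<phi>(1)] \<phi>(2)])
  have form_\<phi>: "L2_inner M (A \<gamma>) (fcnj \<xi>) = \<gamma> g * (\<integral>x. \<phi> x * (\<gamma> x * \<xi> x) \<partial>M)" if "\<gamma> \<in> Xp" "\<xi> \<in> Xp0" for \<gamma> \<xi>
  proof -
    have d: "\<gamma> \<cdot>\<^sub>f \<xi> \<in> Xp0" by (rule Xp_fmult_Xp0[OF that])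
    then have "fcnj (\<gamma> \<cdot>\<^sub>f \<xi>) \<in> Xm" using fcnj_Xm_iff[of "\<gamma> \<cdot>\<^sub>f \<xi>"] by (auto intro: Xp_dual)
    from \<phi>(3)[OF this] show ?thesis
      using form[OF that] by (simp add: fourier_def fcnj_def fmult_def)
  qed
  have "AE x in M. A f x = Hankel M r \<phi> (translation g f) x" if f: "f \<in> D" for f
  proof (rule spectral_Xm_eqI)
    have fs: "f \<in> spectral_space M Xp" by (rule D(2)[OF f])
    note fL = spectral_space_L2[OF fs]
    have tL: "translation g f \<in> L2 M" by (rule L2_translation(1)[OF fL])
    show "A f \<in> spectral_space M Xm" by (rule linear_operator_between_facts(2)[OF A f])
    show "Hankel M r \<phi> (translation g f) \<in> spectral_space M Xm" by (rule Hankel_spec(1)[OF \<phi>i tL])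
    fix \<xi> assume \<xi>: "\<xi> \<in> Xp0"
    then have \<xi>d: "\<xi> \<in> dual" by (auto intro: Xp_dual)
    note \<xi>L = dual_L2[OF \<xi>d]
    have \<xi>m: "fcnj \<xi> \<in> spectral_space M Xm"
      using \<xi> fcnj_Xm_iff[OF \<xi>d] by (intro spectral_space_char dual_fcnj \<xi>d) simp
    obtain F where F: "\<And>n. F n \<in> char_span Xp" "(\<lambda>n. L2_norm M (\<lambda>x. F n x - f x)) \<longlonglongrightarrow> 0"
      using spectral_space_dense[OF Xp_sub fs] by blast
    have FD: "F n \<in> D" for n using F(1) D(1) by blast
    have FL: "F n \<in> L2 M" for n using spectral_space_L2[OF D(2)[OF FD]] .
    have AF: "(\<lambda>n. L2_norm M (\<lambda>x. A (F n) x - A f x)) \<longlonglongrightarrow> 0"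
    proof (rule tendsto_sandwich[OF _ _ tendsto_const tendsto_mult_right_zero[OF F(2), of "\<bar>C\<bar>"]])
      have "L2_norm M (\<lambda>x. A (F n) x - A f x) \<le> \<bar>C\<bar> * L2_norm M (\<lambda>x. F n x - f x)" for n
      proof -
        have dD: "(\<lambda>x. (-1) * f x + F n x) \<in> D" by (intro D(3,4) f FD)
        have "AE x in M. A (\<lambda>x. (-1) * f x + F n x) x = (-1) * A f x + A (F n) x"
          by (rule operator_combination[OF A f FD])
        then have "AE x in M. A (\<lambda>x. (-1) * f x + F n x) x = A (F n) x - A f x"
          by eventually_elim simp
        then have "L2_norm M (\<lambda>x. A (F n) x - A f x) = L2_norm M (A (\<lambda>x. (-1) * f x + F n x))"
          by (intro L2_norm_cong_AE[symmetric] L2_measurable L2_diff AL FD f dD)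
        then show ?thesis using C[OF dD] by simp
      qed
      then show "\<forall>\<^sub>F n in sequentially. L2_norm M (\<lambda>x. A (F n) x - A f x) \<le> \<bar>C\<bar> * L2_norm M (\<lambda>x. F n x - f x)"
        by simp
    qed simp
    have "(\<lambda>n. \<integral>x. A (F n) x * \<xi> x \<partial>M) \<longlonglongrightarrow> (\<integral>x. A f x * \<xi> x \<partial>M)"
      by (rule L2_integral_mult_tendsto[OF AL[OF FD] AL[OF f] AF \<xi>L])
    moreover have "(\<integral>x. A (F n) x * \<xi> x \<partial>M) = (\<integral>x. translation g (F n) x * (\<phi> x * \<xi> x) \<partial>M)" for n
    proof -
      have u: "translation g (F n) \<in> char_span Xp" by (rule char_span_translation[OF F(1) Xp_sub])
      have "translation (- g) (translation g (F n)) = F n" by (simp add: translation_def)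
      then show ?thesis
        using mu_Hankel_form[OF A form_\<phi> \<phi>(1) u char_span_char[OF \<xi>]] by (simp add: mult_ac)
    qed
    moreover have "(\<lambda>n. \<integral>x. translation g (F n) x * (\<phi> x * \<xi> x) \<partial>M) \<longlonglongrightarrow>
        (\<integral>x. translation g f x * (\<phi> x * \<xi> x) \<partial>M)"
    proof (rule L2_integral_mult_tendsto[OF L2_translation(1)[OF FL] tL])
      have "(\<lambda>x. translation g (F n) x - translation g f x) = translation g (\<lambda>x. F n x - f x)" for n
        by (simp add: translation_def)
      then show "(\<lambda>n. L2_norm M (\<lambda>x. translation g (F n) x - translation g f x)) \<longlonglongrightarrow> 0"
        using F(2) by (simp add: L2_translation(2)[OF L2_diff[OF FL fL]])
      show "(\<lambda>x. \<phi> x * \<xi> x) \<in> L2 M"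
        using L_infty_mult_L2(1)[OF \<phi>i \<xi>L] by (simp add: fmult_def)
    qed
    ultimately have "(\<integral>x. A f x * \<xi> x \<partial>M) = (\<integral>x. translation g f x * (\<phi> x * \<xi> x) \<partial>M)"
      using LIMSEQ_unique by simp
    then show "L2_inner M (A f) (fcnj \<xi>) = L2_inner M (Hankel M r \<phi> (translation g f)) (fcnj \<xi>)"
      unfolding Hankel_spec(2)[OF \<phi>i tL \<xi>m] by (simp add: L2_inner_def fmult_def fcnj_def mult_ac)
  qed
  then have "op_eq M D A (\<lambda>f. Hankel M r \<phi> (translation g f))" by (simp add: op_eq_def)
  with \<phi>i show thesis by (rule that)
qed

lemma Hankel_imp_bounded_mu_Hankel:
  assumes A: "linear_operator_between M r D A" and \<phi>: "\<phi> \<in> L_infty M"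
    and eq: "op_eq M D A (\<lambda>f. Hankel M r \<phi> (translation g f))"
    and g: "\<And>\<gamma>. \<gamma> \<in> Xp \<Longrightarrow> \<gamma> g = \<mu> \<gamma>"
  shows "bounded_operator M D A" "mu_Hankel M r \<mu> A"
proof -
  show "bounded_operator M D A"
    unfolding bounded_operator_def using op_eq_Hankel_norm_le[OF A \<phi> zero_H_infty eq] by blast
  show "mu_Hankel M r \<mu> A"
    unfolding mu_Hankel_def
    by (rule exI[of _ "\<lambda>\<eta>. \<integral>x. \<phi> x * \<eta> x \<partial>M"])
       (use op_eq_Hankel_inner[OF A \<phi> eq] g in \<open>auto simp: fmult_def\<close>)
qed

end

theorem theorem6:
  fixes M :: "'g::{topological_ab_group_add, t2_space} measure"
    and r :: "('g \<Rightarrow> complex) rel"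
    and \<mu> :: "('g \<Rightarrow> complex) \<Rightarrow> complex"
  assumes "compact (UNIV :: 'g set)"
    and "connected (UNIV :: 'g set)"
    and "normalized_haar M"
    and "dual_order r"
    and "generalized_semicharacter r \<mu>"
    and "\<forall>\<gamma>\<in>X_plus r. cmod (\<mu> \<gamma>) = 1"
  shows "\<exists>g. \<forall>D A. linear_operator_between M r D A \<longrightarrow>
     ((bounded_operator M D A \<and> mu_Hankel M r \<mu> A \<longleftrightarrow>
        (\<exists>\<phi>\<in>L_infty M. op_eq M D A (\<lambda>f. Hankel M r \<phi> (translation g f)))) \<and>
      (\<forall>h. \<forall>\<phi>\<in>L_infty M. op_eq M D A (\<lambda>f. Hankel M r \<phi> (translation h f)) \<longrightarrow>
        op_norm M D A = L_infty_dist M \<phi> (H_infty M r)))"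
proof -
  interpret ordered_haar M r
    using assms(1,3,4) by unfold_locales
  obtain g where g: "\<And>\<gamma>. \<gamma> \<in> X_plus r \<Longrightarrow> \<gamma> g = \<mu> \<gamma>"
    using semicharacter_point[OF assms(5,6)] by blast
  show ?thesis
  proof (intro exI[of _ g] allI impI conjI ballI)
    fix D A assume A: "linear_operator_between M r D A"
    show "bounded_operator M D A \<and> mu_Hankel M r \<mu> A \<longleftrightarrow>
        (\<exists>\<phi>\<in>L_infty M. op_eq M D A (\<lambda>f. Hankel M r \<phi> (translation g f)))"
    proof
      assume B: "bounded_operator M D A \<and> mu_Hankel M r \<mu> A"
      show "\<exists>\<phi>\<in>L_infty M. op_eq M D A (\<lambda>f. Hankel M r \<phi> (translation g f))"
        by (rule bounded_mu_Hankel_imp_Hankel[OF A conjunct1[OF B] conjunct2[OF B] g]) (assumption, rule bexI)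
    next
      assume "\<exists>\<phi>\<in>L_infty M. op_eq M D A (\<lambda>f. Hankel M r \<phi> (translation g f))"
      then obtain \<phi> where \<phi>: "\<phi> \<in> L_infty M" "op_eq M D A (\<lambda>f. Hankel M r \<phi> (translation g f))" ..
      from Hankel_imp_bounded_mu_Hankel[OF A \<phi>, of \<mu>] g
      show "bounded_operator M D A \<and> mu_Hankel M r \<mu> A" by blast
    qed
  next
    fix D A h \<phi> assume "linear_operator_between M r D A" "\<phi> \<in> L_infty M"
      "op_eq M D A (\<lambda>f. Hankel M r \<phi> (translation h f))"
    then show "op_norm M D A = L_infty_dist M \<phi> (H_infty M r)" by (rule op_norm_eq_dist)
  qed
qed

end
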